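(* Let $m,n\ge1$. The side-length map $\overline{\mathbf s}:\mathrm{CPol}\to\mathbb R^n$ is a (trivial) fiber bundle over each chamber of $C(n,m+1)$. Hence if $\mathbf r$ and $\mathbf r'$ lie in the same chamber, the moduli spaces $M_{\mathbf r}$ and $M_{\mathbf r'}$ are diffeomorphic.
   Context: For a unit vector $w\in\mathbb C^{m+1}$, $w\otimes w^*$ is the projection $v\mapsto(v,w)w$. $\mathrm{CPol}$ is the set of closed polygons with arbitrary positive side-lengths, i.e. of $n$-tuples $\mathbf e=(e_1,\dots,e_n)$ of rank-one positive semidefinite Hermitian $(m+1)\times(m+1)$ matrices, $e_i=r_i\,w_i\otimes w_i^*$ ($r_i>0$, $\|w_i\|=1$), such that $\sum_i e_i$ is a scalar multiple of the identity $\mathbb I$. The side-length map $\overline{\mathbf s}$ sends $\mathbf e$ to $(r_1,\dots,r_n)$. For $\mathbf r\in(\mathbb R_{>0})^n$, $\widetilde M_{\mathbf r}=\overline{\mathbf s}^{-1}(\mathbf r)$ is the set of closed polygons with side-lengths $\mathbf r$, and the moduli space is $M_{\mathbf r}=\widetilde M_{\mathbf r}/U(m+1)$, where $U(m+1)$ acts by simultaneous conjugation. $C(n,m+1)$ is the set of $\mathbf r\in(\mathbb R_{>0})^n$ with $M_{\mathbf r}\ne\emptyset$ (equivalently $m r_i\le\sum_{j\ne i}r_j$ for all $i$). For $1\le k\le m$ and a partition $\{1,\dots,n\}=I\sqcup J$ into nonempty subsets, the wall $W_{I,J,k}$ is $\{\mathbf r\in C(n,m+1): k\sum_{i\in I}r_i=(m-k+1)\sum_{j\in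 J}r_j\}$. A chamber is a connected component of the complement in $C(n,m+1)$ of the union of all walls. *)

theory Defs
  imports "HOL-Analysis.Analysis"
begin

section \<open>Smooth functions and smooth spaces\<close>

text \<open>\<open>C_diff k U f\<close> is meant for open \<open>U\<close> only, where it says that \<open>f\<close> is \<open>k\<close> times
  continuously differentiable on \<open>U\<close>.\<close>

fun C_diff :: "nat \<Rightarrow> 'a::euclidean_space set \<Rightarrow> ('a \<Rightarrow> 'b::real_normed_vector) \<Rightarrow> bool" where
  "C_diff 0 U f \<longleftrightarrow> continuous_on U f"
| "C_diff (Suc k) U f \<longleftrightarrow> (\<forall>x\<in>U. f differentiable (at x)) \<and>
     (\<forall>v. C_diff k U (\<lambda>x. frechet_derivative f (at x) v))"

definition smooth_on :: "'a::euclidean_space set \<Rightarrow> ('a \<Rightarrow> 'b::real_normed_vector) \<Rightarrow> bool" where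
  "smooth_on U f \<longleftrightarrow> (\<forall>k. C_diff k U f)"

text \<open>Smooth structures are given by their sheaves of smooth real functions (functionally
  structured spaces, as in Bredon, \<^emph>\<open>Topology and Geometry\<close>, II.2).
  \<open>sfun X U\<close> collects the functions that are smooth on the open set \<open>U\<close>; their values outside
  \<open>U\<close> carry no information, and \<open>sfun X U\<close> is never used for a \<open>U\<close> that is not open in \<open>X\<close>.\<close>

record 'a smooth_space =
  stop :: "'a topology"
  sfun :: "'a set \<Rightarrow> ('a \<Rightarrow> real) set"

definition smooth_map :: "'a smooth_space \<Rightarrow> 'b smooth_space \<Rightarrow> ('a \<Rightarrow> 'b) \<Rightarrow> bool" where
  "smooth_map X Y \<phi> \<longleftrightarrow> continuous_map (stop X) (stop Y) \<phi> \<and>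
     (\<forall>V f. openin (stop Y) V \<longrightarrow> f \<in> sfun Y V \<longrightarrow>
        f \<circ> \<phi> \<in> sfun X {x \<in> topspace (stop X). \<phi> x \<in> V})"

definition diffeomorphism :: "'a smooth_space \<Rightarrow> 'b smooth_space \<Rightarrow> ('a \<Rightarrow> 'b) \<Rightarrow> bool" where
  "diffeomorphism X Y \<phi> \<longleftrightarrow> (\<exists>\<psi>. smooth_map X Y \<phi> \<and> smooth_map Y X \<psi> \<and>
     (\<forall>x \<in> topspace (stop X). \<psi> (\<phi> x) = x) \<and> (\<forall>y \<in> topspace (stop Y). \<phi> (\<psi> y) = y))"

text \<open>A subset of a Euclidean space: a function on it is smooth if locally it is the restriction
  of a smooth function on an open subset of the ambient space.\<close>

definition eucl_space :: "'a::euclidean_space set \<Rightarrow> 'a smooth_space" where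
  "eucl_space S = \<lparr> stop = top_of_set S,
     sfun = (\<lambda>U. {f. \<forall>x\<in>U. \<exists>W g. open W \<and> x \<in> W \<and> smooth_on W g \<and> (\<forall>y \<in> U \<inter> W. g y = f y)}) \<rparr>"

definition open_subspace :: "'a smooth_space \<Rightarrow> 'a set \<Rightarrow> 'a smooth_space" where
  "open_subspace X U = X \<lparr> stop := subtopology (stop X) U \<rparr>"

definition quotient_topology :: "'a topology \<Rightarrow> ('a \<Rightarrow> 'b) \<Rightarrow> 'b topology" where
  "quotient_topology T p =
     topology (\<lambda>U. U \<subseteq> p ` topspace T \<and> openin T {x \<in> topspace T. p x \<in> U})"

lemma openin_quotient_topology:
  "openin (quotient_topology T p) U \<longleftrightarrow>
     U \<subseteq> p ` topspace T \<and> openin T {x \<in> topspace T. p x \<in> U}"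
proof -
  have "istopology (\<lambda>U. U \<subseteq> p ` topspace T \<and> openin T {x \<in> topspace T. p x \<in> U})"
    unfolding istopology_def
  proof (intro conjI allI impI)
    fix S U
    assume "S \<subseteq> p ` topspace T \<and> openin T {x \<in> topspace T. p x \<in> S}"
      and "U \<subseteq> p ` topspace T \<and> openin T {x \<in> topspace T. p x \<in> U}"
    moreover have "{x \<in> topspace T. p x \<in> S \<inter> U} =
        {x \<in> topspace T. p x \<in> S} \<inter> {x \<in> topspace T. p x \<in> U}" by auto
    ultimately show "S \<inter> U \<subseteq> p ` topspace T" "openin T {x \<in> topspace T. p x \<in> S \<inter> U}"
      by (blast, simp only: openin_Int)
  next
    fix K
    assume K: "\<forall>U\<in>K. U \<subseteq> p ` topspace T \<and> openin T {x \<in> topspace T. p x \<in> U}"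
    then show "\<Union> K \<subseteq> p ` topspace T" by auto
    have "{x \<in> topspace T. p x \<in> \<Union> K} = (\<Union>U\<in>K. {x \<in> topspace T. p x \<in> U})" by auto
    moreover have "openin T (\<Union>U\<in>K. {x \<in> topspace T. p x \<in> U})"
      using K by (intro openin_Union) blast
    ultimately show "openin T {x \<in> topspace T. p x \<in> \<Union> K}" by (simp only:)
  qed
  then show ?thesis unfolding quotient_topology_def by (subst topology_inverse') (auto simp only:)
qed

lemma topspace_quotient_topology: "topspace (quotient_topology T p) = p ` topspace T"
proof -
  have "{x \<in> topspace T. p x \<in> p ` topspace T} = topspace T" by auto
  then have "openin (quotient_topology T p) (p ` topspace T)"
    by (simp add: openin_quotient_topology)
  moreover have "topspace (quotient_topology T p) \<subseteq> p ` topspace T"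
    using openin_quotient_topology[of T p "topspace (quotient_topology T p)"] by simp
  ultimately show ?thesis by (meson openin_subset subset_antisym)
qed

text \<open>The quotient structure: a function downstairs is smooth iff its pullback is. For a free
  proper action of a Lie group on a manifold this is the usual quotient manifold, for which the
  projection is a submersion.\<close>

definition quotient_space :: "'a smooth_space \<Rightarrow> ('a \<Rightarrow> 'b) \<Rightarrow> 'b smooth_space" where
  "quotient_space X p = \<lparr> stop = quotient_topology (stop X) p,
     sfun = (\<lambda>U. {f. f \<circ> p \<in> sfun X {x \<in> topspace (stop X). p x \<in> U}}) \<rparr>"

text \<open>Smooth manifolds without boundary. The model \<open>\<real>\<^sup>d\<close> is a \<open>d\<close>-dimensional linear subspace
  \<open>L\<close> of some sufficiently large Euclidean type \<open>'e\<close>, since \<open>d\<close> itself need not be the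
  dimension of a type that can be named.\<close>

definition smooth_manifold :: "'e::euclidean_space itself \<Rightarrow> 'a smooth_space \<Rightarrow> bool" where
  "smooth_manifold _ X \<longleftrightarrow> Hausdorff_space (stop X) \<and> second_countable (stop X) \<and>
     (\<exists>L :: 'e set. subspace L \<and>
        (\<forall>x \<in> topspace (stop X). \<exists>U V \<phi>. openin (stop X) U \<and> x \<in> U \<and>
           openin (top_of_set L) V \<and> diffeomorphism (open_subspace X U) (eucl_space V) \<phi>))"

definition diffeomorphic_manifolds ::
  "'e::euclidean_space itself \<Rightarrow> 'a smooth_space \<Rightarrow> 'b smooth_space \<Rightarrow> bool" where
  "diffeomorphic_manifolds E X Y \<longleftrightarrow>
     smooth_manifold E X \<and> smooth_manifold E Y \<and> (\<exists>\<phi>. diffeomorphism X Y \<phi>)"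

text \<open>A smooth trivialization \<open>h\<close> of \<open>p : E \<rightarrow> B\<close>. A typical fibre is diffeomorphic to any fibre
  of \<open>p\<close>, so that nothing is lost by looking for \<open>F\<close> in the type of \<open>E\<close>.\<close>

definition trivial_fiber_bundle ::
  "'a::euclidean_space set \<Rightarrow> 'b::euclidean_space set \<Rightarrow> ('a \<Rightarrow> 'b) \<Rightarrow> bool" where
  "trivial_fiber_bundle E B p \<longleftrightarrow> smooth_map (eucl_space E) (eucl_space B) p \<and>
     (\<exists>(F :: 'a set) h. diffeomorphism (eucl_space E) (eucl_space (B \<times> F)) h \<and>
        (\<forall>x\<in>E. fst (h x) = p x))"


section \<open>Closed polygons\<close>

text \<open>Matrices of size \<open>m + 1\<close> are indexed by a finite type \<open>'d\<close> with \<open>CARD('d) = m + 1\<close>, and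
  \<open>n\<close>-tuples by a finite type \<open>'n\<close> with \<open>CARD('n) = n\<close>.\<close>

type_synonym ('d, 'n) polygon = "((complex ^ 'd) ^ 'd) ^ 'n"

text \<open>The matrix of \<open>v \<mapsto> (v, w) w\<close>.\<close>

definition line_projection :: "complex ^ 'd \<Rightarrow> complex ^ 'd ^ 'd" where
  "line_projection w = (\<chi> a b. w $ a * cnj (w $ b))"

definition is_edge :: "real \<Rightarrow> complex ^ 'd ^ 'd \<Rightarrow> bool" where
  "is_edge r A \<longleftrightarrow> r > 0 \<and> (\<exists>w. norm w = 1 \<and> A = r *\<^sub>R line_projection w)"

definition CPol :: "('d::finite, 'n::finite) polygon set" where
  "CPol = {e. (\<forall>i. \<exists>r. is_edge r (e $ i)) \<and> (\<exists>c. (\<Sum>i\<in>UNIV. e $ i) = mat c)}"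

definition side_lengths :: "('d::finite, 'n::finite) polygon \<Rightarrow> real ^ 'n" where
  "side_lengths e = (\<chi> i. THE r. is_edge r (e $ i))"

lemma trace_is_edge:
  fixes A :: "complex ^ 'd::finite ^ 'd"
  assumes "is_edge r A"
  shows "trace A = complex_of_real r"
proof -
  obtain w where w: "norm w = 1" "A = r *\<^sub>R line_projection w"
    using assms by (auto simp: is_edge_def)
  have "(\<Sum>a\<in>UNIV. w $ a * cnj (w $ a)) = complex_of_real (\<Sum>a\<in>UNIV. (norm (w $ a))\<^sup>2)"
    unfolding of_real_sum by (intro sum.cong refl) (metis complex_norm_square of_real_power)
  also have "(\<Sum>a\<in>UNIV. (norm (w $ a))\<^sup>2) = (norm w)\<^sup>2"
    unfolding norm_vec_def L2_set_def by (rule real_sqrt_pow2[symmetric]) (intro sum_nonneg zero_le_power2)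
  finally have "(\<Sum>a\<in>UNIV. w $ a * cnj (w $ a)) = 1" using w by simp
  moreover have "trace A = of_real r * (\<Sum>a\<in>UNIV. w $ a * cnj (w $ a))"
    unfolding w(2) trace_def line_projection_def sum_distrib_left
    by (intro sum.cong refl) (simp only: vector_scaleR_component vec_lambda_beta
        scaleR_conv_of_real[where 'a = complex])
  ultimately show ?thesis by (simp only: mult_1_right)
qed

lemma side_lengths_eq:
  fixes e :: "('d::finite, 'n::finite) polygon"
  assumes "\<And>i. is_edge (r $ i) (e $ i)"
  shows "side_lengths e = r"
proof -
  have "(THE s. is_edge s (e $ i)) = r $ i" for i
  proof (rule the_equality)
    show "is_edge (r $ i) (e $ i)" by (rule assms)
    fix s assume "is_edge s (e $ i)"
    then have "complex_of_real s = complex_of_real (r $ i)"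
      using trace_is_edge assms by metis
    then show "s = r $ i" by (simp only: of_real_eq_iff)
  qed
  then show ?thesis by (simp add: side_lengths_def vec_eq_iff)
qed

definition closed_polygons :: "real ^ 'n \<Rightarrow> ('d::finite, 'n::finite) polygon set" where
  "closed_polygons r = {e \<in> CPol. side_lengths e = r}"

definition conj_transpose :: "complex ^ 'd ^ 'd \<Rightarrow> complex ^ 'd ^ 'd" where
  "conj_transpose A = (\<chi> a b. cnj (A $ b $ a))"

definition unitary_group :: "(complex ^ 'd::finite ^ 'd) set" where
  "unitary_group = {u. u ** conj_transpose u = mat 1 \<and> conj_transpose u ** u = mat 1}"

definition conjugate :: "complex ^ 'd ^ 'd \<Rightarrow> ('d::finite, 'n::finite) polygon \<Rightarrow> ('d, 'n) polygon"
  where "conjugate u e = (\<chi> i. u ** e $ i ** conj_transpose u)"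

definition orbit :: "('d::finite, 'n::finite) polygon \<Rightarrow> ('d, 'n) polygon set" where
  "orbit e = (\<lambda>u. conjugate u e) ` unitary_group"

definition moduli_space :: "real ^ 'n \<Rightarrow> ('d::finite, 'n::finite) polygon set smooth_space" where
  "moduli_space r = quotient_space (eucl_space (closed_polygons r)) orbit"

lemma topspace_moduli_space: "topspace (stop (moduli_space r)) = orbit ` closed_polygons r"
  by (simp add: moduli_space_def quotient_space_def eucl_space_def topspace_quotient_topology)


section \<open>Walls and chambers\<close>

definition side_length_cone :: "'d::finite itself \<Rightarrow> (real ^ 'n::finite) set" where
  "side_length_cone _ = {r. (\<forall>i. r $ i > 0) \<and>
     topspace (stop (moduli_space r :: ('d, 'n) polygon set smooth_space)) \<noteq> {}}"

text \<open>The factor \<open>m - k + 1\<close> is \<open>CARD('d) - k\<close>.\<close>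

definition wall ::
  "'d::finite itself \<Rightarrow> 'n set \<Rightarrow> 'n set \<Rightarrow> nat \<Rightarrow> (real ^ 'n::finite) set" where
  "wall D I J k = {r \<in> side_length_cone D.
     real k * (\<Sum>i\<in>I. r $ i) = (real CARD('d) - real k) * (\<Sum>j\<in>J. r $ j)}"

definition walls :: "'d::finite itself \<Rightarrow> (real ^ 'n::finite) set set" where
  "walls D = {wall D I J k | I J k. I \<noteq> {} \<and> J \<noteq> {} \<and> I \<inter> J = {} \<and> I \<union> J = UNIV \<and>
     1 \<le> k \<and> k \<le> CARD('d) - 1}"

definition chambers :: "'d::finite itself \<Rightarrow> (real ^ 'n::finite) set set" where
  "chambers D = components (side_length_cone D - \<Union> (walls D))"

end

theory Submission
  imports Defs
begin

text \<open>The trivialization comes from geometric invariant theory rather than from flows. By the theorem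
  of Kempf and Ness, the \<open>GL(m+1)\<close>-orbit of a configuration of lines that is stable for the weights
  \<open>s\<close> contains a closed polygon with side-lengths \<open>s\<close>, unique up to \<open>U(m+1)\<close>, and stability does not
  change within a chamber. Choosing the linear map positive definite of fixed trace makes the polygon
  \<open>balance s e\<close> obtained from \<open>e\<close> unique and, by the implicit function theorem, smooth in \<open>(s, e)\<close>, so
  \<open>e \<mapsto> (s(e), balance r\<^sub>0 e)\<close> is a trivialization with inverse \<open>(r, f) \<mapsto> balance r f\<close>. Existence
  is proved by a connectedness argument along the chamber, uniqueness by the Cauchy--Schwarz
  inequality. Charts of a moduli space are matrix coordinates of a configuration of lines with
  respect to a basis, normalised along a spanning tree.\<close>

subsection \<open>Calculus of smooth functions\<close>

text \<open>Everything rests on one rigidity fact: off the walls, a Hermitian matrix that has every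
  vector of a tight frame as an eigenvector is a scalar. It is used twice. It determines the
  balancing matrix of a closed polygon up to a unitary factor and a positive scalar, and it makes
  the linearised balancing equation injective, which is what the implicit function theorem asks for.
  In both cases the eigenvector property comes from the equality case of a Cauchy--Schwarz
  inequality summed over the frame. The walls enter once more in the existence proof, where they
  keep limits of balancing matrices from becoming singular. Smoothness on a subset means local
  extendability to the ambient space. Hence \<open>act\<close> and \<open>defect\<close> are defined
  for arbitrary matrices, and being Hermitian is turned into an equation, so that the implicit
  function theorem yields extensions of \<open>balance\<close> to open sets. The moduli spaces have,
  in addition, to be shown to be manifolds: the quotient structure provides their functions but no
  charts.\<close>

lemma C_diff_cong:
  assumes "open U" "\<And>x. x \<in> U \<Longrightarrow> f x = g x"
  shows "C_diff k U f \<longleftrightarrow> C_diff k U g"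
  using assms(2)
proof (induction k arbitrary: f g)
  case 0
  then show ?case by (simp cong: continuous_on_cong)
next
  case (Suc k)
  have D: "(f has_derivative F) (at x) \<longleftrightarrow> (g has_derivative F) (at x)" if "x \<in> U" for x F
    using Suc.prems that assms(1)
    by (metis has_derivative_transform_within_open)
  have "frechet_derivative f (at x) = frechet_derivative g (at x)" if "x \<in> U" for x
    using D[OF that] by (simp add: frechet_derivative_def)
  then have "C_diff k U (\<lambda>x. frechet_derivative f (at x) v) \<longleftrightarrow>
      C_diff k U (\<lambda>x. frechet_derivative g (at x) v)" for v
    by (intro Suc.IH) simp
  with D show ?case by (simp add: differentiable_def)
qed

text \<open>Lets the inductions below work with explicit derivative formulas; since \<open>U\<close>
  is open, \<open>C_diff_cong\<close> trades \<open>frechet_derivative\<close> for such a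
  formula.\<close>

lemma C_diff_SucI:
  assumes "open U" "\<And>x. x \<in> U \<Longrightarrow> (f has_derivative f' x) (at x)"
    and "\<And>v. C_diff k U (\<lambda>x. f' x v)"
  shows "C_diff (Suc k) U f"
proof -
  have "C_diff k U (\<lambda>x. frechet_derivative f (at x) v)" for v
    using assms(3)[of v] C_diff_cong[OF assms(1), of "\<lambda>x. frechet_derivative f (at x) v" "\<lambda>x. f' x v" k]
    by (metis assms(2) frechet_derivative_at)
  then show ?thesis using assms(2) by (auto simp: differentiable_def)
qed

lemma C_diff_SucD:
  assumes "C_diff (Suc k) U f"
  shows "x \<in> U \<Longrightarrow> (f has_derivative frechet_derivative f (at x)) (at x)"
    and "C_diff k U (\<lambda>x. frechet_derivative f (at x) v)"
  using assms by (auto simp: frechet_derivative_works)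

lemma C_diff_decr: "C_diff (Suc k) U f \<Longrightarrow> C_diff k U f"
proof (induction k arbitrary: f)
  case 0
  then show ?case
    by (auto intro!: continuous_at_imp_continuous_on differentiable_imp_continuous_within)
next
  case (Suc k)
  then show ?case by (metis C_diff.simps(2))
qed

lemma C_diff_continuous_on: "C_diff k U f \<Longrightarrow> continuous_on U f"
  by (induction k) (use C_diff_decr in auto)

lemma C_diff_subset: "C_diff k U f \<Longrightarrow> V \<subseteq> U \<Longrightarrow> C_diff k V f"
  by (induction k arbitrary: f) (auto intro: continuous_on_subset)

lemma C_diff_const:
  assumes "open U" shows "C_diff k U (\<lambda>x. c)"
proof (induction k arbitrary: c)
  case (Suc k)
  show ?case by (rule C_diff_SucI[OF assms, where f' = "\<lambda>x v. 0"]) (use Suc in auto)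
qed simp

lemma C_diff_bounded_linear:
  assumes "open U" "bounded_linear h" "C_diff k U f"
  shows "C_diff k U (\<lambda>x. h (f x))"
  using assms(3)
proof (induction k arbitrary: f)
  case 0
  then show ?case using bounded_linear.continuous_on[OF assms(2)] by auto
next
  case (Suc k)
  show ?case
    by (rule C_diff_SucI[OF assms(1), where f' = "\<lambda>x v. h (frechet_derivative f (at x) v)"])
      (intro bounded_linear.has_derivative[OF assms(2)] C_diff_SucD[OF Suc.prems] Suc.IH; assumption)+
qed

lemma C_diff_ident:
  assumes "open U" shows "C_diff k U (\<lambda>x. x)"
proof (cases k)
  case (Suc j)
  show ?thesis unfolding Suc
    by (rule C_diff_SucI[OF assms, where f' = "\<lambda>x v. v"]) (auto intro: C_diff_const assms)
qed simp

lemma C_diff_add: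
  assumes "open U" "C_diff k U f" "C_diff k U g"
  shows "C_diff k U (\<lambda>x. f x + g x)"
  using assms(2,3)
proof (induction k arbitrary: f g)
  case 0
  then show ?case by (simp add: continuous_on_add)
next
  case (Suc k)
  show ?case
    by (rule C_diff_SucI[OF assms(1), where
          f' = "\<lambda>x v. frechet_derivative f (at x) v + frechet_derivative g (at x) v"])
      (intro has_derivative_add C_diff_SucD[OF Suc.prems(1)] C_diff_SucD[OF Suc.prems(2)] Suc.IH;
        assumption)+
qed

lemma C_diff_sum:
  assumes "open U" "\<And>i. i \<in> I \<Longrightarrow> C_diff k U (f i)"
  shows "C_diff k U (\<lambda>x. \<Sum>i\<in>I. f i x)"
  using assms(2)
  by (induction I rule: infinite_finite_induct) (simp_all add: C_diff_const C_diff_add assms(1))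

lemma C_diff_bilinear:
  assumes "open U" "bounded_bilinear h" "C_diff k U f" "C_diff k U g"
  shows "C_diff k U (\<lambda>x. h (f x) (g x))"
  using assms(3,4)
proof (induction k arbitrary: f g)
  case 0
  then show ?case by (simp add: bounded_bilinear.continuous_on[OF assms(2)])
next
  case (Suc k)
  have k: "C_diff k U f" "C_diff k U g" using Suc.prems by (auto intro: C_diff_decr)
  show ?case
    by (rule C_diff_SucI[OF assms(1), where
          f' = "\<lambda>x v. h (f x) (frechet_derivative g (at x) v) + h (frechet_derivative f (at x) v) (g x)"])
      (intro bounded_bilinear.FDERIV[OF assms(2)] C_diff_add[OF assms(1)] C_diff_SucD[OF Suc.prems(1)]
        C_diff_SucD[OF Suc.prems(2)] Suc.IH k; assumption)+
qed

text \<open>Turns a derivative applied to a varying vector into a sum of derivatives in fixed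
  directions, the only ones that \<open>C_diff\<close> speaks about.\<close>

lemma linear_expansion:
  fixes h :: "'a::euclidean_space \<Rightarrow> 'b::real_vector"
  assumes "linear h"
  shows "h w = (\<Sum>b\<in>Basis. (w \<bullet> b) *\<^sub>R h b)"
proof -
  have "h (\<Sum>b\<in>Basis. (w \<bullet> b) *\<^sub>R b) = (\<Sum>b\<in>Basis. (w \<bullet> b) *\<^sub>R h b)"
    using assms by (simp add: linear_sum linear_scale)
  then show ?thesis unfolding euclidean_representation .
qed

lemma C_diff_compose:
  fixes f :: "'a::euclidean_space \<Rightarrow> 'b::euclidean_space" and g :: "'b \<Rightarrow> 'c::real_normed_vector"
  assumes "open U" "open V" "\<And>x. x \<in> U \<Longrightarrow> f x \<in> V" "C_diff k U f" "C_diff k V g"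
  shows "C_diff k U (\<lambda>x. g (f x))"
  using assms(4,5)
proof (induction k arbitrary: g)
  case 0
  then show ?case using assms(3) by (auto intro: continuous_on_compose2)
next
  case (Suc k)
  let ?D = "\<lambda>x v. \<Sum>b\<in>Basis. (frechet_derivative f (at x) v \<bullet> b) *\<^sub>R frechet_derivative g (at (f x)) b"
  have der: "((\<lambda>x. g (f x)) has_derivative ?D x) (at x)" if x: "x \<in> U" for x
  proof -
    have g: "(g has_derivative frechet_derivative g (at (f x))) (at (f x))"
      using C_diff_SucD(1)[OF Suc.prems(2)] assms(3) x by blast
    note exp = linear_expansion[OF has_derivative_linear[OF g]]
    have "?D x = frechet_derivative g (at (f x)) \<circ> frechet_derivative f (at x)"
      by (rule ext) (simp only: o_apply exp[symmetric])
    then show ?thesis using diff_chain_at[OF C_diff_SucD(1)[OF Suc.prems(1) x] g] by (simp add: o_def)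
  qed
  show ?case
  proof (rule C_diff_SucI[OF assms(1) der])
    fix v
    show "C_diff k U (\<lambda>x. ?D x v)"
    proof (intro C_diff_sum[OF assms(1)] C_diff_bilinear[OF assms(1) bounded_bilinear_scaleR])
      fix b :: 'b
      show "C_diff k U (\<lambda>x. frechet_derivative f (at x) v \<bullet> b)"
        by (rule C_diff_bounded_linear[OF assms(1) bounded_linear_inner_left]) (use Suc.prems in auto)
      show "C_diff k U (\<lambda>x. frechet_derivative g (at (f x)) b)"
        using Suc.IH[OF C_diff_decr[OF Suc.prems(1)] C_diff_SucD(2)[OF Suc.prems(2)]] by simp
    qed
  qed
qed

lemma C_diff_inverse:
  fixes f :: "'a::euclidean_space \<Rightarrow> 'b::real_normed_field"
  assumes "open U" "\<And>x. x \<in> U \<Longrightarrow> f x \<noteq> 0" "C_diff k U f"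
  shows "C_diff k U (\<lambda>x. inverse (f x))"
  using assms(3)
proof (induction k)
  case 0
  then show ?case using assms(2) by (auto intro: continuous_on_inverse)
next
  case (Suc k)
  have "C_diff k U (\<lambda>x. inverse (f x) * frechet_derivative f (at x) v * inverse (f x))" for v
    using Suc by (intro C_diff_bilinear[OF assms(1) bounded_bilinear_mult] Suc.IH) (auto intro: C_diff_decr)
  from C_diff_bounded_linear[OF assms(1) bounded_linear_minus[OF bounded_linear_ident] this]
  have *: "C_diff k U (\<lambda>x. - (inverse (f x) * frechet_derivative f (at x) v * inverse (f x)))" for v .
  show ?case
    by (rule C_diff_SucI[OF assms(1) _ *], rule Deriv.has_derivative_inverse)
      (use assms(2) in blast, rule C_diff_SucD(1)[OF Suc.prems])
qed

section \<open>Smoothness rules, including the operations of matrix algebra\<close>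

named_theorems smooth_intros

lemma smooth_on_const [smooth_intros]: "open U \<Longrightarrow> smooth_on U (\<lambda>x. c)"
  by (simp add: smooth_on_def C_diff_const)

lemma smooth_on_ident [smooth_intros]: "open U \<Longrightarrow> smooth_on U (\<lambda>x. x)"
  by (simp add: smooth_on_def C_diff_ident)

lemma smooth_on_bounded_linear:
  "bounded_linear h \<Longrightarrow> open U \<Longrightarrow> smooth_on U f \<Longrightarrow> smooth_on U (\<lambda>x. h (f x))"
  by (simp add: smooth_on_def C_diff_bounded_linear)

lemma smooth_on_bilinear:
  "bounded_bilinear h \<Longrightarrow> open U \<Longrightarrow> smooth_on U f \<Longrightarrow> smooth_on U g \<Longrightarrow> smooth_on U (\<lambda>x. h (f x) (g x))"
  by (simp add: smooth_on_def C_diff_bilinear)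

lemma smooth_on_add [smooth_intros]:
  "open U \<Longrightarrow> smooth_on U f \<Longrightarrow> smooth_on U g \<Longrightarrow> smooth_on U (\<lambda>x. f x + g x)"
  by (simp add: smooth_on_def C_diff_add)

lemma smooth_on_minus [smooth_intros]:
  "open U \<Longrightarrow> smooth_on U f \<Longrightarrow> smooth_on U (\<lambda>x. - f x)"
  by (rule smooth_on_bounded_linear[OF bounded_linear_minus[OF bounded_linear_ident]])

lemma smooth_on_diff [smooth_intros]:
  "open U \<Longrightarrow> smooth_on U f \<Longrightarrow> smooth_on U g \<Longrightarrow> smooth_on U (\<lambda>x. f x - g x)"
  using smooth_on_add[OF _ _ smooth_on_minus, of U f g] by simp

lemma smooth_on_sum [smooth_intros]:
  "open U \<Longrightarrow> (\<And>i. i \<in> I \<Longrightarrow> smooth_on U (f i)) \<Longrightarrow> smooth_on U (\<lambda>x. \<Sum>i\<in>I. f i x)"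
  by (simp add: smooth_on_def C_diff_sum)

lemmas smooth_on_scaleR [smooth_intros] = smooth_on_bilinear[OF bounded_bilinear_scaleR]
lemmas smooth_on_mult [smooth_intros] = smooth_on_bilinear[OF bounded_bilinear_mult]
lemmas smooth_on_fst [smooth_intros] = smooth_on_bounded_linear[OF bounded_linear_fst]
lemmas smooth_on_snd [smooth_intros] = smooth_on_bounded_linear[OF bounded_linear_snd]
lemmas smooth_on_Re [smooth_intros] = smooth_on_bounded_linear[OF bounded_linear_Re]
lemmas smooth_on_cnj [smooth_intros] = smooth_on_bounded_linear[OF bounded_linear_cnj]
lemmas smooth_on_vec_nth [smooth_intros] = smooth_on_bounded_linear[OF bounded_linear_vec_nth]

lemma smooth_on_prod [smooth_intros]:
  fixes f :: "'i \<Rightarrow> 'a::euclidean_space \<Rightarrow> 'b::{real_normed_algebra,comm_ring_1}"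
  shows "open U \<Longrightarrow> (\<And>i. i \<in> I \<Longrightarrow> smooth_on U (f i)) \<Longrightarrow> smooth_on U (\<lambda>x. \<Prod>i\<in>I. f i x)"
  by (induction I rule: infinite_finite_induct) (auto intro: smooth_on_const smooth_on_mult)

lemma smooth_on_inverse [smooth_intros]:
  fixes f :: "'a::euclidean_space \<Rightarrow> 'b::real_normed_field"
  shows "open U \<Longrightarrow> smooth_on U f \<Longrightarrow> (\<And>x. x \<in> U \<Longrightarrow> f x \<noteq> 0) \<Longrightarrow> smooth_on U (\<lambda>x. inverse (f x))"
  by (simp add: smooth_on_def C_diff_inverse)

lemma smooth_on_divide [smooth_intros]:
  fixes f :: "'a::euclidean_space \<Rightarrow> 'b::real_normed_field"
  shows "open U \<Longrightarrow> smooth_on U f \<Longrightarrow> smooth_on U g \<Longrightarrow> (\<And>x. x \<in> U \<Longrightarrow> g x \<noteq> 0) \<Longrightarrow>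
    smooth_on U (\<lambda>x. f x / g x)"
  unfolding divide_inverse by (intro smooth_intros)

lemma smooth_on_Pair [smooth_intros]:
  fixes f :: "'a::euclidean_space \<Rightarrow> 'b::real_normed_vector" and g :: "'a \<Rightarrow> 'c::real_normed_vector"
  assumes "open U" "smooth_on U f" "smooth_on U g"
  shows "smooth_on U (\<lambda>x. (f x, g x))"
proof -
  have "smooth_on U (\<lambda>x. (f x, 0) + (0, g x))"
    using assms
    by (intro smooth_on_add smooth_on_bounded_linear[where h = "\<lambda>z. (z, 0)" and f = f]
        smooth_on_bounded_linear[where h = "\<lambda>z. (0, z)" and f = g])
      (auto intro!: bounded_linear_intros)
  then show ?thesis by simp
qed

lemma smooth_on_vec_lambda [smooth_intros]:
  fixes f :: "'i::finite \<Rightarrow> 'a::euclidean_space \<Rightarrow> 'b::euclidean_space"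
  assumes "open U" "\<And>i. smooth_on U (f i)"
  shows "smooth_on U (\<lambda>x. \<chi> i. f i x)"
proof -
  have "bounded_linear (axis i :: 'b \<Rightarrow> 'b^'i)" for i
    by (rule linear_conv_bounded_linear[THEN iffD1], rule linearI) (auto simp: axis_def vec_eq_iff)
  then have "smooth_on U (\<lambda>x. axis i (f i x) :: 'b^'i)" for i
    by (rule smooth_on_bounded_linear) (rule assms)+
  then have "smooth_on U (\<lambda>x. \<Sum>i\<in>UNIV. axis i (f i x))"
    by (rule smooth_on_sum[OF assms(1)])
  moreover have "(\<Sum>i\<in>UNIV. axis i (f i x)) = (\<chi> i. f i x)" for x
    by (simp add: vec_eq_iff axis_def)
  ultimately show ?thesis by simp
qed

lemma smooth_on_subset: "smooth_on U f \<Longrightarrow> V \<subseteq> U \<Longrightarrow> smooth_on V f"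
  unfolding smooth_on_def using C_diff_subset by blast

lemma smooth_on_continuous_on: "smooth_on U f \<Longrightarrow> continuous_on U f"
  unfolding smooth_on_def using C_diff_continuous_on by blast

lemma smooth_on_compose:
  fixes f :: "'a::euclidean_space \<Rightarrow> 'b::euclidean_space" and g :: "'b \<Rightarrow> 'c::real_normed_vector"
  assumes "open U" "open V" "\<And>x. x \<in> U \<Longrightarrow> f x \<in> V" "smooth_on U f" "smooth_on V g"
  shows "smooth_on U (\<lambda>x. g (f x))"
  using assms unfolding smooth_on_def by (blast intro: C_diff_compose)

lemma smooth_on_frechet:
  assumes "smooth_on U f"
  shows "x \<in> U \<Longrightarrow> (f has_derivative frechet_derivative f (at x)) (at x)"
    and "smooth_on U (\<lambda>x. frechet_derivative f (at x) v)"
  using assms C_diff_SucD unfolding smooth_on_def by blast+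

lemma smooth_on_matrix_mult [smooth_intros]:
  fixes f :: "'a::euclidean_space \<Rightarrow> complex^'j::finite^'i::finite"
    and g :: "'a \<Rightarrow> complex^'k::finite^'j"
  shows "open U \<Longrightarrow> smooth_on U f \<Longrightarrow> smooth_on U g \<Longrightarrow> smooth_on U (\<lambda>x. f x ** g x)"
  unfolding matrix_matrix_mult_def by (intro smooth_intros) auto

lemma smooth_on_conj_transpose [smooth_intros]:
  fixes f :: "'a::euclidean_space \<Rightarrow> complex^'i::finite^'i"
  shows "open U \<Longrightarrow> smooth_on U f \<Longrightarrow> smooth_on U (\<lambda>x. conj_transpose (f x))"
  unfolding conj_transpose_def by (intro smooth_intros) auto

lemma smooth_on_trace [smooth_intros]:
  fixes f :: "'a::euclidean_space \<Rightarrow> complex^'i::finite^'i"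
  shows "open U \<Longrightarrow> smooth_on U f \<Longrightarrow> smooth_on U (\<lambda>x. trace (f x))"
  unfolding trace_def by (intro smooth_intros) auto

lemma smooth_on_det [smooth_intros]:
  fixes f :: "'a::euclidean_space \<Rightarrow> complex^'i::finite^'i"
  shows "open U \<Longrightarrow> smooth_on U f \<Longrightarrow> smooth_on U (\<lambda>x. det (f x))"
  unfolding det_def by (intro smooth_intros) auto

subsection \<open>The smooth inverse function theorem\<close>

text \<open>The derivative of \<open>x \<mapsto> A(x)\<inverse> b\<close> is read off the inverse of \<open>(x, z) \<mapsto> (x, A(x) z)\<close>.\<close>

lemma has_derivative_inverse_family:
  fixes A :: "'b::euclidean_space \<Rightarrow> 'a::euclidean_space \<Rightarrow> 'a"
  assumes U: "open U" "x0 \<in> U" and lin: "\<And>x. x \<in> U \<Longrightarrow> linear (A x)" "\<And>x. x \<in> U \<Longrightarrow> bij (A x)"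
    and A: "\<And>w x. x \<in> U \<Longrightarrow> ((\<lambda>x. A x w) has_derivative (\<lambda>u. A' x u w)) (at x)"
  shows "((\<lambda>x. inv (A x) b) has_derivative
     (\<lambda>u. - inv (A x0) (\<Sum>c\<in>Basis. (inv (A x0) b \<bullet> c) *\<^sub>R A' x0 u c))) (at x0)"
proof -
  \<comment> \<open>The expansion in the basis lets the derivative be computed from those of
    \<open>A x c\<close> for fixed \<open>c\<close>, which is all that is assumed about
    \<open>A\<close>.\<close>
  define \<Psi> where "\<Psi> = (\<lambda>(x, z). (x, \<Sum>c\<in>Basis. (z \<bullet> c) *\<^sub>R A x c))"
  define \<Gamma> where "\<Gamma> = (\<lambda>(x, z). (x, inv (A x) z))"
  define z0 where "z0 = inv (A x0) b"
  define \<Psi>' where "\<Psi>' = (\<lambda>p. \<lambda>(u, \<zeta>). (u, \<Sum>c\<in>Basis. (snd p \<bullet> c) *\<^sub>R A' (fst p) u c + (\<zeta> \<bullet> c) *\<^sub>R A (fst p) c))"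
  define \<Gamma>' where "\<Gamma>' = (\<lambda>(u, \<eta>). (u, inv (A x0) (\<eta> - (\<Sum>c\<in>Basis. (z0 \<bullet> c) *\<^sub>R A' x0 u c))))"
  have \<Psi>_eq: "\<Psi> (x, z) = (x, A x z)" if "x \<in> U" for x z
    using linear_expansion[OF lin(1)[OF that], of z] by (simp add: \<Psi>_def)
  have der: "(\<Psi> has_derivative \<Psi>' p) (at p)" if "fst p \<in> U" for p
  proof -
    obtain x z where p: "p = (x, z)" by force
    then have x: "x \<in> U" using that by simp
    have 1: "((\<lambda>p. A (fst p) c) has_derivative (\<lambda>q. A' x (fst q) c)) (at p)" for c
      using has_derivative_compose[OF bounded_linear_imp_has_derivative[OF bounded_linear_fst],
          of "\<lambda>x. A x c" "\<lambda>u. A' x u c" p UNIV] A[OF x, of c] by (simp add: p)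
    have "((\<lambda>p. (fst p, \<Sum>c\<in>Basis. (snd p \<bullet> c) *\<^sub>R A (fst p) c)) has_derivative
       (\<lambda>q. (fst q, \<Sum>c\<in>Basis. (snd p \<bullet> c) *\<^sub>R A' x (fst q) c + (snd q \<bullet> c) *\<^sub>R A (fst p) c))) (at p)"
      by (intro derivative_intros 1)
    then show ?thesis by (simp add: \<Psi>_def \<Psi>'_def p case_prod_unfold)
  qed
  have cont: "continuous_on (U \<times> UNIV) \<Psi>"
    by (auto intro!: continuous_at_imp_continuous_on has_derivative_continuous[OF der])
  have id: "\<Psi>' (x0, z0) \<circ> \<Gamma>' = id"
  proof
    fix p :: "'b \<times> 'a" obtain u \<eta> where p: "p = (u, \<eta>)" by force
    let ?s = "\<Sum>c\<in>Basis. (z0 \<bullet> c) *\<^sub>R A' x0 u c"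
    have "(\<Sum>c\<in>Basis. (inv (A x0) (\<eta> - ?s) \<bullet> c) *\<^sub>R A x0 c) = A x0 (inv (A x0) (\<eta> - ?s))"
      by (rule linear_expansion[OF lin(1)[OF U(2)], symmetric])
    also have "\<dots> = \<eta> - ?s" using lin(2)[OF U(2)] by (simp add: bij_is_surj surj_f_inv_f)
    finally show "(\<Psi>' (x0, z0) \<circ> \<Gamma>') p = id p" by (simp add: \<Psi>'_def \<Gamma>'_def p sum.distrib)
  qed
  have "(\<Gamma> has_derivative \<Gamma>') (at (\<Psi> (x0, z0)))"
  proof (rule has_derivative_inverse_strong[OF _ _ cont _ der id])
    show "open (U \<times> (UNIV :: 'a set))" using U by (intro open_Times) auto
    show "\<Gamma> (\<Psi> p) = p" if "p \<in> U \<times> UNIV" for p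
      using that lin(2) by (cases p) (simp add: \<Psi>_eq \<Gamma>_def bij_is_inj inv_f_f)
  qed (use U in auto)
  moreover have "\<Psi> (x0, z0) = (x0, b)"
    using lin(2)[OF U(2)] by (simp add: \<Psi>_eq U z0_def bij_is_surj surj_f_inv_f)
  ultimately have "(\<Gamma> has_derivative \<Gamma>') (at (x0, b))" by simp
  moreover have "((\<lambda>x. (x, b)) has_derivative (\<lambda>u. (u, 0))) (at x0)"
    by (intro derivative_intros)
  ultimately have "((\<lambda>x. \<Gamma> (x, b)) has_derivative (\<lambda>u. \<Gamma>' (u, 0))) (at x0)"
    using has_derivative_compose[of "\<lambda>x. (x, b)" "\<lambda>u. (u, 0)" x0 UNIV \<Gamma> \<Gamma>'] by simp
  then have "((\<lambda>x. snd (\<Gamma> (x, b))) has_derivative (\<lambda>u. snd (\<Gamma>' (u, 0)))) (at x0)"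
    by (rule has_derivative_snd)
  moreover have "linear (inv (A x0))"
    using lin[OF U(2)] by (simp add: inj_linear_imp_inv_linear bij_is_inj)
  ultimately show ?thesis by (simp add: \<Gamma>_def \<Gamma>'_def z0_def linear_neg)
qed

text \<open>Induction on the order of differentiability, for all \<open>b\<close> at once: the
  derivative is a combination of solutions for other right-hand sides, with coefficients built from
  such solutions and from the derivatives of \<open>A\<close>.\<close>

lemma smooth_on_inverse_family:
  fixes A :: "'b::euclidean_space \<Rightarrow> 'a::euclidean_space \<Rightarrow> 'a"
  assumes U: "open U" and lin: "\<And>x. x \<in> U \<Longrightarrow> linear (A x)" "\<And>x. x \<in> U \<Longrightarrow> bij (A x)"
    and A: "\<And>w. smooth_on U (\<lambda>x. A x w)"
  shows "smooth_on U (\<lambda>x. inv (A x) b)"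
proof -
  let ?A' = "\<lambda>x u w. frechet_derivative (\<lambda>x. A x w) (at x) u"
  let ?F = "\<lambda>x u b. \<Sum>c\<in>Basis. (inv (A x) b \<bullet> c) *\<^sub>R ?A' x u c"
  have der: "((\<lambda>x. inv (A x) b) has_derivative
       (\<lambda>u. - (\<Sum>e\<in>Basis. (?F x u b \<bullet> e) *\<^sub>R inv (A x) e))) (at x)" if x: "x \<in> U" for x b
  proof -
    have "linear (inv (A x))"
      using lin[OF x] by (simp add: inj_linear_imp_inv_linear bij_is_inj)
    then show ?thesis
      by (intro has_derivative_eq_rhs[OF has_derivative_inverse_family[OF U x lin smooth_on_frechet(1)[OF A]]]
          ext arg_cong[where f = uminus] linear_expansion)
  qed
  have "C_diff k U (\<lambda>x. inv (A x) b)" for k b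
  proof (induction k arbitrary: b)
    case 0
    show ?case
      by (auto intro!: continuous_at_imp_continuous_on has_derivative_continuous[OF der])
  next
    case (Suc k)
    have 1: "C_diff k U (\<lambda>x. ?A' x u c)" for u c
      using smooth_on_frechet(2)[OF A] by (simp add: smooth_on_def)
    have "C_diff k U (\<lambda>x. - (\<Sum>e\<in>Basis. (?F x u b \<bullet> e) *\<^sub>R inv (A x) e))" for u
      by (rule C_diff_bounded_linear[OF U bounded_linear_minus[OF bounded_linear_ident]],
          rule C_diff_sum[OF U], rule C_diff_bilinear[OF U bounded_bilinear_scaleR],
          rule C_diff_bounded_linear[OF U bounded_linear_inner_left],
          rule C_diff_sum[OF U], rule C_diff_bilinear[OF U bounded_bilinear_scaleR],
          rule C_diff_bounded_linear[OF U bounded_linear_inner_left], rule Suc.IH, rule 1, rule Suc.IH)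
    from C_diff_SucI[OF U der this] show ?case .
  qed
  then show ?thesis by (simp add: smooth_on_def)
qed

text \<open>The C1 theorem provides \<open>g\<close> with derivative \<open>inv (f' (g y))\<close>.
  By \<open>smooth_on_inverse_family\<close> this inverse depends smoothly on the point
  \<open>g y\<close>, so each order of differentiability of \<open>g\<close> passes to its
  derivative and yields the next order.\<close>

theorem smooth_inverse_function:
  fixes f :: "'a::euclidean_space \<Rightarrow> 'a"
  assumes U: "open U" "smooth_on U f" "x0 \<in> U"
    and inj: "\<And>v. frechet_derivative f (at x0) v = 0 \<Longrightarrow> v = 0"
  obtains U' V g where "open U'" "U' \<subseteq> U" "x0 \<in> U'" "open V" "f x0 \<in> V"
    "homeomorphism U' V f g" "smooth_on V g"
proof -
  define f' where "f' x = Blinfun (frechet_derivative f (at x))" for x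
  have f': "blinfun_apply (f' x) = frechet_derivative f (at x)" if "x \<in> U" for x
    unfolding f'_def using smooth_on_frechet(1)[OF U(2) that]
    by (simp add: bounded_linear_Blinfun_apply has_derivative_bounded_linear)
  have cont: "continuous_on U f'"
  proof (rule continuous_on_blinfun_componentwise)
    fix i :: 'a
    have "continuous_on U (\<lambda>x. frechet_derivative f (at x) i)"
      by (rule smooth_on_continuous_on[OF smooth_on_frechet(2)[OF U(2)]])
    then show "continuous_on U (\<lambda>x. blinfun_apply (f' x) i)" using f' by (simp cong: continuous_on_cong)
  qed
  have der: "(f has_derivative blinfun_apply (f' x)) (at x)" if "x \<in> U" for x
    using smooth_on_frechet(1)[OF U(2) that] f'[OF that] by simp
  let ?D = "frechet_derivative f (at x0)"
  have lin: "linear ?D" using smooth_on_frechet(1)[OF U(2,3)] by (rule has_derivative_linear)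
  then have "inj ?D" using inj by (simp add: linear_injective_0)
  then obtain h where h: "linear h" "h \<circ> ?D = id"
    using linear_injective_left_inverse[OF lin] by blast
  then have "Blinfun h o\<^sub>L f' x0 = id_blinfun"
    by (intro blinfun_eqI) (simp add: f'[OF U(3)] bounded_linear_Blinfun_apply linear_linear pointfree_idE)
  from inverse_function_theorem[OF U(1) der cont U(3) this]
  obtain U' V g g' where o: "open U'" "U' \<subseteq> U" "x0 \<in> U'" "open V" "f x0 \<in> V"
    and hom: "homeomorphism U' V f g"
    and g: "\<And>y. y \<in> V \<Longrightarrow> (g has_derivative (g' y)) (at y)"
      "\<And>y. y \<in> V \<Longrightarrow> g' y = inv (blinfun_apply (f'(g y)))"
      "\<And>y. y \<in> V \<Longrightarrow> bij (blinfun_apply (f'(g y)))" by metis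
  have gV: "g y \<in> U'" if "y \<in> V" for y using hom that by (auto simp: homeomorphism_def)
  have bij: "bij (frechet_derivative f (at x))" if "x \<in> U'" for x
  proof -
    have "f x \<in> V" "g (f x) = x" using hom that by (auto simp: homeomorphism_def)
    then show ?thesis using g(3)[of "f x"] f' that o(2) by auto
  qed
  have "smooth_on U' (\<lambda>x. inv (frechet_derivative f (at x)) v)" for v
  proof (rule smooth_on_inverse_family[OF o(1) _ bij])
    show "linear (frechet_derivative f (at x))" if "x \<in> U'" for x
      using smooth_on_frechet(1)[OF U(2)] that o(2) by (blast intro: has_derivative_linear)
    show "smooth_on U' (\<lambda>x. frechet_derivative f (at x) w)" for w
      using smooth_on_frechet(2)[OF U(2)] o(2) by (rule smooth_on_subset)
  qed
  then have inv: "C_diff k U' (\<lambda>x. inv (frechet_derivative f (at x)) v)" for k v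
    by (simp add: smooth_on_def)
  have "C_diff k V g" for k
  proof (induction k)
    case 0
    then show ?case using hom by (simp add: homeomorphism_def)
  next
    case (Suc k)
    have der: "(g has_derivative (\<lambda>v. inv (frechet_derivative f (at (g y))) v)) (at y)" if "y \<in> V" for y
      using g(1,2)[OF that] f'[of "g y"] gV[OF that] o(2) by auto
    show ?case
      by (rule C_diff_SucI[OF o(4) der]) (assumption, rule C_diff_compose[OF o(4,1) gV Suc inv])
  qed
  with o hom that show ?thesis by (metis smooth_on_def)
qed

text \<open>The inverse function theorem for \<open>p \<mapsto> (fst p, G p)\<close>. The partial
  derivative enters through velocities along straight lines, the form in which it is computed for
  \<open>defect\<close>.\<close>

theorem smooth_implicit_function:
  fixes G :: "'y::euclidean_space \<times> 'a::euclidean_space \<Rightarrow> 'a"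
  assumes O: "open S" "smooth_on S G" "(y0, h0) \<in> S" "G (y0, h0) = 0"
    and D: "\<And>X. ((\<lambda>t. G (y0, h0 + t *\<^sub>R X)) has_vector_derivative D X) (at 0)"
    and inj: "\<And>X. D X = 0 \<Longrightarrow> X = 0"
  obtains Y \<gamma> where "open Y" "y0 \<in> Y" "smooth_on Y \<gamma>" "\<gamma> y0 = h0"
    "\<And>y. y \<in> Y \<Longrightarrow> (y, \<gamma> y) \<in> S \<and> G (y, \<gamma> y) = 0"
proof -
  define \<Psi> where "\<Psi> p = (fst p, G p)" for p
  have sm: "smooth_on S \<Psi>" unfolding \<Psi>_def by (intro smooth_intros O)
  let ?DG = "frechet_derivative G (at (y0, h0))"
  have dG: "(G has_derivative ?DG) (at (y0, h0))" by (rule smooth_on_frechet(1)[OF O(2,3)])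
  have "(\<Psi> has_derivative (\<lambda>q. (fst q, ?DG q))) (at (y0, h0))"
    unfolding \<Psi>_def by (intro derivative_intros dG)
  then have D\<Psi>: "frechet_derivative \<Psi> (at (y0, h0)) = (\<lambda>q. (fst q, ?DG q))"
    by (rule frechet_derivative_at[symmetric])
  have "v = 0" if "frechet_derivative \<Psi> (at (y0, h0)) v = 0" for v
  proof -
    have v: "fst v = 0" "?DG v = 0" using that unfolding D\<Psi> by (auto simp: prod_eq_iff)
    have "((\<lambda>t. (y0, h0 + t *\<^sub>R snd v)) has_derivative (\<lambda>t. (0, t *\<^sub>R snd v))) (at 0)"
      by (auto intro!: derivative_eq_intros)
    from has_derivative_compose[OF this, of G ?DG] dG
    have "((\<lambda>t. G (y0, h0 + t *\<^sub>R snd v)) has_derivative (\<lambda>t. ?DG (0, t *\<^sub>R snd v))) (at 0)"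
      by simp
    from has_derivative_unique[OF this D[of "snd v", unfolded has_vector_derivative_def]]
    have "?DG (0, 1 *\<^sub>R snd v) = 1 *\<^sub>R D (snd v)" by metis
    moreover have "v = (0, snd v)" using v by (simp add: prod_eq_iff)
    ultimately have "D (snd v) = 0" using v by simp
    then show ?thesis using inj v by (simp add: prod_eq_iff)
  qed
  from smooth_inverse_function[OF O(1) sm O(3) this]
  obtain U' V g where U': "open U'" "U' \<subseteq> S" "(y0, h0) \<in> U'" and V: "open V" "\<Psi> (y0, h0) \<in> V"
    and hom: "homeomorphism U' V \<Psi> g" and g: "smooth_on V g" by blast
  \<comment> \<open>Zeros of \<open>G\<close> correspond to the points \<open>(y, 0)\<close> of
    \<open>V\<close>.\<close>
  define Y where "Y = (\<lambda>y. (y, 0)) -` V"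
  have "open Y" unfolding Y_def by (intro open_vimage V(1) continuous_intros)
  moreover have "y0 \<in> Y" using V(2) O(4) by (simp add: Y_def \<Psi>_def)
  moreover have "smooth_on Y (\<lambda>y. snd (g (y, 0)))"
    using \<open>open Y\<close> by (intro smooth_intros smooth_on_compose[OF _ V(1) _ _ g]) (auto simp: Y_def)
  moreover have "snd (g (y0, 0)) = h0"
    using hom U'(3) O(4) unfolding homeomorphism_def by (metis \<Psi>_def fst_conv snd_conv)
  moreover have "(y, snd (g (y, 0))) \<in> S \<and> G (y, snd (g (y, 0))) = 0" if "y \<in> Y" for y
  proof -
    have "g (y, 0) \<in> U'" "\<Psi> (g (y, 0)) = (y, 0)"
      using hom that by (auto simp: homeomorphism_def Y_def)
    then show ?thesis using U'(2) by (cases "g (y, 0)") (auto simp: \<Psi>_def)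
  qed
  ultimately show thesis by (rule that)
qed

subsection \<open>Maps between subsets of Euclidean spaces and their quotients\<close>

text \<open>The condition in \<open>sfun (eucl_space S)\<close>, but for vector-valued functions, so
  that maps between subsets can be treated without testing them against real functions.\<close>

definition locally_smooth ::
  "'a::euclidean_space set \<Rightarrow> ('a \<Rightarrow> 'b::real_normed_vector) \<Rightarrow> bool" where
  "locally_smooth S f \<longleftrightarrow>
     (\<forall>x\<in>S. \<exists>W g. open W \<and> x \<in> W \<and> smooth_on W g \<and> (\<forall>y\<in>S \<inter> W. g y = f y))"

lemma sfun_eucl_space: "f \<in> sfun (eucl_space S) U \<longleftrightarrow> locally_smooth U f"
  by (simp add: eucl_space_def locally_smooth_def)

lemma stop_eucl_space [simp]: "stop (eucl_space S) = top_of_set S"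
  by (simp add: eucl_space_def)

lemma locally_smooth_cong:
  "(\<And>x. x \<in> S \<Longrightarrow> f x = g x) \<Longrightarrow> locally_smooth S f \<longleftrightarrow> locally_smooth S g"
  by (simp add: locally_smooth_def)

lemma locally_smooth_subset:
  assumes "locally_smooth S f" "T \<subseteq> S" shows "locally_smooth T f"
  unfolding locally_smooth_def
proof
  fix x assume "x \<in> T"
  then obtain W g where "open W" "x \<in> W" "smooth_on W g" "\<forall>y\<in>S \<inter> W. g y = f y"
    using assms unfolding locally_smooth_def by blast
  then show "\<exists>W g. open W \<and> x \<in> W \<and> smooth_on W g \<and> (\<forall>y\<in>T \<inter> W. g y = f y)"
    using assms(2) by blast
qed

lemma smooth_on_imp_locally_smooth: "open W \<Longrightarrow> smooth_on W f \<Longrightarrow> S \<subseteq> W \<Longrightarrow> locally_smooth S f"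
  unfolding locally_smooth_def by blast

lemma locally_smooth_continuous_on:
  assumes "locally_smooth S f" shows "continuous_on S f"
  unfolding continuous_on_eq_continuous_within
proof
  fix x assume x: "x \<in> S"
  then obtain W g where W: "open W" "x \<in> W" "smooth_on W g" "\<forall>y\<in>S \<inter> W. g y = f y"
    using assms unfolding locally_smooth_def by blast
  then have "continuous (at x within S) g"
    using smooth_on_continuous_on by (metis continuous_at_imp_continuous_at_within continuous_on_eq_continuous_at)
  moreover have "\<forall>\<^sub>F y in at x within S. f y = g y"
    unfolding eventually_at_topological using W by (intro exI[of _ W]) auto
  ultimately show "continuous (at x within S) f"
    using W x by (simp add: continuous_within tendsto_cong)
qed

lemma locally_smooth_compose:
  fixes \<phi> :: "'a::euclidean_space \<Rightarrow> 'b::euclidean_space"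
  assumes \<phi>: "locally_smooth A \<phi>" and f: "locally_smooth B f" and AB: "\<And>x. x \<in> A \<Longrightarrow> \<phi> x \<in> B"
  shows "locally_smooth A (\<lambda>x. f (\<phi> x))"
  unfolding locally_smooth_def
proof
  fix x assume x: "x \<in> A"
  obtain W h where W: "open W" "x \<in> W" "smooth_on W h" "\<forall>y\<in>A \<inter> W. h y = \<phi> y"
    using \<phi> x unfolding locally_smooth_def by blast
  obtain W' g where W': "open W'" "\<phi> x \<in> W'" "smooth_on W' g" "\<forall>y\<in>B \<inter> W'. g y = f y"
    using f AB[OF x] unfolding locally_smooth_def by blast
  let ?W = "W \<inter> h -` W'"
  have o: "open ?W" using smooth_on_continuous_on[OF W(3)] W(1) W'(1) by (simp add: continuous_open_preimage)
  moreover have "x \<in> ?W" using W W' x by simp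
  moreover have "smooth_on ?W (\<lambda>y. g (h y))"
    by (rule smooth_on_compose[OF o W'(1) _ _ W'(3)]) (auto intro: smooth_on_subset[OF W(3)])
  moreover have "\<forall>y\<in>A \<inter> ?W. g (h y) = f (\<phi> y)" using W(4) W'(4) AB by auto
  ultimately show "\<exists>W g. open W \<and> x \<in> W \<and> smooth_on W g \<and> (\<forall>y\<in>A \<inter> W. g y = f (\<phi> y))" by blast
qed

lemma locally_smooth_Pair:
  fixes f :: "'a::euclidean_space \<Rightarrow> 'b::real_normed_vector" and g :: "'a \<Rightarrow> 'c::real_normed_vector"
  assumes "locally_smooth A f" "locally_smooth A g"
  shows "locally_smooth A (\<lambda>x. (f x, g x))"
  unfolding locally_smooth_def
proof
  fix x assume x: "x \<in> A"
  obtain W h where W: "open W" "x \<in> W" "smooth_on W h" "\<forall>y\<in>A \<inter> W. h y = f y"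
    using assms(1) x unfolding locally_smooth_def by blast
  obtain W' h' where W': "open W'" "x \<in> W'" "smooth_on W' h'" "\<forall>y\<in>A \<inter> W'. h' y = g y"
    using assms(2) x unfolding locally_smooth_def by blast
  have "smooth_on (W \<inter> W') (\<lambda>y. (h y, h' y))"
    using W W' by (intro smooth_intros) (auto intro: smooth_on_subset)
  then show "\<exists>W k. open W \<and> x \<in> W \<and> smooth_on W k \<and> (\<forall>y\<in>A \<inter> W. k y = (f y, g y))"
    using W W' by (intro exI[of _ "W \<inter> W'"] exI[of _ "\<lambda>y. (h y, h' y)"]) auto
qed

lemma locally_smooth_bounded_linear:
  fixes f :: "'a::euclidean_space \<Rightarrow> 'b::real_normed_vector"
  assumes "bounded_linear f" shows "locally_smooth A f"
  using smooth_on_bounded_linear[OF assms open_UNIV smooth_on_ident[OF open_UNIV]]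
  by (rule smooth_on_imp_locally_smooth[OF open_UNIV]) simp

lemma locally_smooth_const: "locally_smooth A (\<lambda>x. c)"
  by (rule smooth_on_imp_locally_smooth[OF open_UNIV smooth_on_const[OF open_UNIV]]) simp

lemma locally_smooth_ident: "locally_smooth A (\<lambda>x. x)"
  by (rule locally_smooth_bounded_linear[OF bounded_linear_ident])

lemma smooth_map_eucl_space:
  fixes \<phi> :: "'a::euclidean_space \<Rightarrow> 'b::euclidean_space"
  assumes "locally_smooth A \<phi>" "\<And>x. x \<in> A \<Longrightarrow> \<phi> x \<in> B"
  shows "smooth_map (eucl_space A) (eucl_space B) \<phi>"
  unfolding smooth_map_def
proof (intro conjI allI impI)
  show "continuous_map (stop (eucl_space A)) (stop (eucl_space B)) \<phi>"
    using assms locally_smooth_continuous_on by auto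
  fix V and f :: "'b \<Rightarrow> real"
  assume "f \<in> sfun (eucl_space B) V"
  then have "locally_smooth V f" by (simp add: sfun_eucl_space)
  then show "f \<circ> \<phi> \<in> sfun (eucl_space A) {x \<in> topspace (stop (eucl_space A)). \<phi> x \<in> V}"
    unfolding sfun_eucl_space o_def
    by (rule locally_smooth_compose[rotated]) (auto intro: locally_smooth_subset[OF assms(1)])
qed

lemma stop_quotient_space [simp]: "stop (quotient_space X p) = quotient_topology (stop X) p"
  by (simp add: quotient_space_def)

lemma sfun_quotient_space:
  "f \<in> sfun (quotient_space X p) U \<longleftrightarrow> f \<circ> p \<in> sfun X {x \<in> topspace (stop X). p x \<in> U}"
  by (simp add: quotient_space_def)

lemma continuous_map_quotient_topology: "continuous_map X (quotient_topology X p) p"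
  by (auto simp: continuous_map_def openin_quotient_topology topspace_quotient_topology)

text \<open>Openness and smoothness downstairs are tested after pulling back along \<open>p\<close>,
  and there \<open>\<phi> \<circ> p\<close> may be replaced by
  \<open>q \<circ> \<Phi>\<close>.\<close>

lemma smooth_map_quotient:
  fixes \<Phi> :: "'a::euclidean_space \<Rightarrow> 'b::euclidean_space"
  assumes \<Phi>: "smooth_map (eucl_space A) (eucl_space B) \<Phi>"
    and comm: "\<And>x. x \<in> A \<Longrightarrow> \<phi> (p x) = q (\<Phi> x)"
  shows "smooth_map (quotient_space (eucl_space A) p) (quotient_space (eucl_space B) q) \<phi>"
  unfolding smooth_map_def
proof (intro conjI allI impI)
  have cont: "continuous_map (top_of_set A) (top_of_set B) \<Phi>" using \<Phi> by (simp add: smooth_map_def)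
  then have AB: "\<Phi> x \<in> B" if "x \<in> A" for x using that by (auto simp: continuous_map_def)
  show "continuous_map (stop (quotient_space (eucl_space A) p)) (stop (quotient_space (eucl_space B) q)) \<phi>"
    unfolding continuous_map_def
  proof (intro conjI allI impI)
    show "\<phi> \<in> topspace (stop (quotient_space (eucl_space A) p)) \<rightarrow>
        topspace (stop (quotient_space (eucl_space B) q))"
      using comm AB by (auto simp: topspace_quotient_topology)
    fix U assume "openin (stop (quotient_space (eucl_space B) q)) U"
    then have "openin (top_of_set B) {x \<in> B. q x \<in> U}" by (simp add: openin_quotient_topology)
    from openin_continuous_map_preimage[OF cont this]
    have "openin (top_of_set A) {x \<in> A. \<Phi> x \<in> {x \<in> B. q x \<in> U}}" by simp
    moreover have "{x \<in> A. \<Phi> x \<in> {x \<in> B. q x \<in> U}} = {x \<in> A. p x \<in> {y \<in> p ` A. \<phi> y \<in> U}}"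
      by (intro Collect_cong conj_cong refl) (simp add: comm AB)
    ultimately show "openin (stop (quotient_space (eucl_space A) p))
        {x \<in> topspace (stop (quotient_space (eucl_space A) p)). \<phi> x \<in> U}"
      by (simp add: openin_quotient_topology topspace_quotient_topology)
  qed
  fix V f
  assume V: "openin (stop (quotient_space (eucl_space B) q)) V"
    and f: "f \<in> sfun (quotient_space (eucl_space B) q) V"
  let ?S = "{x \<in> A. p x \<in> {y \<in> p ` A. \<phi> y \<in> V}}"
  have "f \<circ> q \<circ> \<Phi> \<in> sfun (eucl_space A) {x \<in> A. \<Phi> x \<in> {x \<in> B. q x \<in> V}}"
    using \<Phi> V f by (auto simp: smooth_map_def sfun_quotient_space openin_quotient_topology)
  moreover have "{x \<in> A. \<Phi> x \<in> {x \<in> B. q x \<in> V}} = ?S"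
    by (intro Collect_cong conj_cong refl) (simp add: comm AB)
  ultimately have "locally_smooth ?S (f \<circ> q \<circ> \<Phi>)" by (simp add: sfun_eucl_space)
  then have "locally_smooth ?S (f \<circ> \<phi> \<circ> p)"
    by (subst locally_smooth_cong[of _ _ "f \<circ> q \<circ> \<Phi>"]) (auto simp: comm)
  then show "f \<circ> \<phi> \<in> sfun (quotient_space (eucl_space A) p)
      {x \<in> topspace (stop (quotient_space (eucl_space A) p)). \<phi> x \<in> V}"
    by (simp add: sfun_quotient_space topspace_quotient_topology sfun_eucl_space)
qed

text \<open>Charts come from data upstairs: \<open>\<xi>\<close> is constant on the classes over
  \<open>U\<close> and separates them, and \<open>\<sigma>\<close> is a section of it. The chart is
  induced by \<open>\<xi>\<close>, and its inverse is \<open>p \<circ> \<sigma>\<close>.\<close>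

lemma quotient_chart:
  fixes \<xi> :: "'a::euclidean_space \<Rightarrow> 'b::euclidean_space" and p :: "'a \<Rightarrow> 'c" and M :: "'a set"
  defines "Q \<equiv> quotient_space (eucl_space M) p"
  assumes U: "openin (stop Q) U"
    and \<xi>: "locally_smooth {x \<in> M. p x \<in> U} \<xi>" "\<And>x. x \<in> M \<Longrightarrow> p x \<in> U \<Longrightarrow> \<xi> x \<in> V"
    and inv: "\<And>x y. x \<in> M \<Longrightarrow> y \<in> M \<Longrightarrow> p x \<in> U \<Longrightarrow> p x = p y \<Longrightarrow> \<xi> x = \<xi> y"
    and \<sigma>: "locally_smooth V \<sigma>" "\<And>v. v \<in> V \<Longrightarrow> \<sigma> v \<in> M \<and> p (\<sigma> v) \<in> U \<and> \<xi> (\<sigma> v) = v"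
    and p\<sigma>: "\<And>x. x \<in> M \<Longrightarrow> p x \<in> U \<Longrightarrow> p (\<sigma> (\<xi> x)) = p x"
  shows "\<exists>\<phi>. diffeomorphism (open_subspace Q U) (eucl_space V) \<phi>"
proof -
  define N where "N = {x \<in> M. p x \<in> U}"
  define \<phi> where "\<phi> u = \<xi> (SOME x. x \<in> M \<and> p x = u)" for u
  have \<phi>: "\<phi> (p x) = \<xi> x" if "x \<in> M" "p x \<in> U" for x
  proof -
    have "(SOME y. y \<in> M \<and> p y = p x) \<in> M \<and> p (SOME y. y \<in> M \<and> p y = p x) = p x"
      by (rule someI[of _ x]) (use that in auto)
    then show ?thesis unfolding \<phi>_def using inv that by metis
  qed
  have sQ: "stop (open_subspace Q U) = subtopology (quotient_topology (top_of_set M) p) U"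
    by (simp add: open_subspace_def Q_def)
  have sf: "f \<in> sfun (open_subspace Q U) W \<longleftrightarrow> locally_smooth {x \<in> M. p x \<in> W} (f \<circ> p)" for f W
    by (simp add: open_subspace_def Q_def sfun_quotient_space sfun_eucl_space)
  have UM: "U \<subseteq> p ` M" and N: "openin (top_of_set M) N"
    using U by (auto simp: Q_def openin_quotient_topology N_def)
  have tQ: "topspace (stop (open_subspace Q U)) = U"
    using UM unfolding sQ by (auto simp: topspace_quotient_topology)
  have oQ: "openin (stop (open_subspace Q U)) W \<longleftrightarrow>
      W \<subseteq> U \<and> openin (top_of_set M) {x \<in> M. p x \<in> W}" for W
  proof -
    have "openin (stop (open_subspace Q U)) W \<longleftrightarrow> openin (stop Q) W \<and> W \<subseteq> U"
      unfolding sQ using openin_open_subtopology[OF U] by (simp add: Q_def)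
    then show ?thesis using UM by (auto simp: Q_def openin_quotient_topology)
  qed
  have s\<xi>: "smooth_map (eucl_space N) (eucl_space V) \<xi>"
    by (rule smooth_map_eucl_space) (use \<xi> in \<open>auto simp: N_def\<close>)
  have s\<sigma>: "smooth_map (eucl_space V) (eucl_space M) \<sigma>"
    by (rule smooth_map_eucl_space) (use \<sigma> in auto)
  have 1: "smooth_map (open_subspace Q U) (eucl_space V) \<phi>"
    unfolding smooth_map_def continuous_map_def
  proof (intro conjI allI impI)
    show "\<phi> \<in> topspace (stop (open_subspace Q U)) \<rightarrow> topspace (stop (eucl_space V))"
      unfolding tQ using UM \<phi> \<xi>(2) by auto
    fix W
    assume W: "openin (stop (eucl_space V)) W"
    have eq: "{x \<in> M. p x \<in> {u \<in> U. \<phi> u \<in> W}} = {x \<in> N. \<xi> x \<in> W}" using \<phi> by (auto simp: N_def)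
    have "openin (top_of_set N) {x \<in> N. \<xi> x \<in> W}"
      using s\<xi> W openin_continuous_map_preimage[of "top_of_set N" "top_of_set V" \<xi> W]
      by (simp add: smooth_map_def)
    then have "openin (top_of_set M) {x \<in> N. \<xi> x \<in> W}" using N openin_trans by blast
    then show "openin (stop (open_subspace Q U)) {x \<in> topspace (stop (open_subspace Q U)). \<phi> x \<in> W}"
      unfolding oQ tQ eq by auto
    fix f :: "'b \<Rightarrow> real" assume "f \<in> sfun (eucl_space V) W"
    then have "f \<circ> \<xi> \<in> sfun (eucl_space N) {x \<in> N. \<xi> x \<in> W}"
      using s\<xi> W by (auto simp: smooth_map_def)
    then have "locally_smooth {x \<in> N. \<xi> x \<in> W} (f \<circ> \<xi>)" by (simp add: sfun_eucl_space)
    then show "f \<circ> \<phi> \<in> sfun (open_subspace Q U) {x \<in> topspace (stop (open_subspace Q U)). \<phi> x \<in> W}"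
      unfolding sf tQ eq
      by (subst locally_smooth_cong[of _ _ "f \<circ> \<xi>"]) (auto simp: \<phi> N_def)
  qed
  have 2: "smooth_map (eucl_space V) (open_subspace Q U) (p \<circ> \<sigma>)"
    unfolding smooth_map_def continuous_map_def
  proof (intro conjI allI impI)
    show "p \<circ> \<sigma> \<in> topspace (stop (eucl_space V)) \<rightarrow> topspace (stop (open_subspace Q U))"
      unfolding tQ using \<sigma>(2) by auto
    fix W
    assume W: "openin (stop (open_subspace Q U)) W"
    then have o: "openin (top_of_set M) {x \<in> M. p x \<in> W}" by (simp add: oQ)
    have eq: "{v \<in> V. (p \<circ> \<sigma>) v \<in> W} = {v \<in> V. \<sigma> v \<in> {x \<in> M. p x \<in> W}}" using \<sigma>(2) by auto
    show "openin (stop (eucl_space V)) {v \<in> topspace (stop (eucl_space V)). (p \<circ> \<sigma>) v \<in> W}"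
      using s\<sigma> openin_continuous_map_preimage[OF _ o, of "top_of_set V" \<sigma>] eq
      by (simp only: smooth_map_def stop_eucl_space topspace_euclidean_subtopology)
    fix f :: "'c \<Rightarrow> real" assume "f \<in> sfun (open_subspace Q U) W"
    then have "f \<circ> p \<in> sfun (eucl_space M) {x \<in> M. p x \<in> W}" by (simp add: sf sfun_eucl_space)
    then have "f \<circ> p \<circ> \<sigma> \<in> sfun (eucl_space V) {v \<in> V. \<sigma> v \<in> {x \<in> M. p x \<in> W}}"
      using s\<sigma> o by (auto simp: smooth_map_def)
    then show "f \<circ> (p \<circ> \<sigma>) \<in> sfun (eucl_space V) {v \<in> topspace (stop (eucl_space V)). (p \<circ> \<sigma>) v \<in> W}"
      by (simp only: eq o_assoc stop_eucl_space topspace_euclidean_subtopology)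
  qed
  have "\<forall>u\<in>U. p (\<sigma> (\<phi> u)) = u" using UM \<phi> p\<sigma> by auto
  moreover have "\<forall>v\<in>V. \<phi> (p (\<sigma> v)) = v" using \<phi> \<sigma>(2) by auto
  ultimately have "diffeomorphism (open_subspace Q U) (eucl_space V) \<phi>"
    unfolding diffeomorphism_def tQ using 1 2 by (intro exI[of _ "p \<circ> \<sigma>"]) auto
  then show ?thesis by blast
qed

subsection \<open>Hermitian linear algebra\<close>

abbreviation adj :: "complex^'d^'d \<Rightarrow> complex^'d^'d" where
  "adj \<equiv> conj_transpose"

definition hinner :: "complex^'d::finite \<Rightarrow> complex^'d \<Rightarrow> complex" where
  "hinner x y = (\<Sum>a\<in>UNIV. cnj (x $ a) * y $ a)"

lemma hinner_simps [simp]: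
  "hinner x 0 = 0" "hinner 0 x = 0"
  "hinner x (- y) = - hinner x y" "hinner (- x) y = - hinner x y"
  "hinner x (z *s y) = z * hinner x y" "hinner (z *s x) y = cnj z * hinner x y"
  "hinner x (t *\<^sub>R y) = t *\<^sub>R hinner x y" "hinner (t *\<^sub>R x) y = t *\<^sub>R hinner x y"
  by (simp_all add: hinner_def sum_distrib_left sum_negf scaleR_conv_of_real[where 'a = complex]
      mult.assoc mult.left_commute scaleR_right.sum[symmetric])

lemma hinner_add:
  "hinner x (y + z) = hinner x y + hinner x z" "hinner (x + y) z = hinner x z + hinner y z"
  "hinner x (y - z) = hinner x y - hinner x z" "hinner (x - y) z = hinner x z - hinner y z"
  by (simp_all add: hinner_def sum.distrib sum_subtractf algebra_simps)

lemma hinner_sum: "hinner x (\<Sum>i\<in>I. f i) = (\<Sum>i\<in>I. hinner x (f i))"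
  by (induction I rule: infinite_finite_induct) (simp_all add: hinner_add)

lemma cnj_hinner [simp]: "cnj (hinner x y) = hinner y x"
  by (simp add: hinner_def mult.commute)

lemma Re_hinner: "Re (hinner x y) = x \<bullet> y"
  by (simp add: hinner_def inner_vec_def inner_complex_def)

lemma hinner_self: "hinner x x = of_real ((norm x)\<^sup>2)"
proof -
  have "Im (hinner x x) = 0" by (simp add: complex_is_Real_iff[symmetric] Reals_cnj_iff)
  then show ?thesis by (simp add: complex_eq_iff Re_hinner power2_norm_eq_inner)
qed

lemma matrix_vector_mult_complex_simps:
  fixes A :: "complex^'d::finite^'d"
  shows "A *v (t *\<^sub>R x) = t *\<^sub>R (A *v x)" "(t *\<^sub>R A) *v x = t *\<^sub>R (A *v x)"
    "A *v (z *s x) = z *s (A *v x)"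
  by (simp_all add: matrix_vector_mult_def vec_eq_iff scaleR_right.sum sum_distrib_left
      scaleR_conv_of_real[where 'a = complex] mult.left_commute mult.assoc)

lemma sum_matrix_vector_mult:
  fixes A :: "'i \<Rightarrow> complex^'d::finite^'d"
  shows "(\<Sum>i\<in>I. A i) *v x = (\<Sum>i\<in>I. A i *v x)"
  by (induction I rule: infinite_finite_induct) (simp_all add: matrix_vector_mult_add_rdistrib)

lemma linear_matrix_vector_mult_complex:
  fixes A :: "complex^'d::finite^'d" shows "linear (\<lambda>x. A *v x)"
  by (rule linearI) (simp_all add: matrix_vector_right_distrib matrix_vector_mult_complex_simps)

lemma adj_adj [simp]: "adj (adj A) = A"
  by (simp add: conj_transpose_def vec_eq_iff)

lemma adj_mult: "adj (A ** B) = adj B ** adj (A :: complex^'d::finite^'d)"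
  by (simp add: conj_transpose_def vec_eq_iff matrix_matrix_mult_def mult.commute)

lemma adj_simps [simp]:
  "adj (A + B) = adj A + adj B" "adj (A - B) = adj A - adj B" "adj (- A) = - adj A" "adj 0 = 0"
  "adj (t *\<^sub>R A) = t *\<^sub>R adj A" "adj (mat z) = mat (cnj z)"
  by (simp_all add: conj_transpose_def vec_eq_iff mat_def)

lemma adj_sum: "adj (\<Sum>i\<in>I. A i) = (\<Sum>i\<in>I. adj (A i))"
  by (induction I rule: infinite_finite_induct) simp_all

lemma hinner_adj: "hinner x (A *v y) = hinner (adj A *v x) y"
proof -
  have "hinner x (A *v y) = (\<Sum>a\<in>UNIV. \<Sum>b\<in>UNIV. cnj (x $ a) * (A $ a $ b * y $ b))"
    by (simp add: hinner_def matrix_vector_mult_def sum_distrib_left)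
  also have "\<dots> = (\<Sum>b\<in>UNIV. \<Sum>a\<in>UNIV. cnj (x $ a) * (A $ a $ b * y $ b))" by (rule sum.swap)
  also have "\<dots> = hinner (adj A *v x) y"
    by (simp add: hinner_def matrix_vector_mult_def sum_distrib_left sum_distrib_right
        conj_transpose_def mult_ac)
  finally show ?thesis .
qed

lemma line_projection_mult: "line_projection w *v x = hinner w x *s w"
  by (simp add: line_projection_def matrix_vector_mult_def hinner_def vec_eq_iff sum_distrib_left mult_ac)

lemma adj_line_projection [simp]: "adj (line_projection w) = line_projection w"
  by (simp add: line_projection_def conj_transpose_def vec_eq_iff mult.commute)

lemma conjugate_line_projection:
  fixes A :: "complex^'d::finite^'d"
  shows "A ** line_projection w ** adj A = line_projection (A *v w)"
proof (rule matrix_eq[THEN iffD2], rule allI)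
  fix x
  show "(A ** line_projection w ** adj A) *v x = line_projection (A *v w) *v x"
    by (simp add: matrix_vector_mul_assoc[symmetric] line_projection_mult
        matrix_vector_mult_complex_simps hinner_adj[of w "adj A"])
qed

lemma trace_mult_line_projection: "trace (A ** line_projection w) = hinner w (A *v w)"
  by (simp add: trace_def line_projection_def matrix_matrix_mult_def hinner_def
      matrix_vector_mult_def sum_distrib_left mult_ac)

lemma trace_line_projection: "trace (line_projection w) = of_real ((norm w)\<^sup>2)"
  using trace_mult_line_projection[of "mat 1" w] by (simp add: hinner_self)

lemma line_projection_scale: "line_projection (z *s w) = ((cmod z)\<^sup>2) *\<^sub>R line_projection w"
proof -
  have "z * w $ a * (cnj z * cnj (w $ b)) = of_real ((cmod z)\<^sup>2) * (w $ a * cnj (w $ b))" for a b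
    unfolding complex_norm_square by (simp only: mult_ac)
  then show ?thesis
    by (simp add: line_projection_def vec_eq_iff scaleR_conv_of_real[where 'a = complex] del: of_real_power)
qed

lemma trace_scaleR: "trace (t *\<^sub>R A :: complex^'d::finite^'d) = t *\<^sub>R trace A"
  by (simp add: trace_def scaleR_right.sum)

lemma trace_sum: "trace (\<Sum>i\<in>I. A i :: complex^'d::finite^'d) = (\<Sum>i\<in>I. trace (A i))"
  by (induction I rule: infinite_finite_induct) (simp_all add: trace_0[unfolded mat_0] trace_add)

text \<open>Pythagoras for the projection onto the line of \<open>u\<close>: the gap in the
  Cauchy--Schwarz inequality is an exact square.\<close>

lemma norm_minus_hinner_projection:
  assumes "u \<noteq> 0"
  shows "(norm (y - (hinner u y / of_real ((norm u)\<^sup>2)) *s u))\<^sup>2 =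
    (norm y)\<^sup>2 - (cmod (hinner u y))\<^sup>2 / (norm u)\<^sup>2"
proof -
  let ?c = "hinner u y / of_real ((norm u)\<^sup>2)"
  have nz: "complex_of_real ((norm u)\<^sup>2) \<noteq> 0" using assms by simp
  have "complex_of_real ((norm (y - ?c *s u))\<^sup>2) =
      of_real ((norm y)\<^sup>2) - ?c * hinner y u - cnj ?c * hinner u y + cnj ?c * ?c * of_real ((norm u)\<^sup>2)"
    unfolding hinner_self[symmetric] by (simp add: hinner_add algebra_simps)
  also have "\<dots> = of_real ((norm y)\<^sup>2) - hinner u y * cnj (hinner u y) / of_real ((norm u)\<^sup>2)"
    using nz by (simp add: field_simps)
  also have "\<dots> = of_real ((norm y)\<^sup>2 - (cmod (hinner u y))\<^sup>2 / (norm u)\<^sup>2)"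
    unfolding complex_norm_square[symmetric] by simp
  finally show ?thesis unfolding of_real_eq_iff .
qed

text \<open>Complex subspaces are kept as real ones stable under multiplication by i, so that the
  real \<open>dim\<close> applies. All dimensions are therefore twice the complex ones.\<close>

definition csubspace :: "(complex^'d::finite) set \<Rightarrow> bool" where
  "csubspace V \<longleftrightarrow> subspace V \<and> (\<forall>x\<in>V. \<i> *s x \<in> V)"

lemma csubspaceI:
  assumes "0 \<in> V" "\<And>x y. x \<in> V \<Longrightarrow> y \<in> V \<Longrightarrow> x + y \<in> V" "\<And>z x. x \<in> V \<Longrightarrow> z *s x \<in> V"
  shows "csubspace V"
proof -
  have "t *\<^sub>R x = of_real t *s x" for t and x :: "complex^'a"
    by (simp add: vec_eq_iff scaleR_conv_of_real[where 'a = complex])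
  then show ?thesis using assms by (auto simp: csubspace_def subspace_def)
qed

lemma DIM_complex_vec: "DIM(complex^'d::finite) = 2 * CARD('d)"
  by simp

text \<open>Splitting off the complex line of a nonzero \<open>x\<close>, of real dimension two,
  leaves its Hermitian orthogonal complement, again complex. Evenness makes half of
  \<open>dim V\<close> an integer \<open>k\<close> as in the equation of a wall.\<close>

lemma even_dim_csubspace:
  fixes V :: "(complex^'d::finite) set"
  assumes "csubspace V" shows "even (dim V)"
  using assms
proof (induction "dim V" arbitrary: V rule: less_induct)
  case less
  show ?case
  proof (cases "V \<subseteq> {0}")
    case False
    then obtain x where x: "x \<in> V" "x \<noteq> 0" by auto
    define W where "W = {y \<in> V. hinner x y = 0}"
    let ?A = "span {x, \<i> *s x}"
    have Vs: "subspace V" using less.prems by (simp add: csubspace_def)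
    have ix: "\<i> *s x \<in> V" using less.prems x by (simp add: csubspace_def)
    have orth: "orthogonal x (\<i> *s x)"
      unfolding orthogonal_def Re_hinner[symmetric] by (simp add: hinner_self)
    have ix0: "\<i> *s x \<noteq> 0" using x by (auto simp: vec_eq_iff)
    have ne: "x \<noteq> \<i> *s x" using orth x by (metis orthogonal_self)
    have "pairwise orthogonal {x, \<i> *s x}"
      using orth by (auto simp: pairwise_insert orthogonal_commute)
    then have "independent {x, \<i> *s x}"
      by (rule pairwise_orthogonal_independent) (use x ix0 in auto)
    then have dA: "dim ?A = 2" using ne by (simp add: dim_span dim_eq_card_independent)
    have AV: "?A \<subseteq> V" using Vs x ix by (intro span_minimal) auto
    have eq: "{y \<in> V. \<forall>z\<in>?A. orthogonal z y} = W"
    proof (intro set_eqI iffI)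
      fix y assume "y \<in> {y \<in> V. \<forall>z\<in>?A. orthogonal z y}"
      then have "y \<in> V" "x \<bullet> y = 0" "(\<i> *s x) \<bullet> y = 0"
        by (auto simp: orthogonal_def span_base)
      then show "y \<in> W" unfolding W_def Re_hinner[symmetric] by (simp add: complex_eq_iff)
    next
      fix y assume y: "y \<in> W"
      then have "orthogonal y x" "orthogonal y (\<i> *s x)"
        using cnj_hinner[of x y] by (auto simp: W_def orthogonal_def Re_hinner[symmetric])
      then have "orthogonal y z" if "z \<in> ?A" for z
        using that by (auto intro: orthogonal_to_span)
      then show "y \<in> {y \<in> V. \<forall>z\<in>?A. orthogonal z y}"
        using y by (auto simp: W_def orthogonal_commute)
    qed
    have "dim W + 2 = dim V"
      using dim_subspace_orthogonal_to_vectors[OF subspace_span Vs AV] using dA by (simp only: eq)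
    moreover have "csubspace W"
      using less.prems
      by (auto simp: W_def csubspace_def subspace_def hinner_add)
    ultimately show ?thesis using less.hyps[of W] by (metis even_add even_numeral less_add_same_cancel1 zero_less_numeral)
  qed (metis dim_eq_0 even_zero)
qed

subsection \<open>Tight frames and stability\<close>

text \<open>Closed polygons with side-lengths \<open>r\<close> correspond to tight frames up to phases; the lengths are
  the squared norms, so that no unit vectors are needed.\<close>

definition tight_frame :: "real^'n::finite \<Rightarrow> (complex^'d::finite)^'n \<Rightarrow> bool" where
  "tight_frame r u \<longleftrightarrow> (\<forall>i. r $ i > 0 \<and> (norm (u $ i))\<^sup>2 = r $ i) \<and>
     (\<Sum>i\<in>UNIV. line_projection (u $ i)) = mat (of_real ((\<Sum>i\<in>UNIV. r $ i) / CARD('d)))"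

definition polygon_of :: "(complex^'d)^'n \<Rightarrow> ('d::finite, 'n::finite) polygon" where
  "polygon_of u = (\<chi> i. line_projection (u $ i))"

lemma trace_mat: "trace (mat z :: complex^'d::finite^'d) = of_nat CARD('d) * z"
  by (simp add: trace_def mat_def)

lemma line_projection_scaleR: "line_projection (t *\<^sub>R w) = t\<^sup>2 *\<^sub>R line_projection w"
  by (simp add: line_projection_def vec_eq_iff power2_eq_square)

lemma is_edge_iff:
  "is_edge r A \<longleftrightarrow> r > 0 \<and> (\<exists>w. (norm w)\<^sup>2 = r \<and> A = line_projection w)" for A :: "complex^'d::finite^'d"
proof (intro iffI conjI)
  assume e: "is_edge r A"
  then show "r > 0" by (simp add: is_edge_def)
  obtain w where w: "norm w = 1" "A = r *\<^sub>R line_projection w" using e by (auto simp: is_edge_def)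
  show "\<exists>w. (norm w)\<^sup>2 = r \<and> A = line_projection w"
    using w \<open>r > 0\<close>
    by (intro exI[of _ "sqrt r *\<^sub>R w"]) (simp add: power_mult_distrib line_projection_scaleR)
next
  assume r: "r > 0 \<and> (\<exists>w. (norm w)\<^sup>2 = r \<and> A = line_projection w)"
  then obtain w where w: "(norm w)\<^sup>2 = r" "A = line_projection w" by blast
  have n: "norm w > 0" "norm w = sqrt r" using w r by (auto simp: real_sqrt_unique)
  have "A = r *\<^sub>R line_projection (inverse (norm w) *\<^sub>R w)"
    using w n r by (simp add: line_projection_scaleR power_inverse)
  moreover have "norm (inverse (norm w) *\<^sub>R w) = 1" using n by simp
  ultimately show "is_edge r A" using r unfolding is_edge_def by blast
qed

lemma closed_polygons_iff:
  "e \<in> closed_polygons r \<longleftrightarrow> (\<exists>u. tight_frame r u \<and> e = polygon_of u)"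
  for e :: "('d::finite, 'n::finite) polygon"
proof
  assume "e \<in> closed_polygons r"
  then have e: "e \<in> CPol" "side_lengths e = r" by (auto simp: closed_polygons_def)
  then have "\<forall>i. \<exists>s. is_edge s (e $ i)" by (simp add: CPol_def)
  then obtain s where "\<And>i. is_edge (s i) (e $ i)" by metis
  moreover from this have "side_lengths e = (\<chi> i. s i)" by (intro side_lengths_eq) simp
  ultimately have edge: "is_edge (r $ i) (e $ i)" for i using e by auto
  then obtain u where u: "\<And>i. (norm (u i))\<^sup>2 = r $ i \<and> e $ i = line_projection (u i)"
    unfolding is_edge_iff by metis
  obtain c where c: "(\<Sum>i\<in>UNIV. e $ i) = mat c" using e by (auto simp: CPol_def)
  \<comment> \<open>Comparing traces determines the scalar \<open>c\<close>.\<close>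
  have "trace (\<Sum>i\<in>UNIV. e $ i) = of_real (\<Sum>i\<in>UNIV. r $ i)"
    using trace_is_edge[OF edge] by (simp add: trace_sum)
  then have "c = of_real ((\<Sum>i\<in>UNIV. r $ i) / CARD('d))"
    unfolding c trace_mat by (simp add: field_simps)
  then have "tight_frame r (\<chi> i. u i)"
    using u edge c by (simp add: tight_frame_def is_edge_iff)
  moreover have "e = polygon_of (\<chi> i. u i)" using u by (simp add: polygon_of_def vec_eq_iff)
  ultimately show "\<exists>u. tight_frame r u \<and> e = polygon_of u" by blast
next
  assume "\<exists>u. tight_frame r u \<and> e = polygon_of u"
  then obtain u where u: "tight_frame r u" "e = polygon_of u" by blast
  then have "is_edge (r $ i) (e $ i)" for i
    by (auto simp: tight_frame_def polygon_of_def is_edge_iff)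
  moreover have "(\<Sum>i\<in>UNIV. e $ i) = mat (of_real ((\<Sum>i\<in>UNIV. r $ i) / CARD('d)))"
    using u by (simp add: tight_frame_def polygon_of_def)
  ultimately show "e \<in> closed_polygons r"
    unfolding closed_polygons_def CPol_def by (auto intro: side_lengths_eq)
qed

text \<open>Pairing the first identity, the reconstruction formula of a tight frame, with
  \<open>x\<close> gives the second, its Parseval identity.\<close>

lemma tight_frame_hinner:
  assumes "tight_frame r (u :: (complex^'d::finite)^'n::finite)"
  shows "(\<Sum>i\<in>UNIV. hinner (u $ i) x *s u $ i) = ((\<Sum>i\<in>UNIV. r $ i) / CARD('d)) *\<^sub>R x"
    and "(\<Sum>i\<in>UNIV. (cmod (hinner (u $ i) x))\<^sup>2) = (\<Sum>i\<in>UNIV. r $ i) / CARD('d) * (norm x)\<^sup>2"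
proof -
  let ?c = "(\<Sum>i\<in>UNIV. r $ i) / CARD('d)"
  have "(\<Sum>i\<in>UNIV. hinner (u $ i) x *s u $ i) = (\<Sum>i\<in>UNIV. line_projection (u $ i)) *v x"
    by (simp add: sum_matrix_vector_mult line_projection_mult)
  also have "\<dots> = mat (of_real ?c) *v x" using assms by (simp add: tight_frame_def)
  also have "\<dots> = ?c *\<^sub>R x"
    by (simp add: vec_eq_iff matrix_vector_mult_def mat_def if_distrib if_distribR
        scaleR_conv_of_real[where 'a = complex] cong: if_cong)
  finally show 1: "(\<Sum>i\<in>UNIV. hinner (u $ i) x *s u $ i) = ?c *\<^sub>R x" .
  have "complex_of_real (\<Sum>i\<in>UNIV. (cmod (hinner (u $ i) x))\<^sup>2) = hinner x (\<Sum>i\<in>UNIV. hinner (u $ i) x *s u $ i)"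
    unfolding hinner_sum of_real_sum complex_norm_square by simp
  also have "\<dots> = of_real (?c * (norm x)\<^sup>2)"
    unfolding 1 hinner_simps hinner_self by (simp add: scaleR_conv_of_real)
  finally show "(\<Sum>i\<in>UNIV. (cmod (hinner (u $ i) x))\<^sup>2) = ?c * (norm x)\<^sup>2"
    by (rule of_real_eq_iff[THEN iffD1])
qed

lemma tight_frame_sum_pos:
  assumes "tight_frame r u" shows "(\<Sum>i\<in>UNIV. r $ i) > 0"
  using assms by (intro sum_pos) (auto simp: tight_frame_def)

text \<open>Sum the Parseval identity over a real orthonormal basis of \<open>V\<close>. A frame
  vector in \<open>V\<close> contributes twice its squared norm, once for itself and once for its
  multiple by i, and every other vector contributes a nonnegative amount.\<close>

lemma subspace_stability:
  assumes t: "tight_frame r (u :: (complex^'d::finite)^'n::finite)" and V: "csubspace V"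
  shows "2 * CARD('d) * (\<Sum>i | u $ i \<in> V. r $ i) \<le> (\<Sum>i\<in>UNIV. r $ i) * dim V"
proof -
  have Vs: "subspace V" using V by (simp add: csubspace_def)
  obtain B where B: "B \<subseteq> V" "pairwise orthogonal B" "\<And>x. x \<in> B \<Longrightarrow> norm x = 1"
    "independent B" "card B = dim V" "span B = V"
    using orthonormal_basis_subspace[OF Vs] by metis
  have fB: "finite B" using B(4) by (rule independent_imp_finite)
  have parseval: "(\<Sum>b\<in>B. (x \<bullet> b)\<^sup>2) = (norm x)\<^sup>2" if "x \<in> V" for x
  proof -
    have "(norm x)\<^sup>2 = x \<bullet> (\<Sum>b\<in>B. (x \<bullet> b) *\<^sub>R b)"
      using orthonormal_basis_expand[OF B(2,3) _ fB] that B(6) by (simp add: power2_norm_eq_inner)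
    then show ?thesis by (simp add: inner_sum_right power2_eq_square)
  qed
  have cm: "(cmod (hinner x b))\<^sup>2 = (x \<bullet> b)\<^sup>2 + ((\<i> *s x) \<bullet> b)\<^sup>2" for x b :: "complex^'d"
    unfolding Re_hinner[symmetric] by (simp add: cmod_power2)
  have "(\<Sum>i | u $ i \<in> V. 2 * r $ i) = (\<Sum>i | u $ i \<in> V. \<Sum>b\<in>B. (cmod (hinner (u $ i) b))\<^sup>2)"
  proof (rule sum.cong[OF refl])
    fix i assume "i \<in> {i. u $ i \<in> V}"
    then have "u $ i \<in> V" by simp
    moreover from this have "\<i> *s u $ i \<in> V" using V by (simp add: csubspace_def)
    moreover have "norm (\<i> *s u $ i) = norm (u $ i)"
      by (simp add: norm_vec_def norm_mult)
    ultimately show "2 * r $ i = (\<Sum>b\<in>B. (cmod (hinner (u $ i) b))\<^sup>2)"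
      using t by (simp add: cm sum.distrib parseval tight_frame_def)
  qed
  also have "\<dots> \<le> (\<Sum>i\<in>UNIV. \<Sum>b\<in>B. (cmod (hinner (u $ i) b))\<^sup>2)"
    by (intro sum_mono2 sum_nonneg) auto
  also have "\<dots> = (\<Sum>b\<in>B. \<Sum>i\<in>UNIV. (cmod (hinner (u $ i) b))\<^sup>2)" by (rule sum.swap)
  also have "\<dots> = (\<Sum>i\<in>UNIV. r $ i) / CARD('d) * dim V"
    using B(3) by (simp add: tight_frame_hinner(2)[OF t] B(5))
  finally have "2 * (\<Sum>i | u $ i \<in> V. r $ i) \<le> (\<Sum>i\<in>UNIV. r $ i) / CARD('d) * dim V"
    unfolding sum_distrib_left[symmetric] .
  then show ?thesis by (simp add: field_simps)
qed

text \<open>The equation of a wall, with \<open>k\<close> in place of \<open>CARD('d) - k\<close>.\<close>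

definition generic :: "'d::finite itself \<Rightarrow> real^'n::finite \<Rightarrow> bool" where
  "generic _ r \<longleftrightarrow> (\<forall>I k. I \<noteq> {} \<longrightarrow> I \<noteq> UNIV \<longrightarrow> 1 \<le> k \<longrightarrow> k < CARD('d) \<longrightarrow>
     CARD('d) * (\<Sum>i\<in>I. r $ i) \<noteq> real k * (\<Sum>i\<in>UNIV. r $ i))"

text \<open>Equality would be the equation of a wall with \<open>k\<close> half of
  \<open>dim V\<close>. That \<open>dim V\<close> is neither zero nor full excludes the cases in
  which \<open>I\<close> is empty or everything.\<close>

lemma generic_dim:
  fixes V :: "(complex^'d::finite) set"
  assumes r: "\<And>i. r $ i > 0" and g: "generic TYPE('d) (r :: real^'n::finite)"
    and V: "csubspace V" "0 < dim V" "dim V < 2 * CARD('d)"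
  shows "2 * CARD('d) * (\<Sum>i\<in>I. r $ i) \<noteq> (\<Sum>i\<in>UNIV. r $ i) * dim V"
proof
  assume eq: "2 * CARD('d) * (\<Sum>i\<in>I. r $ i) = (\<Sum>i\<in>UNIV. r $ i) * dim V"
  obtain k where k: "dim V = 2 * k" using even_dim_csubspace[OF V(1)] by (rule evenE)
  have R: "(\<Sum>i\<in>UNIV. r $ i) > 0" using r by (intro sum_pos) auto
  have eq': "CARD('d) * (\<Sum>i\<in>I. r $ i) = real k * (\<Sum>i\<in>UNIV. r $ i)" using eq k by simp
  have "I \<noteq> {}"
  proof
    assume "I = {}"
    then have "(\<Sum>i\<in>UNIV. r $ i) * dim V = 0" using eq by simp
    then show False using R V(2) by (simp del: dim_eq_0)
  qed
  moreover have "I \<noteq> UNIV" using eq' R V(3) k by auto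
  ultimately show False using g eq' V k by (auto simp: generic_def)
qed

lemma subspace_stability_strict:
  assumes t: "tight_frame r (u :: (complex^'d::finite)^'n::finite)" and g: "generic TYPE('d) r"
    and V: "csubspace V" "0 < dim V" "dim V < 2 * CARD('d)"
  shows "2 * CARD('d) * (\<Sum>i | u $ i \<in> V. r $ i) < (\<Sum>i\<in>UNIV. r $ i) * dim V"
  using subspace_stability[OF t V(1)] generic_dim[OF _ g V, of "{i. u $ i \<in> V}"] t
  by (simp add: tight_frame_def)

text \<open>Adding the inequalities makes the total weight smaller than itself. This is the
  contradiction behind every argument in which a configuration splits along two complementary
  subspaces.\<close>

lemma no_complementary_stability:
  fixes r :: "real^'n::finite"
  assumes "\<And>i. r $ i > 0" and IJ: "I \<union> J = UNIV" and ab: "a + b \<le> 2 * CARD('d::finite)"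
    and I: "2 * CARD('d) * (\<Sum>i\<in>I. r $ i) < (\<Sum>i\<in>UNIV. r $ i) * real a"
    and J: "2 * CARD('d) * (\<Sum>i\<in>J. r $ i) \<le> (\<Sum>i\<in>UNIV. r $ i) * real b"
  shows False
proof -
  have r: "r $ i \<ge> 0" for i using assms(1)[of i] by simp
  have "(\<Sum>i\<in>UNIV. r $ i) = (\<Sum>i\<in>I. r $ i) + (\<Sum>i\<in>J - I. r $ i)"
    using IJ by (subst sum.union_disjoint[symmetric]) auto
  also have "\<dots> \<le> (\<Sum>i\<in>I. r $ i) + (\<Sum>i\<in>J. r $ i)"
    using r by (intro add_left_mono sum_mono2) auto
  finally have "2 * CARD('d) * (\<Sum>i\<in>UNIV. r $ i) \<le> 2 * CARD('d) * (\<Sum>i\<in>I. r $ i) + 2 * CARD('d) * (\<Sum>i\<in>J. r $ i)"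
    by (simp add: distrib_left[symmetric])
  also have "\<dots> < (\<Sum>i\<in>UNIV. r $ i) * real (a + b)"
    using add_less_le_mono[OF I J] by (simp add: algebra_simps)
  also have "\<dots> \<le> (\<Sum>i\<in>UNIV. r $ i) * real (2 * CARD('d))"
    using ab r by (intro mult_left_mono sum_nonneg) (simp_all only: of_nat_le_iff)
  finally show False by simp
qed

lemma dim_pos_iff: "0 < dim V \<longleftrightarrow> (\<exists>x\<in>V. x \<noteq> 0)" for V :: "'a::euclidean_space set"
  using dim_eq_0[of V] by (metis gr0I less_numeral_extra(3) singletonD singletonI subsetD subsetI)

lemma dim_less_iff: "subspace V \<Longrightarrow> dim V < DIM('a) \<longleftrightarrow> V \<noteq> UNIV" for V :: "'a::euclidean_space set"
  using dim_eq_full[of V] dim_subset_UNIV[of V] span_eq_iff[of V] by (metis le_neq_implies_less less_irrefl)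

text \<open>Decomposing along an eigenspace and its orthogonal complement would violate stability.\<close>

lemma eigenvectors_imp_scalar:
  fixes u :: "(complex^'d::finite)^'n::finite"
  assumes t: "tight_frame r u" and g: "generic TYPE('d) r"
    and H: "adj H = H" and ev: "\<And>i. \<exists>z. H *v u $ i = z *s u $ i"
  shows "\<exists>l::real. H = mat (of_real l)"
proof -
  obtain z where z: "\<And>i. H *v u $ i = z i *s u $ i" using ev by metis
  have nz: "u $ i \<noteq> 0" for i using t unfolding tight_frame_def by (metis norm_zero less_irrefl power_zero_numeral)
  define i0 :: 'n where "i0 = undefined"
  define V where "V = {x. H *v x = z i0 *s x}"
  define W where "W = {x. \<forall>y\<in>V. hinner y x = 0}"
  have zr: "cnj (z i) = z i" for i
    using hinner_adj[of "u $ i" H "u $ i"] nz[of i] by (simp add: H z hinner_self)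
  have V: "csubspace V"
    by (rule csubspaceI) (simp_all add: V_def matrix_vector_right_distrib matrix_vector_mult_complex_simps
        vector_ssub_ldistrib vector_add_ldistrib mult.commute)
  have W: "csubspace W" by (rule csubspaceI) (auto simp: W_def hinner_add)
  have Vs: "subspace V" and Ws: "subspace W" using V W by (auto simp: csubspace_def)
  have i0: "u $ i0 \<in> V" by (simp add: V_def z)
  have "V = UNIV"
  proof (rule ccontr)
    assume nU: "V \<noteq> UNIV"
    \<comment> \<open>As \<open>V\<close> is stable under multiplication by i, real and Hermitian
      orthogonality to it agree, and the real dimension formula applies to \<open>W\<close>.\<close>
    have W_eq: "W = {y \<in> UNIV. \<forall>x\<in>V. orthogonal x y}"
    proof -
      have "hinner y x = 0" if "\<forall>y\<in>V. y \<bullet> x = 0" "y \<in> V" for x y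
      proof -
        have "Re (hinner y x) = 0" "Re (hinner (\<i> *s y) x) = 0"
          unfolding Re_hinner using that V by (auto simp: csubspace_def)
        then show ?thesis by (simp add: complex_eq_iff)
      qed
      then show ?thesis by (auto simp: W_def orthogonal_def Re_hinner[symmetric])
    qed
    have dd: "dim W + dim V = 2 * CARD('d)"
      using dim_subspace_orthogonal_to_vectors[OF Vs subspace_UNIV subset_UNIV]
      by (simp add: W_eq)
    have dV: "0 < dim V" "dim V < 2 * CARD('d)"
      using nz i0 nU dim_less_iff[OF Vs] by (auto simp: dim_pos_iff simp del: dim_eq_0)
    \<comment> \<open>Eigenvectors of a Hermitian matrix for different eigenvalues are
      orthogonal.\<close>
    have "u $ i \<in> W" if "u $ i \<notin> V" for i
    proof -
      have "z i \<noteq> z i0" using that z by (auto simp: V_def)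
      moreover have "z i * hinner y (u $ i) = z i0 * hinner y (u $ i)" if "y \<in> V" for y
        using hinner_adj[of y H "u $ i"] that zr[of i0] by (simp add: H z V_def)
      ultimately show ?thesis by (auto simp: W_def)
    qed
    then have "{i. u $ i \<in> V} \<union> {i. u $ i \<in> W} = UNIV" by auto
    moreover have "r $ i > 0" for i using t by (simp add: tight_frame_def)
    moreover have "dim V + dim W \<le> 2 * CARD('d)" using dd by simp
    ultimately show False
      using no_complementary_stability subspace_stability_strict[OF t g V dV] subspace_stability[OF t W] by blast
  qed
  then have "H *v x = z i0 *s x" for x by (auto simp: V_def)
  then have "H = mat (z i0)"
    by (intro matrix_eq[THEN iffD2] allI)
      (simp add: vec_eq_iff matrix_vector_mult_def mat_def if_distrib if_distribR cong: if_cong)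
  moreover have "z i0 = of_real (Re (z i0))"
    using zr[of i0] by (simp add: complex_eq_iff)
  ultimately show ?thesis by metis
qed

section \<open>Global and infinitesimal rigidity of tight frames\<close>

lemma trace_mult_adj: "trace (A ** adj A) = of_real ((norm A)\<^sup>2)" for A :: "complex^'d::finite^'d"
proof -
  have "(norm A)\<^sup>2 = (\<Sum>a\<in>UNIV. \<Sum>b\<in>UNIV. (cmod (A $ a $ b))\<^sup>2)"
    by (simp add: norm_vec_def L2_set_def sum_nonneg)
  then show ?thesis
    by (simp add: trace_def matrix_matrix_mult_def conj_transpose_def complex_norm_square del: of_real_power)
qed

lemma matrix_add_rdistrib_complex: "(A + B) ** C = A ** C + B ** (C :: complex^'d::finite^'d)"
  by (simp add: matrix_matrix_mult_def vec_eq_iff sum.distrib distrib_right)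

lemma matrix_sum_mult:
  fixes A :: "'i \<Rightarrow> complex^'d::finite^'d"
  shows "B ** (\<Sum>i\<in>I. A i) = (\<Sum>i\<in>I. B ** A i)" "(\<Sum>i\<in>I. A i) ** B = (\<Sum>i\<in>I. A i ** B)"
  by (induction I rule: infinite_finite_induct) (simp_all add: matrix_add_ldistrib matrix_add_rdistrib_complex)

lemma scaleR_matrix_mult:
  fixes A B :: "complex^'d::finite^'d"
  shows "(t *\<^sub>R A) ** B = t *\<^sub>R (A ** B)" "A ** (t *\<^sub>R B) = t *\<^sub>R (A ** B)"
  by (simp_all add: matrix_matrix_mult_def vec_eq_iff scaleR_right.sum)

lemma mat_of_real: "mat (of_real t) = t *\<^sub>R (mat 1 :: complex^'d::finite^'d)"
  by (simp add: mat_def vec_eq_iff scaleR_conv_of_real[where 'a = complex])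

lemma mat_mult_vec: "mat z *v x = z *s x" for x :: "complex^'d::finite"
  by (simp add: vec_eq_iff matrix_vector_mult_def mat_def if_distrib if_distribR cong: if_cong)

lemma sum_conjugate_tight_frame:
  assumes "tight_frame r (u :: (complex^'d::finite)^'n::finite)"
  shows "(\<Sum>i\<in>UNIV. line_projection (A *v u $ i)) = ((\<Sum>i\<in>UNIV. r $ i) / CARD('d)) *\<^sub>R (A ** adj A)"
proof -
  have "(\<Sum>i\<in>UNIV. line_projection (A *v u $ i)) = A ** (\<Sum>i\<in>UNIV. line_projection (u $ i)) ** adj A"
    by (simp add: matrix_sum_mult conjugate_line_projection)
  then show ?thesis using assms
    by (simp add: tight_frame_def mat_of_real[where 'd = 'd] scaleR_matrix_mult del: of_real_divide of_real_sum)
qed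

text \<open>The trace of the preceding identity. The norm of \<open>A\<close> is the
  Hilbert--Schmidt norm, so the sum does not change when \<open>A\<close> is replaced by its adjoint
  or when the frame is replaced by another one with the same \<open>r\<close>.\<close>

lemma sum_norm_tight_frame:
  fixes A :: "complex^'d::finite^'d"
  assumes "tight_frame r (u :: (complex^'d::finite)^'n::finite)"
  shows "(\<Sum>i\<in>UNIV. (norm (A *v u $ i))\<^sup>2) = (\<Sum>i\<in>UNIV. r $ i) / CARD('d) * (norm A)\<^sup>2"
proof -
  have "complex_of_real (\<Sum>i\<in>UNIV. (norm (A *v u $ i))\<^sup>2) = trace (\<Sum>i\<in>UNIV. line_projection (A *v u $ i))"
    by (simp add: trace_sum trace_line_projection)
  also have "\<dots> = of_real ((\<Sum>i\<in>UNIV. r $ i) / CARD('d) * (norm A)\<^sup>2)"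
    unfolding sum_conjugate_tight_frame[OF assms] trace_scaleR trace_mult_adj by (simp add: scaleR_conv_of_real[where 'a = complex])
  finally show ?thesis by (rule of_real_eq_iff[THEN iffD1])
qed

lemma norm_adj [simp]: "norm (adj A) = norm A" for A :: "complex^'d::finite^'d"
proof -
  have "complex_of_real ((norm (adj A))\<^sup>2) = of_real ((norm A)\<^sup>2)"
    unfolding trace_mult_adj[symmetric] using trace_mul_sym[of A "adj A"] by simp
  then have "(norm (adj A))\<^sup>2 = (norm A)\<^sup>2" by (rule of_real_eq_iff[THEN iffD1])
  then show ?thesis by simp
qed

text \<open>The squared distances of the \<open>y i\<close> from the lines of the \<open>x i\<close>
  add up to the difference of the two sides, so they all vanish.\<close>

lemma cauchy_schwarz_sum_equality:
  fixes x y :: "'n::finite \<Rightarrow> complex^'d::finite"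
  assumes nz: "\<And>i. x i \<noteq> 0"
    and le: "(\<Sum>i\<in>UNIV. (norm (y i))\<^sup>2) \<le> (\<Sum>i\<in>UNIV. (cmod (hinner (x i) (y i)))\<^sup>2 / (norm (x i))\<^sup>2)"
  shows "y i = (hinner (x i) (y i) / of_real ((norm (x i))\<^sup>2)) *s x i"
proof -
  let ?s = "\<lambda>i. (norm (y i - (hinner (x i) (y i) / of_real ((norm (x i))\<^sup>2)) *s x i))\<^sup>2"
  have "(\<Sum>i\<in>UNIV. ?s i) = (\<Sum>i\<in>UNIV. (norm (y i))\<^sup>2) -
      (\<Sum>i\<in>UNIV. (cmod (hinner (x i) (y i)))\<^sup>2 / (norm (x i))\<^sup>2)"
    unfolding norm_minus_hinner_projection[OF nz] by (rule sum_subtractf)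
  then have "(\<Sum>i\<in>UNIV. ?s i) = 0" using le by (intro antisym sum_nonneg) auto
  then have "?s i = 0" by (subst (asm) sum_nonneg_eq_0_iff) auto
  then show ?thesis by simp
qed

lemma tight_frame_nz: "tight_frame r u \<Longrightarrow> u $ i \<noteq> 0"
  unfolding tight_frame_def by (metis norm_zero less_irrefl power_zero_numeral)

text \<open>Let \<open>q\<close> be the inverse of \<open>h\<close>. The vectors
  \<open>h *v u $ i\<close> and \<open>adj q *v u $ i\<close> have inner product
  \<open>r $ i\<close>. The squared norms of the latter have the same sum as those of
  \<open>q *v v $ i\<close>, by tightness of both frames, and that sum is exactly the lower bound of
  Cauchy--Schwarz. So the two vectors are parallel, and each \<open>u $ i\<close> is an eigenvector
  of \<open>adj h ** h\<close>.\<close>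

lemma tight_frame_unique_up_to_unitary:
  fixes u v :: "(complex^'d::finite)^'n::finite"
  assumes u: "tight_frame r u" and v: "tight_frame r v" and g: "generic TYPE('d) r"
    and rel: "\<And>i. v $ i = \<tau> i *s (h *v u $ i)"
  shows "\<exists>l>0. adj h ** h = mat (of_real l)"
proof -
  let ?c = "(\<Sum>i\<in>UNIV. r $ i) / CARD('d)"
  have c: "?c > 0" using tight_frame_sum_pos[OF u] by simp
  \<comment> \<open>Invertibility of \<open>h\<close> is derived: its range contains the vectors of
    \<open>v\<close>, which span.\<close>
  have "\<exists>y. h *v y = x" for x
  proof -
    have "?c *\<^sub>R x = (\<Sum>i\<in>UNIV. hinner (v $ i) x *s (\<tau> i *s (h *v u $ i)))"
      using tight_frame_hinner(1)[OF v, of x] rel by simp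
    also have "\<dots> = h *v (\<Sum>i\<in>UNIV. hinner (v $ i) x *s (\<tau> i *s u $ i))"
      by (simp add: linear_sum[OF linear_matrix_vector_mult_complex] matrix_vector_mult_complex_simps)
    finally have "h *v (inverse ?c *\<^sub>R (\<Sum>i\<in>UNIV. hinner (v $ i) x *s (\<tau> i *s u $ i))) = x"
      using c unfolding matrix_vector_mult_complex_simps
      by (metis less_irrefl scaleR_scaleR left_inverse scaleR_one)
    then show ?thesis by blast
  qed
  then have "surj ((*v) h)" by (metis surjI)
  then obtain q where hq: "h ** q = mat 1" using matrix_right_invertible_surjective by blast
  then have qh: "q ** h = mat 1" using matrix_left_right_inverse by blast
  have qv: "q *v v $ i = \<tau> i *s u $ i" for i
    by (simp add: rel matrix_vector_mult_complex_simps matrix_vector_mul_assoc qh)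
  have ad: "adj h ** adj q = mat 1" using arg_cong[OF qh, of adj] by (simp add: adj_mult)
  define x where "x i = h *v u $ i" for i
  define y where "y i = adj q *v u $ i" for i
  have xy: "hinner (x i) (y i) = of_real (r $ i)" for i
    using u by (simp add: x_def y_def hinner_adj matrix_vector_mul_assoc qh hinner_self tight_frame_def)
  have rp: "r $ i > 0" for i using u by (simp add: tight_frame_def)
  have xnz: "x i \<noteq> 0" for i using xy[of i] rp[of i] by auto
  have nv: "(cmod (\<tau> i))\<^sup>2 * (norm (x i))\<^sup>2 = r $ i" for i
  proof -
    have "(norm (v $ i))\<^sup>2 = r $ i" using v by (simp add: tight_frame_def)
    moreover have "norm (v $ i) = cmod (\<tau> i) * norm (x i)"
      by (simp add: rel x_def norm_vec_def norm_mult L2_set_left_distrib L2_set_right_distrib)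
    ultimately show ?thesis by (simp add: power_mult_distrib)
  qed
  have "(\<Sum>i\<in>UNIV. (norm (y i))\<^sup>2) = ?c * (norm q)\<^sup>2"
    unfolding y_def sum_norm_tight_frame[OF u] by simp
  also have "\<dots> = (\<Sum>i\<in>UNIV. (norm (q *v v $ i))\<^sup>2)"
    by (rule sum_norm_tight_frame[OF v, symmetric])
  also have "\<dots> = (\<Sum>i\<in>UNIV. (cmod (hinner (x i) (y i)))\<^sup>2 / (norm (x i))\<^sup>2)"
  proof (rule sum.cong[OF refl])
    fix i
    have "norm (q *v v $ i) = cmod (\<tau> i) * norm (u $ i)"
      by (simp add: qv norm_vec_def norm_mult L2_set_left_distrib L2_set_right_distrib)
    then have "(norm (q *v v $ i))\<^sup>2 = (cmod (\<tau> i))\<^sup>2 * r $ i"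
      using u by (simp add: power_mult_distrib tight_frame_def)
    then show "(norm (q *v v $ i))\<^sup>2 = (cmod (hinner (x i) (y i)))\<^sup>2 / (norm (x i))\<^sup>2"
      using nv[of i] rp[of i] xnz[of i] by (simp add: xy field_simps power2_eq_square)
  qed
  finally have "(\<Sum>i\<in>UNIV. (norm (y i))\<^sup>2) \<le> (\<Sum>i\<in>UNIV. (cmod (hinner (x i) (y i)))\<^sup>2 / (norm (x i))\<^sup>2)"
    by simp
  from cauchy_schwarz_sum_equality[of x y, OF xnz this]
  have y: "y i = of_real (r $ i / (norm (x i))\<^sup>2) *s x i" for i by (simp add: xy)
  let ?H = "adj h ** h"
  have "\<exists>z. ?H *v u $ i = z *s u $ i" for i
  proof -
    have "u $ i = adj h *v y i" by (simp add: y_def matrix_vector_mul_assoc ad)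
    also have "\<dots> = of_real (r $ i / (norm (x i))\<^sup>2) *s (?H *v u $ i)"
      unfolding y by (simp add: x_def matrix_vector_mult_complex_simps matrix_vector_mul_assoc)
    finally have e: "u $ i = of_real (r $ i / (norm (x i))\<^sup>2) *s (?H *v u $ i)" .
    have "of_real ((norm (x i))\<^sup>2 / r $ i) *s (u $ i) =
        of_real ((norm (x i))\<^sup>2 / r $ i) *s (of_real (r $ i / (norm (x i))\<^sup>2) *s (?H *v u $ i))"
      by (subst e) (rule refl)
    also have "\<dots> = ?H *v u $ i"
    proof -
      have "complex_of_real ((norm (x i))\<^sup>2 / r $ i) * of_real (r $ i / (norm (x i))\<^sup>2) = 1"
        unfolding of_real_mult[symmetric] using rp[of i] xnz[of i] by simp
      then show ?thesis by (simp only: vector_smult_assoc vector_smult_lid)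
    qed
    finally show ?thesis by metis
  qed
  from eigenvectors_imp_scalar[OF u g _ this] obtain l :: real where l: "?H = mat (of_real l)"
    by (auto simp: adj_mult)
  have "of_real ((norm (x i))\<^sup>2) = hinner (u $ i) (?H *v u $ i)" for i
    by (simp add: x_def hinner_self[symmetric] hinner_adj[of "u $ i" "adj h"] matrix_vector_mul_assoc[symmetric]
        del: of_real_power)
  then have "of_real ((norm (x i))\<^sup>2) = complex_of_real (l * r $ i)" for i
    using u by (simp add: l mat_mult_vec hinner_self tight_frame_def del: of_real_power)
  then have "(norm (x i))\<^sup>2 = l * r $ i" for i by (metis of_real_eq_iff)
  moreover have "(norm (x undefined))\<^sup>2 > 0" using xnz by simp
  ultimately have "l * r $ undefined > 0" by metis
  then have "l > 0" using rp[of undefined] by (simp add: zero_less_mult_iff)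
  with l show ?thesis by blast
qed

text \<open>The equation \<open>eq\<close> is the vanishing of the first variation of the balancing
  condition at the identity in the direction \<open>S\<close>. Multiplied by \<open>S\<close> and
  traced, it becomes the equality case of Cauchy--Schwarz for \<open>u $ i\<close> and
  \<open>S *v u $ i\<close>.\<close>

lemma tight_frame_infinitesimally_rigid:
  fixes u :: "(complex^'d::finite)^'n::finite"
  assumes u: "tight_frame r u" and g: "generic TYPE('d) r" and S: "adj S = S"
    and eq: "((\<Sum>i\<in>UNIV. r $ i) / CARD('d)) *\<^sub>R S =
       (\<Sum>i\<in>UNIV. (Re (hinner (u $ i) (S *v u $ i)) / r $ i) *\<^sub>R line_projection (u $ i))"
  shows "\<exists>l::real. S = mat (of_real l)"
proof -
  let ?c = "(\<Sum>i\<in>UNIV. r $ i) / CARD('d)"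
  have real: "hinner (u $ i) (S *v u $ i) = of_real (Re (hinner (u $ i) (S *v u $ i)))" for i
    using hinner_adj[of "u $ i" S "u $ i"] S cnj_hinner[of "u $ i" "S *v u $ i"]
    by (metis Reals_cnj_iff of_real_Re)
  have "complex_of_real (?c * (norm S)\<^sup>2) = trace (S ** (?c *\<^sub>R S))"
    using trace_mult_adj[of S] S by (simp add: scaleR_matrix_mult trace_scaleR scaleR_conv_of_real[where 'a = complex])
  also have "\<dots> = (\<Sum>i\<in>UNIV. (Re (hinner (u $ i) (S *v u $ i)) / r $ i) *\<^sub>R hinner (u $ i) (S *v u $ i))"
    unfolding eq by (simp add: matrix_sum_mult trace_sum scaleR_matrix_mult trace_scaleR trace_mult_line_projection)
  also have "\<dots> = (\<Sum>i\<in>UNIV. of_real ((cmod (hinner (u $ i) (S *v u $ i)))\<^sup>2 / (norm (u $ i))\<^sup>2))"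
  proof (rule sum.cong[OF refl])
    fix i
    have "(norm (u $ i))\<^sup>2 = r $ i" using u by (simp add: tight_frame_def)
    then show "(Re (hinner (u $ i) (S *v u $ i)) / r $ i) *\<^sub>R hinner (u $ i) (S *v u $ i) =
        of_real ((cmod (hinner (u $ i) (S *v u $ i)))\<^sup>2 / (norm (u $ i))\<^sup>2)"
      by (subst (2 3) real) (simp add: scaleR_conv_of_real power2_eq_square)
  qed
  finally have "?c * (norm S)\<^sup>2 = (\<Sum>i\<in>UNIV. (cmod (hinner (u $ i) (S *v u $ i)))\<^sup>2 / (norm (u $ i))\<^sup>2)"
    unfolding of_real_sum[symmetric] of_real_eq_iff .
  then have le: "(\<Sum>i\<in>UNIV. (norm (S *v u $ i))\<^sup>2) \<le>
      (\<Sum>i\<in>UNIV. (cmod (hinner (u $ i) (S *v u $ i)))\<^sup>2 / (norm (u $ i))\<^sup>2)"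
    unfolding sum_norm_tight_frame[OF u] by simp
  have "\<exists>z. S *v u $ i = z *s u $ i" for i
    using cauchy_schwarz_sum_equality[of "\<lambda>i. u $ i" "\<lambda>i. S *v u $ i", OF tight_frame_nz[OF u] le] by blast
  then show ?thesis by (rule eigenvectors_imp_scalar[OF u g S])
qed

subsection \<open>Polar decomposition\<close>

definition posdef :: "complex^'d::finite^'d \<Rightarrow> bool" where
  "posdef g \<longleftrightarrow> adj g = g \<and> (\<forall>x. x \<noteq> 0 \<longrightarrow> Re (hinner x (g *v x)) > 0)"

lemma unitary_group_iff:
  fixes u :: "complex^'d::finite^'d"
  shows "u \<in> unitary_group \<longleftrightarrow> adj u ** u = mat 1" "u \<in> unitary_group \<longleftrightarrow> u ** adj u = mat 1"
  using matrix_left_right_inverse by (auto simp: unitary_group_def)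

lemma unitary_mult: "u \<in> unitary_group \<Longrightarrow> v \<in> unitary_group \<Longrightarrow> u ** v \<in> unitary_group"
  unfolding unitary_group_iff(1) adj_mult
  by (metis matrix_mul_assoc matrix_mul_lid)

lemma unitary_adj: "u \<in> unitary_group \<Longrightarrow> adj u \<in> unitary_group"
  by (simp add: unitary_group_def)

lemma unitary_one: "mat 1 \<in> unitary_group"
  by (simp add: unitary_group_iff(1))

lemma continuous_on_adj: "continuous_on S f \<Longrightarrow> continuous_on S (\<lambda>x. adj (f x :: complex^'d::finite^'d))"
  unfolding conj_transpose_def by (intro continuous_intros)

lemma continuous_on_matrix_mult:
  fixes f g :: "_ \<Rightarrow> complex^'d::finite^'d"
  shows "continuous_on S f \<Longrightarrow> continuous_on S g \<Longrightarrow> continuous_on S (\<lambda>x. f x ** g x)"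
  unfolding matrix_matrix_mult_def by (intro continuous_intros)

lemma continuous_on_trace:
  fixes f :: "_ \<Rightarrow> complex^'d::finite^'d"
  shows "continuous_on S f \<Longrightarrow> continuous_on S (\<lambda>x. trace (f x))"
  unfolding trace_def by (intro continuous_intros)

lemma continuous_on_line_projection:
  fixes f :: "_ \<Rightarrow> complex^'d::finite"
  shows "continuous_on S f \<Longrightarrow> continuous_on S (\<lambda>x. line_projection (f x))"
  unfolding line_projection_def by (intro continuous_intros)

lemma compact_unitary_group: "compact (unitary_group :: (complex^'d::finite^'d) set)"
proof (rule compact_eq_bounded_closed[THEN iffD2], intro conjI)
  have "(norm u)\<^sup>2 = CARD('d)" if "u \<in> unitary_group" for u :: "complex^'d^'d"
  proof -
    have "complex_of_real ((norm u)\<^sup>2) = of_real (real CARD('d))"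
      unfolding trace_mult_adj[symmetric] using that by (simp add: unitary_group_def trace_mat)
    then show ?thesis by (rule of_real_eq_iff[THEN iffD1])
  qed
  then have "norm u \<le> sqrt CARD('d)" if "u \<in> unitary_group" for u :: "complex^'d^'d"
    using that by (metis norm_ge_zero order_refl real_sqrt_unique)
  then show "bounded (unitary_group :: (complex^'d^'d) set)" by (auto simp: bounded_iff)
  have "closed {u :: complex^'d^'d. adj u ** u = mat 1}"
    by (intro closed_Collect_eq continuous_on_matrix_mult continuous_on_adj continuous_intros)
  moreover have "unitary_group = {u :: complex^'d^'d. adj u ** u = mat 1}"
    by (auto simp: unitary_group_iff(1))
  ultimately show "closed (unitary_group :: (complex^'d^'d) set)" by simp
qed

text \<open>Polarisation with \<open>x + y\<close> and \<open>x + \<i> *s y\<close>.\<close>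

lemma hinner_quadratic_zero:
  fixes A :: "complex^'d::finite^'d"
  assumes "\<And>x. hinner x (A *v x) = 0" shows "A = 0"
proof -
  have "hinner x (A *v y) = 0" for x y
  proof -
    have 1: "hinner x (A *v y) + hinner y (A *v x) = 0"
      using assms[of "x + y"] by (simp add: matrix_vector_right_distrib hinner_add assms add.commute)
    have "\<i> * hinner x (A *v y) - \<i> * hinner y (A *v x) = 0"
      using assms[of "x + \<i> *s y"]
      by (simp add: matrix_vector_right_distrib hinner_add assms matrix_vector_mult_complex_simps)
    then have "hinner x (A *v y) = hinner y (A *v x)" by simp
    with 1 show ?thesis by simp
  qed
  then have "A *v y = 0" for y using hinner_self[of "A *v y"] by simp
  then show ?thesis by (intro matrix_eq[THEN iffD2]) simp
qed

text \<open>The form along the line from \<open>x\<close> in the direction of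
  \<open>- (A *v x)\<close> is a nonnegative quadratic function of \<open>t\<close> without constant
  term, so its linear coefficient must vanish.\<close>

lemma semidefinite_kernel:
  fixes A :: "complex^'d::finite^'d"
  assumes A: "adj A = A" and psd: "\<And>x. Re (hinner x (A *v x)) \<ge> 0"
    and x: "Re (hinner x (A *v x)) = 0"
  shows "A *v x = 0"
proof (rule ccontr)
  let ?y = "A *v x"
  assume "?y \<noteq> 0"
  define K where "K = Re (hinner ?y (A *v ?y))"
  define N where "N = (norm ?y)\<^sup>2"
  have N: "N > 0" "K \<ge> 0" using \<open>?y \<noteq> 0\<close> psd by (simp_all add: N_def K_def)
  have quad: "0 \<le> t * t * K - 2 * t * N" for t
  proof -
    have "hinner x (A *v ?y) = hinner ?y ?y" by (simp add: hinner_adj[of x A] A)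
    then have "Re (hinner (x - t *\<^sub>R ?y) (A *v (x - t *\<^sub>R ?y))) = t * t * K - 2 * t * N"
      using x by (simp add: matrix_vector_mult_diff_distrib matrix_vector_mult_complex_simps hinner_add
          hinner_self K_def N_def algebra_simps)
    then show ?thesis using psd[of "x - t *\<^sub>R ?y"] by simp
  qed
  \<comment> \<open>Small enough for the linear term to dominate; the summand 1 avoids a division by
    zero.\<close>
  define t where "t = N / (K + 1)"
  have t: "t > 0" "t * (K + 1) = N" using N by (simp_all add: t_def)
  have "t * (t * K - 2 * N) \<ge> 0" using quad[of t] by (simp add: algebra_simps)
  then have "t * K \<ge> 2 * N" using t(1) by (simp add: zero_le_mult_iff)
  moreover have "t * K < N" using t by (simp add: algebra_simps)
  ultimately show False using N by simp
qed

text \<open>The unitary factor maximises \<open>Re (tr (u h))\<close>; rotations of a single line serve as test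
  directions.\<close>

lemma polar_decomposition:
  fixes h :: "complex^'d::finite^'d"
  assumes "invertible h"
  obtains u where "u \<in> unitary_group" "posdef (u ** h)"
proof -
  have "continuous_on unitary_group (\<lambda>u :: complex^'d^'d. Re (trace (u ** h)))"
    by (intro continuous_intros continuous_on_trace continuous_on_matrix_mult)
  from continuous_attains_sup[OF compact_unitary_group _ this] obtain u
    where u: "u \<in> unitary_group"
      and max: "\<And>v. v \<in> unitary_group \<Longrightarrow> Re (trace (v ** h)) \<le> Re (trace (u ** h))"
    using unitary_one by blast
  define A where "A = u ** h"
  have unit: "hinner x (A *v x) = of_real (cmod (hinner x (A *v x)))" if x: "norm x = 1" for x
  proof -
    define w where "w = hinner x (A *v x)"
    \<comment> \<open>The phase that turns \<open>w\<close> into its absolute value.\<close>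
    define \<zeta> where "\<zeta> = (if w = 0 then 1 else cnj w / of_real (cmod w))"
    have \<zeta>: "\<zeta> * cnj \<zeta> = 1" "\<zeta> * w = of_real (cmod w)"
      using complex_norm_square[of w]
      by (auto simp: \<zeta>_def field_simps power2_eq_square)
    \<comment> \<open>The rotation of the line of \<open>x\<close> by \<open>\<zeta>\<close>, with
      the orthogonal complement fixed. It changes the trace of \<open>A\<close> by
      \<open>(\<zeta> - 1) * w\<close>.\<close>
    define v where "v = mat 1 + mat (\<zeta> - 1) ** line_projection x"
    have vy: "v *v y = y + ((\<zeta> - 1) * hinner x y) *s x" for y
      by (simp add: v_def matrix_vector_mult_add_rdistrib matrix_vector_mul_assoc[symmetric]
          line_projection_mult mat_mult_vec)
    have "adj v *v y = y + (cnj (\<zeta> - 1) * hinner x y) *s x" for y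
      by (simp add: v_def matrix_vector_mult_add_rdistrib matrix_vector_mul_assoc[symmetric]
          adj_mult line_projection_mult mat_mult_vec matrix_vector_mult_complex_simps del: complex_cnj_diff)
    then have av: "adj v *v y = y + ((cnj \<zeta> - 1) * hinner x y) *s x" for y by simp
    have xx: "hinner x x = 1" using x by (simp add: hinner_self)
    have c0: "(\<zeta> - 1) * c + (cnj \<zeta> - 1) * (c + (\<zeta> - 1) * c) = 0" for c
    proof -
      have "(\<zeta> - 1) * c + (cnj \<zeta> - 1) * (c + (\<zeta> - 1) * c) = (\<zeta> * cnj \<zeta> - 1) * c"
        by (simp add: algebra_simps)
      then show ?thesis by (simp add: \<zeta>)
    qed
    have "adj v *v (v *v y) = y" for y
    proof -
      have "adj v *v (v *v y) = y + ((\<zeta> - 1) * hinner x y + (cnj \<zeta> - 1) * (hinner x y + (\<zeta> - 1) * hinner x y)) *s x"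
        unfolding av vy by (simp add: hinner_add xx vector_sadd_rdistrib)
      then show ?thesis unfolding c0 by simp
    qed
    then have "adj v ** v = mat 1"
      by (intro matrix_eq[THEN iffD2]) (simp add: matrix_vector_mul_assoc[symmetric])
    then have "v ** u \<in> unitary_group" using u by (intro unitary_mult) (auto simp: unitary_group_iff(1))
    from max[OF this] have "Re (trace (v ** A)) \<le> Re (trace A)" by (simp add: A_def matrix_mul_assoc)
    moreover have "trace (v ** A) = trace A + (\<zeta> - 1) * w"
    proof -
      have "trace (v ** A) = trace (A ** v)" by (rule trace_mul_sym)
      also have "A ** v = A + (A ** mat (\<zeta> - 1)) ** line_projection x"
        by (simp add: v_def matrix_add_ldistrib matrix_mul_assoc)
      also have "trace \<dots> = trace A + (\<zeta> - 1) * w"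
        by (simp add: trace_add trace_mult_line_projection matrix_vector_mul_assoc[symmetric]
            mat_mult_vec matrix_vector_mult_complex_simps matrix_vector_mult_diff_distrib hinner_add
            left_diff_distrib w_def)
      finally show ?thesis .
    qed
    ultimately have "Re ((\<zeta> - 1) * w) \<le> 0" by simp
    then have "cmod w \<le> Re w" using \<zeta>(2) by (simp add: left_diff_distrib)
    then have "Re w = cmod w" using complex_Re_le_cmod[of w] by simp
    moreover from this have "Im w = 0" using cmod_power2[of w] by simp
    ultimately show ?thesis by (simp add: w_def complex_eq_iff)
  qed
  have real: "hinner x (A *v x) = of_real (cmod (hinner x (A *v x)))" for x
  proof (cases "x = 0")
    case False
    define y where "y = inverse (norm x) *\<^sub>R x"
    have x: "x = norm x *\<^sub>R y" "norm y = 1" using False by (simp_all add: y_def)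
    have "hinner x (A *v x) = of_real ((norm x)\<^sup>2) * hinner y (A *v y)"
      by (subst (1 2) x(1)) (simp add: matrix_vector_mult_complex_simps scaleR_conv_of_real[where 'a = complex] power2_eq_square)
    also have "\<dots> = of_real ((norm x)\<^sup>2 * cmod (hinner y (A *v y)))"
      by (subst unit[OF x(2)]) simp
    finally have e: "hinner x (A *v x) = of_real ((norm x)\<^sup>2 * cmod (hinner y (A *v y)))" .
    show ?thesis unfolding e norm_of_real by simp
  qed simp
  have "A - adj A = 0"
  proof (rule hinner_quadratic_zero)
    fix x
    have "hinner x (adj A *v x) = cnj (hinner x (A *v x))" by (simp add: hinner_adj[of x "adj A"])
    also have "\<dots> = hinner x (A *v x)" by (subst (1 2) real) simp
    finally show "hinner x ((A - adj A) *v x) = 0"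
      by (simp add: matrix_vector_mult_diff_rdistrib hinner_add)
  qed
  then have A: "adj A = A" by simp
  have "Re (hinner x (A *v x)) > 0" if "x \<noteq> 0" for x
  proof (rule ccontr)
    assume neg: "\<not> ?thesis"
    have psd: "Re (hinner x (A *v x)) \<ge> 0" for x by (subst real) simp
    have "Re (hinner x (A *v x)) = 0" using neg psd[of x] by linarith
    from semidefinite_kernel[OF A psd this] have "u *v (h *v x) = 0"
      by (simp add: A_def matrix_vector_mul_assoc)
    then have "adj u *v (u *v (h *v x)) = 0" by simp
    then have "h *v x = 0" using u by (simp add: matrix_vector_mul_assoc matrix_mul_assoc unitary_group_def)
    moreover obtain q where "q ** h = mat 1" using assms by (auto simp: invertible_def)
    ultimately show False using that
      by (metis matrix_vector_mul_assoc matrix_vector_mul_lid matrix_vector_mult_0_right)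
  qed
  then have "posdef A" using A by (simp add: posdef_def)
  with u that show thesis by (simp add: A_def)
qed

lemma posdef_invertible: "posdef g \<Longrightarrow> invertible g"
proof -
  assume g: "posdef g"
  have "x = 0" if "g *v x = 0" for x
    using g that unfolding posdef_def by (metis hinner_simps(1) less_irrefl zero_complex.sel(1))
  then show ?thesis
    using matrix_left_invertible_ker[of g] invertible_left_inverse[of g] by blast
qed

lemma posdef_scaleR: "posdef g \<Longrightarrow> t > 0 \<Longrightarrow> posdef (t *\<^sub>R g)"
  by (simp add: posdef_def matrix_vector_mult_complex_simps)

lemma posdef_inverse:
  assumes g: "posdef g" and q: "g ** q = mat 1" shows "posdef q"
proof -
  have qg: "q ** g = mat 1" using q matrix_left_right_inverse by blast
  have "adj q ** g = mat 1" using g arg_cong[OF q, of adj] by (simp add: adj_mult posdef_def)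
  then have a: "adj q = q" by (metis matrix_mul_assoc matrix_mul_lid matrix_mul_rid q)
  have "Re (hinner x (q *v x)) > 0" if "x \<noteq> 0" for x
  proof -
    have x: "g *v (q *v x) = x" by (simp add: matrix_vector_mul_assoc q)
    then have "q *v x \<noteq> 0" using that by auto
    then have "Re (hinner (q *v x) (g *v (q *v x))) > 0" using g by (simp add: posdef_def)
    then show ?thesis using x by (simp add: hinner_adj[of x q] a)
  qed
  then show ?thesis using a by (simp add: posdef_def)
qed

lemma posdef_trace_pos:
  fixes g :: "complex^'d::finite^'d"
  assumes g: "posdef g" shows "Re (trace g) > 0"
proof -
  have "trace g = (\<Sum>a\<in>UNIV. hinner (axis a 1) (g *v axis a 1))"
    by (simp add: trace_def hinner_def matrix_vector_mult_def axis_def if_distrib if_distribR cong: if_cong)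
  moreover have "Re (hinner (axis a 1) (g *v axis a 1)) > 0" for a
    using g by (simp add: posdef_def axis_eq_0_iff)
  ultimately show ?thesis by (simp add: sum_pos)
qed

text \<open>Multiplying by \<open>Z\<close> and taking traces writes zero as a sum of values of the
  positive forms \<open>g\<close> and \<open>k\<close> on the columns of \<open>Z\<close>. This
  serves in place of diagonalisation, for square roots and for the linearised balancing
  problem.\<close>

lemma posdef_sylvester:
  fixes Z :: "complex^'d::finite^'d"
  assumes g: "posdef g" and k: "posdef k" and Z: "adj Z = Z" and comm: "g ** Z + Z ** k = 0"
  shows "Z = 0"
proof -
  have "trace (g ** (Z ** adj Z)) + trace (k ** (Z ** adj Z)) = 0"
  proof -
    have "trace (k ** (Z ** Z)) = trace ((Z ** k) ** Z)"
      using trace_mul_sym[of "k ** Z" Z] by (simp add: matrix_mul_assoc)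
    then have "trace (g ** (Z ** Z)) + trace (k ** (Z ** Z)) = trace ((g ** Z + Z ** k) ** Z)"
      by (simp add: matrix_add_rdistrib_complex trace_add matrix_mul_assoc)
    then show ?thesis unfolding comm Z by (simp add: trace_def)
  qed
  moreover have "trace (A ** (Z ** adj Z)) = (\<Sum>a\<in>UNIV. hinner (column a Z) (A *v column a Z))" for A
  proof -
    have "trace (A ** (Z ** adj Z)) = trace (adj Z ** (A ** Z))"
      using trace_mul_sym[of "A ** Z" "adj Z"] by (simp add: matrix_mul_assoc)
    also have "\<dots> = (\<Sum>a\<in>UNIV. hinner (column a Z) (A *v column a Z))"
      by (simp add: trace_def matrix_matrix_mult_def conj_transpose_def
          hinner_def matrix_vector_mult_def column_def)
    finally show ?thesis .
  qed
  ultimately have "(\<Sum>a\<in>UNIV. Re (hinner (column a Z) (g *v column a Z)) + Re (hinner (column a Z) (k *v column a Z))) = 0"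
    by (simp add: sum.distrib complex_eq_iff)
  moreover have nn: "Re (hinner x (g *v x)) \<ge> 0" "Re (hinner x (k *v x)) \<ge> 0" for x
    using g k unfolding posdef_def by (metis hinner_simps(2) less_eq_real_def zero_complex.sel(1))+
  ultimately have "Re (hinner (column a Z) (g *v column a Z)) + Re (hinner (column a Z) (k *v column a Z)) = 0" for a
    by (subst (asm) sum_nonneg_eq_0_iff) (auto intro: add_nonneg_nonneg)
  then have "column a Z = 0" for a
    using nn g unfolding posdef_def by (smt (verit))
  then show ?thesis by (simp add: vec_eq_iff column_def)
qed

text \<open>The difference \<open>Z = g - k\<close> satisfies \<open>g ** Z + Z ** k = 0\<close>
  although \<open>g\<close> and \<open>k\<close> need not commute.\<close>

lemma posdef_square_inj:
  fixes g k :: "complex^'d::finite^'d"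
  assumes g: "posdef g" and k: "posdef k" and eq: "g ** g = k ** k"
  shows "g = k"
proof -
  have "g ** (g - k) + (g - k) ** k = g ** g - k ** k"
    by (simp add: matrix_matrix_mult_def vec_eq_iff sum_subtractf algebra_simps)
  with eq have "g ** (g - k) + (g - k) ** k = 0" by simp
  moreover have "adj (g - k) = g - k" using g k by (simp add: posdef_def)
  ultimately have "g - k = 0" using posdef_sylvester[OF g k] by blast
  then show ?thesis by simp
qed

subsection \<open>Chambers\<close>

lemma side_length_cone_iff:
  "r \<in> side_length_cone TYPE('d::finite) \<longleftrightarrow>
     (\<forall>i. r $ i > 0) \<and> (closed_polygons r :: ('d, 'n::finite) polygon set) \<noteq> {}"
  unfolding side_length_cone_def topspace_moduli_space by simp

lemma chamber_facts:
  assumes \<Delta>: "\<Delta> \<in> chambers TYPE('d::finite)" and r: "r \<in> \<Delta>"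
  shows "generic TYPE('d) (r :: real^'n::finite)" "\<And>i. r $ i > 0"
    "(closed_polygons r :: ('d, 'n) polygon set) \<noteq> {}"
proof -
  have rC: "r \<in> side_length_cone TYPE('d) - \<Union> (walls TYPE('d))"
    using \<Delta> r in_components_subset unfolding chambers_def by blast
  then show "\<And>i. r $ i > 0" "(closed_polygons r :: ('d, 'n) polygon set) \<noteq> {}"
    by (auto simp: side_length_cone_iff)
  show "generic TYPE('d) r"
    unfolding generic_def
  proof (intro allI impI notI)
    fix I k
    assume I: "I \<noteq> {}" "I \<noteq> UNIV" "1 \<le> k" "k < CARD('d)"
      and eq: "CARD('d) * (\<Sum>i\<in>I. r $ i) = real k * (\<Sum>i\<in>UNIV. r $ i)"
    have "(\<Sum>i\<in>UNIV. r $ i) = (\<Sum>i\<in>I. r $ i) + (\<Sum>i\<in>-I. r $ i)"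
      by (subst sum.union_disjoint[symmetric]) auto
    then have "real (CARD('d) - k) * (\<Sum>i\<in>I. r $ i) = (real CARD('d) - real (CARD('d) - k)) * (\<Sum>i\<in>-I. r $ i)"
      using eq I by (simp add: of_nat_diff algebra_simps)
    then have "r \<in> wall TYPE('d) I (-I) (CARD('d) - k)" using rC by (simp add: wall_def)
    moreover have "wall TYPE('d) I (-I) (CARD('d) - k) \<in> walls TYPE('d)"
      unfolding walls_def
      by (rule CollectI, rule exI[of _ I], rule exI[of _ "- I"], rule exI[of _ "CARD('d) - k"]) (use I in auto)
    ultimately show False using rC by blast
  qed
qed

subsection \<open>Balancing a configuration of lines\<close>

text \<open>The linear map \<open>h\<close> moves the lines, and the quotient resets the lengths to
  \<open>r\<close>. Dividing by the trace makes the result insensitive to the lengths in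
  \<open>P\<close> and to nonzero real multiples of \<open>h\<close>.\<close>

definition act :: "real^'n \<Rightarrow> complex^'d::finite^'d \<Rightarrow> ('d, 'n::finite) polygon \<Rightarrow> ('d, 'n) polygon" where
  "act r h P = (\<chi> i. (r $ i / Re (trace (h ** P $ i ** adj h))) *\<^sub>R (h ** P $ i ** adj h))"

definition config :: "('d::finite, 'n::finite) polygon \<Rightarrow> bool" where
  "config P \<longleftrightarrow> (\<exists>w. (\<forall>i. w $ i \<noteq> 0) \<and> P = polygon_of w)"

definition balancing :: "real^'n \<Rightarrow> ('d::finite, 'n::finite) polygon \<Rightarrow> complex^'d^'d \<Rightarrow> bool" where
  "balancing r P h \<longleftrightarrow> invertible h \<and> act r h P \<in> closed_polygons r"

lemma config_closed_polygons: "e \<in> closed_polygons r \<Longrightarrow> config e"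
  unfolding closed_polygons_iff config_def using tight_frame_nz by blast

lemma closed_polygons_pos: "e \<in> closed_polygons r \<Longrightarrow> r $ i > 0"
  unfolding closed_polygons_iff by (auto simp: tight_frame_def)

lemma trace_closed_polygons: "e \<in> closed_polygons r \<Longrightarrow> trace (e $ i) = of_real (r $ i)"
  unfolding closed_polygons_iff by (auto simp: polygon_of_def trace_line_projection tight_frame_def simp del: of_real_power)

lemma invertible_mult_nz:
  fixes h :: "complex^'d::finite^'d"
  assumes "invertible h" "x \<noteq> 0" shows "h *v x \<noteq> 0"
proof
  assume "h *v x = 0"
  moreover obtain q where "q ** h = mat 1" using assms by (auto simp: invertible_def)
  ultimately show False using assms(2)
    by (metis matrix_vector_mul_assoc matrix_vector_mul_lid matrix_vector_mult_0_right)
qed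

lemma Re_trace_act_pos:
  assumes "config P" "invertible h" shows "Re (trace (h ** P $ i ** adj h)) > 0"
  using assms invertible_mult_nz[OF assms(2)]
  by (auto simp: config_def polygon_of_def conjugate_line_projection trace_line_projection simp del: of_real_power)

lemma act_polygon_of:
  assumes r: "\<And>i. r $ i > 0" and nz: "\<And>i. h *v w $ i \<noteq> 0"
  shows "act r h (polygon_of w) = polygon_of (\<chi> i. (sqrt (r $ i) / norm (h *v w $ i)) *\<^sub>R (h *v w $ i))"
proof -
  have "(sqrt (r $ i) / norm (h *v w $ i))\<^sup>2 = r $ i / (norm (h *v w $ i))\<^sup>2" for i
    using r[of i] by (simp add: power_divide)
  then show ?thesis
    by (simp add: act_def polygon_of_def conjugate_line_projection trace_line_projection
        line_projection_scaleR vec_eq_iff del: of_real_power)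
qed

lemma act_in_closed_polygons_iff:
  fixes P :: "('d::finite, 'n::finite) polygon"
  assumes P: "P = polygon_of w" and r: "\<And>i. r $ i > 0" and nz: "\<And>i. h *v w $ i \<noteq> 0"
  shows "act r h P \<in> closed_polygons r \<longleftrightarrow>
     (\<Sum>i\<in>UNIV. act r h P $ i) = mat (of_real ((\<Sum>i\<in>UNIV. r $ i) / CARD('d)))"
proof -
  let ?u = "\<chi> i. (sqrt (r $ i) / norm (h *v w $ i)) *\<^sub>R (h *v w $ i)"
  have a: "act r h P = polygon_of ?u" unfolding P by (rule act_polygon_of[OF r nz])
  have n: "(norm (?u $ i))\<^sup>2 = r $ i" for i using nz[of i] r[of i] by (simp add: power_mult_distrib power_divide)
  show ?thesis
  proof
    assume "act r h P \<in> closed_polygons r"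
    then obtain v where "tight_frame r v" "act r h P = polygon_of v" unfolding closed_polygons_iff by blast
    then show "(\<Sum>i\<in>UNIV. act r h P $ i) = mat (of_real ((\<Sum>i\<in>UNIV. r $ i) / CARD('d)))"
      by (simp add: tight_frame_def polygon_of_def)
  next
    assume "(\<Sum>i\<in>UNIV. act r h P $ i) = mat (of_real ((\<Sum>i\<in>UNIV. r $ i) / CARD('d)))"
    then have "tight_frame r ?u" using r n unfolding a tight_frame_def by (simp add: polygon_of_def)
    then show "act r h P \<in> closed_polygons r" unfolding closed_polygons_iff using a by blast
  qed
qed

lemma conj_scaleR: "(h :: complex^'d::finite^'d) ** (t *\<^sub>R A) ** adj h = t *\<^sub>R (h ** A ** adj h)"
  by (simp add: scaleR_matrix_mult)

text \<open>The intermediate lengths \<open>r\<close> are forgotten by the second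
  normalisation.\<close>

lemma act_act:
  fixes P :: "('d::finite, 'n::finite) polygon"
  assumes P: "config P" and h: "invertible h" and r: "\<And>i. r $ i > 0"
  shows "act s k (act r h P) = act s (k ** h) P"
proof -
  have "act s k (act r h P) $ i = act s (k ** h) P $ i" for i
  proof -
    define t where "t = r $ i / Re (trace (h ** P $ i ** adj h))"
    have t: "t \<noteq> 0" using Re_trace_act_pos[OF P h, of i] r[of i] by (simp add: t_def)
    have "k ** (act r h P $ i) ** adj k = t *\<^sub>R ((k ** h) ** P $ i ** adj (k ** h))"
      by (simp add: act_def t_def conj_scaleR adj_mult matrix_mul_assoc)
    then show ?thesis using t by (simp add: act_def[of s] trace_scaleR)
  qed
  then show ?thesis by (simp add: vec_eq_iff)
qed

lemma act_scaleR: "t \<noteq> 0 \<Longrightarrow> act r (t *\<^sub>R h) P = act r h P"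
  by (simp add: act_def vec_eq_iff scaleR_matrix_mult trace_scaleR)

lemma act_unitary:
  assumes "e \<in> closed_polygons r" "u \<in> unitary_group" shows "act r u e = conjugate u e"
proof -
  have "trace (u ** e $ i ** adj u) = of_real (r $ i)" for i
    using trace_mul_sym[of "u ** e $ i" "adj u"] assms trace_closed_polygons[OF assms(1), of i]
    by (simp add: matrix_mul_assoc unitary_group_def)
  moreover have "r $ i \<noteq> 0" for i using closed_polygons_pos[OF assms(1), of i] by simp
  ultimately show ?thesis by (simp add: act_def conjugate_def)
qed

lemma act_one: "e \<in> closed_polygons r \<Longrightarrow> act r (mat 1) e = e"
  using act_unitary[of e r "mat 1"] by (simp add: unitary_one conjugate_def vec_eq_iff)

lemma conjugate_closed_polygons:
  assumes "e \<in> closed_polygons r" "u \<in> unitary_group" shows "conjugate u e \<in> closed_polygons r"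
proof -
  obtain w where w: "tight_frame r w" "e = polygon_of w" using assms(1) unfolding closed_polygons_iff by blast
  let ?v = "\<chi> i. u *v w $ i"
  have "(norm (u *v w $ i))\<^sup>2 = (norm (w $ i))\<^sup>2" for i
  proof -
    have "complex_of_real ((norm (u *v w $ i))\<^sup>2) = of_real ((norm (w $ i))\<^sup>2)"
      unfolding hinner_self[symmetric] hinner_adj using assms(2)
      by (simp add: matrix_vector_mul_assoc unitary_group_def)
    then show ?thesis by (rule of_real_eq_iff[THEN iffD1])
  qed
  then have "tight_frame r ?v"
    using w(1) sum_conjugate_tight_frame[OF w(1), of u] assms(2)
    by (simp add: tight_frame_def unitary_group_def mat_of_real[where 'd = 'a] del: of_real_divide of_real_sum)
  moreover have "conjugate u e = polygon_of ?v"
    by (simp add: w conjugate_def polygon_of_def conjugate_line_projection)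
  ultimately show ?thesis unfolding closed_polygons_iff by blast
qed

lemma line_projection_eq_imp_parallel:
  assumes "line_projection x = line_projection y" shows "\<exists>z. y = z *s x"
proof (cases "y = 0")
  case False
  have "hinner x y *s x = hinner y y *s y"
    using assms by (simp add: line_projection_mult[symmetric])
  moreover have "inverse (hinner y y) *s (hinner y y *s y) = y"
    using False by (simp add: vec_eq_iff hinner_self)
  ultimately have "inverse (hinner y y) *s (hinner x y *s x) = y" by simp
  then show ?thesis by (metis vector_smult_assoc)
qed (auto intro: exI[of _ 0])

text \<open>Both polygons lift to tight frames, and since \<open>h\<close> carries the lines of one
  to those of the other, the frame vectors correspond under \<open>h\<close> up to scalars.\<close>

theorem balancing_unique_up_to_unitary:
  fixes e :: "('d::finite, 'n::finite) polygon"
  assumes e: "e \<in> closed_polygons r" and h: "balancing r e h" and g: "generic TYPE('d) r"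
  shows "\<exists>l>0. adj h ** h = mat (of_real l)"
proof -
  obtain u where u: "tight_frame r u" "e = polygon_of u" using e unfolding closed_polygons_iff by blast
  obtain v where v: "tight_frame r v" "act r h e = polygon_of v"
    using h unfolding balancing_def closed_polygons_iff by blast
  have nz: "h *v u $ i \<noteq> 0" for i
    using h invertible_mult_nz tight_frame_nz[OF u(1)] by (auto simp: balancing_def)
  have rp: "r $ i > 0" for i using u by (simp add: tight_frame_def)
  have "\<exists>z. v $ i = z *s (h *v u $ i)" for i
  proof -
    have "line_projection ((sqrt (r $ i) / norm (h *v u $ i)) *\<^sub>R (h *v u $ i)) = line_projection (v $ i)"
      using v(2) unfolding u(2) act_polygon_of[OF rp nz] by (simp add: polygon_of_def vec_eq_iff)
    then obtain z where "v $ i = z *s ((sqrt (r $ i) / norm (h *v u $ i)) *\<^sub>R (h *v u $ i))"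
      using line_projection_eq_imp_parallel by blast
    then have "v $ i = (z * of_real (sqrt (r $ i) / norm (h *v u $ i))) *s (h *v u $ i)"
      by (simp add: vec_eq_iff scaleR_conv_of_real[where 'a = complex])
    then show ?thesis by blast
  qed
  then obtain \<tau> where "\<And>i. v $ i = \<tau> i *s (h *v u $ i)" by metis
  then show ?thesis by (rule tight_frame_unique_up_to_unitary[OF u(1) v(1) g])
qed

text \<open>With the trace \<open>CARD('d)\<close> the identity is the normalised choice for a
  polygon that is already closed.\<close>

definition balancer :: "real^'n \<Rightarrow> ('d::finite, 'n::finite) polygon \<Rightarrow> complex^'d^'d \<Rightarrow> bool" where
  "balancer r P g \<longleftrightarrow> posdef g \<and> Re (trace g) = CARD('d) \<and> act r g P \<in> closed_polygons r"

text \<open>A unitary factor on the left only conjugates the resulting closed polygon, and a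
  positive factor changes nothing; so \<open>h\<close> may be replaced by its positive definite
  polar factor, rescaled.\<close>

lemma balancer_exists:
  fixes P :: "('d::finite, 'n::finite) polygon"
  assumes P: "config P" and h: "balancing r P h"
  obtains g where "balancer r P g"
proof -
  have ih: "invertible h" and a: "act r h P \<in> closed_polygons r" using h by (auto simp: balancing_def)
  obtain u where u: "u \<in> unitary_group" "posdef (u ** h)" using polar_decomposition[OF ih] by blast
  define t where "t = CARD('d) / Re (trace (u ** h))"
  have t: "t > 0" using posdef_trace_pos[OF u(2)] by (simp add: t_def)
  have "act r (t *\<^sub>R (u ** h)) P = conjugate u (act r h P)"
    using t act_act[OF P ih closed_polygons_pos[OF a], of r u] act_unitary[OF a u(1)] by (simp add: act_scaleR)
  then have "balancer r P (t *\<^sub>R (u ** h))"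
    using posdef_scaleR[OF u(2) t] posdef_trace_pos[OF u(2)] conjugate_closed_polygons[OF a u(1)]
    by (simp add: balancer_def trace_scaleR t_def)
  then show thesis by (rule that)
qed

text \<open>With \<open>q\<close> the inverse of \<open>g\<close>, the matrix \<open>k ** q\<close>
  balances the closed polygon \<open>act r g P\<close>, so it is unitary up to a scalar and
  \<open>k ** k\<close> is a positive multiple of \<open>g ** g\<close>. Uniqueness of positive
  square roots and the trace then give equality.\<close>

lemma balancer_unique:
  fixes P :: "('d::finite, 'n::finite) polygon"
  assumes P: "config P" and g: "balancer r P g" and k: "balancer r P k" and gen: "generic TYPE('d) r"
  shows "g = k"
proof -
  have ig: "invertible g" and ik: "invertible k" using g k posdef_invertible by (auto simp: balancer_def)
  obtain q where q: "g ** q = mat 1" "q ** g = mat 1" using ig by (auto simp: invertible_def)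
  have iq: "invertible q" using q by (auto simp: invertible_def)
  have ag: "act r g P \<in> closed_polygons r" using g by (simp add: balancer_def)
  have adq: "adj q = q" and adg: "adj g = g" and adk: "adj k = k"
    using posdef_inverse[OF _ q(1)] g k by (auto simp: balancer_def posdef_def)
  have "act r (k ** q) (act r g P) = act r k P"
    using act_act[OF P ig closed_polygons_pos[OF ag], of r "k ** q"] q by (simp add: matrix_mul_assoc[symmetric])
  then have "balancing r (act r g P) (k ** q)"
    using k invertible_mult[OF ik iq] by (simp add: balancing_def balancer_def)
  then obtain l where l: "l > 0" "adj (k ** q) ** (k ** q) = mat (of_real l)"
    using balancing_unique_up_to_unitary[OF ag _ gen] by blast
  have "k ** k = g ** (adj (k ** q) ** (k ** q)) ** g"
    using q adq adk by (simp add: adj_mult matrix_mul_assoc) (simp add: matrix_mul_assoc[symmetric])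
  also have "\<dots> = (sqrt l *\<^sub>R g) ** (sqrt l *\<^sub>R g)"
    unfolding l(2) mat_of_real using l(1) by (simp add: scaleR_matrix_mult)
  finally have "k = sqrt l *\<^sub>R g"
    using posdef_square_inj k g l(1) by (metis balancer_def posdef_scaleR real_sqrt_gt_zero)
  moreover from this have "sqrt l = 1" using g k by (simp add: balancer_def trace_scaleR)
  ultimately show ?thesis by simp
qed

subsection \<open>Smooth dependence of the balancing matrix\<close>

text \<open>For a configuration \<open>P\<close>, the Hermitian part of the defect is the balancing condition together
  with the normalisation of the trace, and its skew part forces \<open>h\<close> to be Hermitian. The number of
  equations thus equals the number of unknowns.\<close>

definition defect :: "((real^'n) \<times> ('d::finite, 'n::finite) polygon) \<times> (complex^'d^'d) \<Rightarrow> complex^'d^'d" where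
  "defect = (\<lambda>((r, P), h). (\<Sum>i\<in>UNIV. act r h P $ i) - ((\<Sum>i\<in>UNIV. r $ i) / CARD('d)) *\<^sub>R mat 1
     + (h - adj h) + (Re (trace h) - CARD('d)) *\<^sub>R mat 1)"

text \<open>Nonvanishing of the denominators in \<open>act\<close>, so that the formula is smooth on
  an open set of arbitrary matrices.\<close>

definition defect_domain :: "(((real^'n) \<times> ('d::finite, 'n::finite) polygon) \<times> (complex^'d^'d)) set" where
  "defect_domain = {((r, P), h). \<forall>i. Re (trace (h ** P $ i ** adj h)) \<noteq> 0}"

lemma open_defect_domain: "open (defect_domain :: (((real^'n) \<times> ('d::finite, 'n::finite) polygon) \<times> (complex^'d^'d)) set)"
proof -
  have "open {p :: ((real^'n) \<times> ('d, 'n) polygon) \<times> (complex^'d^'d).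
      Re (trace (snd p ** snd (fst p) $ i ** adj (snd p))) \<noteq> 0}" for i
    by (intro open_Collect_neq continuous_intros continuous_on_trace continuous_on_matrix_mult continuous_on_adj)
  then have "open (\<Inter>i. {p :: ((real^'n) \<times> ('d, 'n) polygon) \<times> (complex^'d^'d).
      Re (trace (snd p ** snd (fst p) $ i ** adj (snd p))) \<noteq> 0})"
    by (intro open_INT) auto
  moreover have "defect_domain = (\<Inter>i. {p :: ((real^'n) \<times> ('d, 'n) polygon) \<times> (complex^'d^'d).
      Re (trace (snd p ** snd (fst p) $ i ** adj (snd p))) \<noteq> 0})"
    by (auto simp: defect_domain_def)
  ultimately show ?thesis by simp
qed

lemma smooth_on_act [smooth_intros]:
  fixes r :: "'a::euclidean_space \<Rightarrow> real^'n::finite" and h :: "'a \<Rightarrow> complex^'d::finite^'d"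
  assumes "open U" "smooth_on U r" "smooth_on U h" "smooth_on U P"
    and "\<And>x. x \<in> U \<Longrightarrow> ((r x, P x), h x) \<in> defect_domain"
  shows "smooth_on U (\<lambda>x. act (r x) (h x) (P x))"
  unfolding act_def using assms(5)
  by (intro smooth_intros assms(1-4)) (auto simp: defect_domain_def)

lemma smooth_on_defect: "smooth_on defect_domain defect"
  unfolding defect_def case_prod_unfold
  by (intro smooth_intros open_defect_domain) auto

lemma sum_hinner_tight_frame:
  assumes "tight_frame r (u :: (complex^'d::finite)^'n::finite)"
  shows "(\<Sum>i\<in>UNIV. hinner (u $ i) (S *v u $ i)) = ((\<Sum>i\<in>UNIV. r $ i) / CARD('d)) *\<^sub>R trace S"
proof -
  have "(\<Sum>i\<in>UNIV. hinner (u $ i) (S *v u $ i)) = trace (S ** (\<Sum>i\<in>UNIV. line_projection (u $ i)))"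
    by (simp add: matrix_sum_mult trace_sum trace_mult_line_projection)
  then show ?thesis using assms
    by (simp add: tight_frame_def mat_of_real[where 'd = 'd] scaleR_matrix_mult trace_scaleR del: of_real_divide of_real_sum)
qed

lemma trace_zero [simp]: "trace (0 :: complex^'d::finite^'d) = 0"
  by (simp add: trace_def)

text \<open>The quotient rule, applied to each summand of \<open>defect\<close> in the matrix
  variable.\<close>

definition defect_derivative ::
  "real^'n \<Rightarrow> complex^'d::finite^'d \<Rightarrow> ('d, 'n::finite) polygon \<Rightarrow> complex^'d^'d \<Rightarrow> complex^'d^'d" where
  "defect_derivative r g P X = (\<Sum>i\<in>UNIV.
     (r $ i / Re (trace (g ** P $ i ** adj g))) *\<^sub>R (X ** P $ i ** adj g + g ** P $ i ** adj X)
     - (r $ i * Re (trace (X ** P $ i ** adj g + g ** P $ i ** adj X)) / (Re (trace (g ** P $ i ** adj g)))\<^sup>2)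
        *\<^sub>R (g ** P $ i ** adj g))
   + (X - adj X) + Re (trace X) *\<^sub>R mat 1"

lemma defect_has_vector_derivative:
  fixes P :: "('d::finite, 'n::finite) polygon"
  assumes nz: "\<And>i. Re (trace (g ** P $ i ** adj g)) \<noteq> 0"
  shows "((\<lambda>t. defect ((r, P), g + t *\<^sub>R X)) has_vector_derivative defect_derivative r g P X) (at 0)"
proof -
  define N0 where "N0 i = g ** P $ i ** adj g" for i
  define N1 where "N1 i = X ** P $ i ** adj g + g ** P $ i ** adj X" for i
  define N2 where "N2 i = X ** P $ i ** adj X" for i
  have num: "(g + t *\<^sub>R X) ** P $ i ** adj (g + t *\<^sub>R X) = N0 i + t *\<^sub>R N1 i + (t * t) *\<^sub>R N2 i" for t i
    by (simp add: N0_def N1_def N2_def matrix_add_ldistrib matrix_add_rdistrib_complex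
        scaleR_matrix_mult scaleR_add_right)
  have eq: "defect ((r, P), g + t *\<^sub>R X) = (\<Sum>i\<in>UNIV.
      (r $ i / (Re (trace (N0 i)) + t * Re (trace (N1 i)) + (t * t) * Re (trace (N2 i)))) *\<^sub>R
        (N0 i + t *\<^sub>R N1 i + (t * t) *\<^sub>R N2 i)) - ((\<Sum>i\<in>UNIV. r $ i) / CARD('d)) *\<^sub>R mat 1
      + (g - adj g + t *\<^sub>R (X - adj X)) + (Re (trace g) + t * Re (trace X) - CARD('d)) *\<^sub>R mat 1" for t
    unfolding defect_def act_def prod.case vec_lambda_beta num
    by (simp add: trace_add trace_scaleR scaleR_diff_right)
  have nz': "Re (trace (N0 i)) \<noteq> 0" for i using nz by (simp add: N0_def)
  have summand: "((\<lambda>t. (r $ i / (Re (trace (N0 i)) + t * Re (trace (N1 i)) + (t * t) * Re (trace (N2 i)))) *\<^sub>R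
        (N0 i + t *\<^sub>R N1 i + (t * t) *\<^sub>R N2 i)) has_vector_derivative
      ((r $ i / Re (trace (N0 i))) *\<^sub>R N1 i - (r $ i * Re (trace (N1 i)) / (Re (trace (N0 i)))\<^sup>2) *\<^sub>R N0 i)) (at 0)" for i
  proof -
    have a: "((\<lambda>t. r $ i / (Re (trace (N0 i)) + t * Re (trace (N1 i)) + (t * t) * Re (trace (N2 i))))
        has_field_derivative (- (r $ i * Re (trace (N1 i)) / (Re (trace (N0 i)))\<^sup>2))) (at 0)"
      using nz'[of i] by (auto intro!: derivative_eq_intros simp: power2_eq_square)
    have b: "((\<lambda>t. N0 i + t *\<^sub>R N1 i + (t * t) *\<^sub>R N2 i) has_vector_derivative N1 i) (at 0)"
      by (auto intro!: derivative_eq_intros)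
    show ?thesis using has_vector_derivative_scaleR[OF a b] by simp
  qed
  have "((\<lambda>t. defect ((r, P), g + t *\<^sub>R X)) has_vector_derivative
     (\<Sum>i\<in>UNIV. (r $ i / Re (trace (N0 i))) *\<^sub>R N1 i - (r $ i * Re (trace (N1 i)) / (Re (trace (N0 i)))\<^sup>2) *\<^sub>R N0 i)
      - 0 + (0 + (X - adj X)) + (0 + Re (trace X) - 0) *\<^sub>R mat 1) (at 0)"
    unfolding eq
    by (intro has_vector_derivative_add has_vector_derivative_diff has_vector_derivative_sum summand
        has_vector_derivative_const)
      (auto intro!: derivative_eq_intros)
  then show ?thesis by (simp add: defect_derivative_def N0_def N1_def)
qed

text \<open>Written at the balanced frame \<open>u\<close>, the derivative is a Hermitian matrix
  \<open>A\<close> of trace zero, plus the skew part of \<open>X\<close>, plus a multiple of the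
  identity. These vanish separately: \<open>X\<close> is Hermitian, its trace is zero, and
  \<open>A = 0\<close> is the equation of infinitesimal rigidity. So \<open>S\<close> is a scalar,
  which makes \<open>X\<close> a multiple of \<open>g\<close>, and the trace makes that multiple
  zero.\<close>

lemma defect_derivative_injective:
  fixes w :: "(complex^'d::finite)^'n::finite"
  assumes P: "P = polygon_of w" "\<And>i. w $ i \<noteq> 0" and g: "balancer r P g" and gen: "generic TYPE('d) r"
    and zero: "defect_derivative r g P X = 0"
  shows "X = 0"
proof -
  have pd: "posdef g" and adg: "adj g = g" and trg: "Re (trace g) = CARD('d)"
    and ag: "act r g P \<in> closed_polygons r" using g by (auto simp: balancer_def posdef_def)
  obtain q where q: "g ** q = mat 1" "q ** g = mat 1"
    using posdef_invertible[OF pd] by (auto simp: invertible_def)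
  have adq: "adj q = q" using posdef_inverse[OF pd q(1)] by (simp add: posdef_def)
  obtain u where u: "tight_frame r u" "act r g P = polygon_of u" using ag unfolding closed_polygons_iff by blast
  define \<tau> where "\<tau> i = Re (trace (g ** P $ i ** adj g))" for i
  have \<tau>: "\<tau> i > 0" for i
    unfolding \<tau>_def by (rule Re_trace_act_pos) (use P posdef_invertible[OF pd] in \<open>auto simp: config_def\<close>)
  have rp: "r $ i > 0" for i using u by (simp add: tight_frame_def)
  have Q: "(r $ i / \<tau> i) *\<^sub>R (g ** P $ i ** adj g) = line_projection (u $ i)" for i
    using u(2) by (simp add: act_def polygon_of_def vec_eq_iff \<tau>_def)
  \<comment> \<open>Moves the base point from \<open>g\<close> to the identity, where the frame
    \<open>u\<close> is balanced.\<close>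
  define Y where "Y = X ** q"
  define S where "S = Y + adj Y"
  define c where "c = (\<Sum>i\<in>UNIV. r $ i) / CARD('d)"
  have Xg: "X = Y ** g" "adj X = g ** adj Y"
    using q adg adq by (simp_all add: Y_def adj_mult matrix_mul_assoc) (simp_all add: matrix_mul_assoc[symmetric])
  let ?N1 = "\<lambda>i. X ** P $ i ** adj g + g ** P $ i ** adj X"
  have N1: "(r $ i / \<tau> i) *\<^sub>R ?N1 i = Y ** line_projection (u $ i) + line_projection (u $ i) ** adj Y" for i
    unfolding Q[symmetric] by (simp add: Xg adg adj_mult scaleR_matrix_mult scaleR_add_right matrix_mul_assoc)
  have trN1: "r $ i * Re (trace (?N1 i)) / (\<tau> i)\<^sup>2 * (\<tau> i / r $ i) = Re (hinner (u $ i) (S *v u $ i)) / r $ i" for i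
  proof -
    have "(r $ i / \<tau> i) * Re (trace (?N1 i)) = Re (trace (Y ** line_projection (u $ i) + line_projection (u $ i) ** adj Y))"
      unfolding N1[symmetric] trace_scaleR by simp
    also have "\<dots> = Re (hinner (u $ i) (S *v u $ i))"
      using trace_mul_sym[of "line_projection (u $ i)" "adj Y"]
      by (simp add: trace_add trace_mult_line_projection S_def matrix_vector_mult_add_rdistrib hinner_add)
    finally show ?thesis using \<tau>[of i] rp[of i] by (simp add: field_simps power2_eq_square)
  qed
  define A where "A = c *\<^sub>R S - (\<Sum>i\<in>UNIV. (Re (hinner (u $ i) (S *v u $ i)) / r $ i) *\<^sub>R line_projection (u $ i))"
  have adS: "adj S = S" by (simp add: S_def add.commute)
  have "defect_derivative r g P X = A + (X - adj X) + Re (trace X) *\<^sub>R mat 1"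
  proof -
    have "(r $ i * Re (trace (?N1 i)) / (\<tau> i)\<^sup>2) *\<^sub>R (g ** P $ i ** adj g) =
        (Re (hinner (u $ i) (S *v u $ i)) / r $ i) *\<^sub>R line_projection (u $ i)" for i
      unfolding Q[symmetric] trN1[symmetric] using \<tau>[of i] rp[of i] by simp
    moreover have "(\<Sum>i\<in>UNIV. Y ** line_projection (u $ i) + line_projection (u $ i) ** adj Y) = c *\<^sub>R S"
    proof -
      have "(\<Sum>i\<in>UNIV. line_projection (u $ i)) = c *\<^sub>R mat 1"
        using u(1) by (simp add: tight_frame_def c_def mat_of_real[where 'd = 'd] del: of_real_divide of_real_sum)
      then show ?thesis
        by (simp add: sum.distrib matrix_sum_mult[symmetric] scaleR_matrix_mult S_def scaleR_add_right)
    qed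
    ultimately show ?thesis
      by (simp add: defect_derivative_def \<tau>_def[symmetric] sum_subtractf N1 A_def)
  qed
  with zero have e1: "A + (X - adj X) + Re (trace X) *\<^sub>R mat 1 = 0" by simp
  have adA: "adj A = A" by (simp add: A_def adS adj_sum)
  have e2: "A - (X - adj X) + Re (trace X) *\<^sub>R mat 1 = 0"
    using arg_cong[OF e1, of adj] by (simp add: adA algebra_simps)
  \<comment> \<open>The equation minus its adjoint isolates the skew part.\<close>
  have "2 *\<^sub>R (X - adj X) = (A + (X - adj X) + Re (trace X) *\<^sub>R mat 1) - (A - (X - adj X) + Re (trace X) *\<^sub>R mat 1)"
    by (simp add: scaleR_2)
  then have adX: "adj X = X" using e1 e2 by simp
  have e3: "A + Re (trace X) *\<^sub>R mat 1 = 0" using e1 adX by simp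
  \<comment> \<open>Since \<open>act\<close> fixes the trace of every edge, its variation
    \<open>A\<close> has trace zero.\<close>
  have "trace A = c *\<^sub>R trace S - of_real (Re (\<Sum>i\<in>UNIV. hinner (u $ i) (S *v u $ i)))"
  proof -
    have "trace ((Re (hinner (u $ i) (S *v u $ i)) / r $ i) *\<^sub>R line_projection (u $ i)) =
        of_real (Re (hinner (u $ i) (S *v u $ i)))" for i
      using u(1) less_imp_neq[OF rp[of i]]
      by (simp add: trace_scaleR trace_line_projection tight_frame_def scaleR_conv_of_real[where 'a = complex] del: of_real_power)
    then show ?thesis by (simp add: A_def trace_sub trace_scaleR trace_sum)
  qed
  then have "Re (trace A) = 0" unfolding sum_hinner_tight_frame[OF u(1)] c_def by simp
  then have trX: "Re (trace X) = 0"
    using arg_cong[OF e3, of "\<lambda>M. Re (trace M)"] by (simp add: trace_add trace_scaleR trace_mat)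
  then have "A = 0" using e3 by simp
  then obtain l :: real where l: "S = mat (of_real l)"
    using tight_frame_infinitesimally_rigid[OF u(1) gen adS] by (auto simp: A_def c_def)
  \<comment> \<open>Multiplying \<open>S\<close> by \<open>g\<close> on both sides removes the
    inverse \<open>q\<close>; the solution \<open>(l / 2) *\<^sub>R g\<close> is unique by
    \<open>posdef_sylvester\<close>.\<close>
  have "g ** X + X ** g = g ** S ** g"
    using adX adq q unfolding S_def Y_def
    by (simp add: adj_mult matrix_add_ldistrib matrix_add_rdistrib_complex matrix_mul_assoc)
      (simp add: matrix_mul_assoc[symmetric] add.commute)
  also have "\<dots> = l *\<^sub>R (g ** g)" by (simp add: l mat_of_real scaleR_matrix_mult)
  finally have gX: "g ** X + X ** g = l *\<^sub>R (g ** g)" .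
  have "g ** (X - (l / 2) *\<^sub>R g) + (X - (l / 2) *\<^sub>R g) ** g = 0"
  proof -
    have sub: "B ** (C - D) = B ** C - B ** D" "(C - D) ** B = C ** B - D ** B" for B C D :: "complex^'d^'d"
      by (simp_all add: matrix_matrix_mult_def vec_eq_iff sum_subtractf algebra_simps)
    show ?thesis using gX by (simp add: sub scaleR_matrix_mult algebra_simps scaleR_left_distrib[symmetric])
  qed
  from posdef_sylvester[OF pd pd _ this] have X: "X = (l / 2) *\<^sub>R g" by (simp add: adX adg)
  then have "l = 0" using trX trg by (simp add: trace_scaleR)
  with X show ?thesis by simp
qed

text \<open>The complement is the projection of a closed set along the compact unit sphere. The set
  contains non-Hermitian matrices, as being Hermitian is not an open condition; it is recovered from
  the skew part of \<open>defect\<close>.\<close>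

lemma open_positive_forms:
  "open {h :: complex^'d::finite^'d. \<forall>x. norm x = 1 \<longrightarrow> x \<bullet> (h *v x) > 0}"
proof -
  let ?T = "{p :: (complex^'d) \<times> (complex^'d^'d). fst p \<bullet> (snd p *v fst p) \<le> 0}"
  have "closed ?T"
    unfolding matrix_vector_mult_def by (intro closed_Collect_le continuous_intros)
  from closed_compact_projection[OF compact_sphere[of 0 1] this]
  have "closed {h :: complex^'d^'d. \<exists>x. x \<in> sphere 0 1 \<and> (x, h) \<in> ?T}" .
  moreover have "{h :: complex^'d^'d. \<forall>x. norm x = 1 \<longrightarrow> x \<bullet> (h *v x) > 0} =
      - {h. \<exists>x. x \<in> sphere 0 1 \<and> (x, h) \<in> ?T}"
    by (auto simp: not_le)
  ultimately show ?thesis by (simp add: open_closed)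
qed

lemma posdef_iff_unit_vectors:
  "posdef h \<longleftrightarrow> adj h = h \<and> (\<forall>x. norm x = 1 \<longrightarrow> x \<bullet> (h *v x) > 0)" for h :: "complex^'d::finite^'d"
proof -
  have "x \<bullet> (h *v x) > 0" if pos: "\<And>x. norm x = 1 \<Longrightarrow> x \<bullet> (h *v x) > 0" and x: "x \<noteq> 0" for x
  proof -
    define y where "y = inverse (norm x) *\<^sub>R x"
    have y: "norm y = 1" "x = norm x *\<^sub>R y" using x by (simp_all add: y_def)
    have "x \<bullet> (h *v x) = (norm x)\<^sup>2 * (y \<bullet> (h *v y))"
      by (subst (1 2) y(2)) (simp add: matrix_vector_mult_complex_simps power2_eq_square)
    then show ?thesis using pos[OF y(1)] x by simp
  qed
  then show ?thesis unfolding posdef_def Re_hinner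
    by (metis norm_zero zero_neq_one)
qed

text \<open>The skew part gives \<open>adj h = h\<close>. The trace of the Hermitian part then
  separates the two remaining conditions, because the traces of the edges add up to the sum of the
  \<open>r $ i\<close> in any case.\<close>

lemma defect_zero:
  fixes w :: "(complex^'d::finite)^'n::finite"
  assumes P: "P = polygon_of w" and r: "\<And>i. r $ i > 0"
    and dom: "((r, P), h) \<in> defect_domain" and zero: "defect ((r, P), h) = 0"
    and pos: "\<And>x. norm x = 1 \<Longrightarrow> x \<bullet> (h *v x) > 0"
  shows "balancer r P h"
proof -
  let ?c = "(\<Sum>i\<in>UNIV. r $ i) / CARD('d)"
  have nz: "h *v w $ i \<noteq> 0" for i
    using dom by (auto simp: defect_domain_def P polygon_of_def conjugate_line_projection
        trace_line_projection simp del: of_real_power)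
  have lp: "act r h P $ i = line_projection ((sqrt (r $ i) / norm (h *v w $ i)) *\<^sub>R (h *v w $ i))" for i
    unfolding P act_polygon_of[OF r nz] by (simp add: polygon_of_def)
  define A where "A = (\<Sum>i\<in>UNIV. act r h P $ i)"
  define B where "B = A - ?c *\<^sub>R mat 1 + (Re (trace h) - CARD('d)) *\<^sub>R mat 1"
  have "trace (act r h P $ i) = of_real (r $ i)" for i
    using nz[of i] r[of i] unfolding lp trace_line_projection by (simp add: power_mult_distrib power_divide del: of_real_power)
  then have trA: "trace A = of_real (\<Sum>i\<in>UNIV. r $ i)" by (simp add: A_def trace_sum)
  have "adj A = A" unfolding A_def by (simp add: adj_sum lp)
  then have adB: "adj B = B" by (simp add: B_def)
  have e1: "B + (h - adj h) = 0" using zero by (simp add: defect_def B_def A_def algebra_simps)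
  have e2: "B - (h - adj h) = 0" using arg_cong[OF e1, of adj] by (simp add: adB algebra_simps)
  have "2 *\<^sub>R B = (B + (h - adj h)) + (B - (h - adj h))" by (simp add: scaleR_2)
  then have B: "B = 0" unfolding e1 e2 by simp
  then have adh: "adj h = h" using e1 by simp
  have "Re (trace B) = 0" by (simp add: B trace_def)
  then have trh: "Re (trace h) = CARD('d)"
    by (simp add: B_def trace_add trace_sub trace_scaleR trace_mat trA)
  then have "A = mat (of_real ?c)" using B by (simp add: B_def mat_of_real[where 'd = 'd] del: of_real_divide of_real_sum)
  then have "act r h P \<in> closed_polygons r"
    unfolding act_in_closed_polygons_iff[OF P r nz] A_def .
  then show ?thesis using adh trh pos by (simp add: balancer_def posdef_iff_unit_vectors)
qed

text \<open>The neighbourhood \<open>Y\<close> consists of arbitrary pairs of weights and tuples of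
  matrices; where they are not positive weights and a configuration, \<open>\<gamma>\<close> is
  merely a zero of the defect. Intersecting with the preimage of the positive forms keeps
  \<open>\<gamma>\<close> positive definite at the relevant points.\<close>

theorem balancer_smooth:
  fixes P0 :: "('d::finite, 'n::finite) polygon"
  assumes P0: "config P0" and g0: "balancer r0 P0 g0" and gen: "generic TYPE('d) r0"
  obtains Y \<gamma> where "open Y" "(r0, P0) \<in> Y" "smooth_on Y \<gamma>"
    "\<And>r P. (r, P) \<in> Y \<Longrightarrow> ((r, P), \<gamma> (r, P)) \<in> defect_domain"
    "\<And>r P. (r, P) \<in> Y \<Longrightarrow> config P \<Longrightarrow> (\<And>i. r $ i > 0) \<Longrightarrow> balancer r P (\<gamma> (r, P))"
proof -
  obtain w where w: "\<And>i. w $ i \<noteq> 0" "P0 = polygon_of w" using P0 by (auto simp: config_def)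
  have pd: "posdef g0" and a: "act r0 g0 P0 \<in> closed_polygons r0" and tr: "Re (trace g0) = CARD('d)"
    using g0 by (auto simp: balancer_def)
  have rp: "r0 $ i > 0" for i using closed_polygons_pos[OF a] .
  have tp: "Re (trace (g0 ** P0 $ i ** adj g0)) > 0" for i
    by (rule Re_trace_act_pos[OF P0 posdef_invertible[OF pd]])
  have nz: "g0 *v w $ i \<noteq> 0" for i using invertible_mult_nz[OF posdef_invertible[OF pd] w(1)] .
  have dom: "((r0, P0), g0) \<in> defect_domain"
    using tp by (auto simp: defect_domain_def) (metis less_irrefl)
  have zero: "defect ((r0, P0), g0) = 0"
    using a tr pd unfolding act_in_closed_polygons_iff[OF w(2) rp nz]
    by (simp add: defect_def posdef_def mat_of_real[where 'd = 'd] del: of_real_divide of_real_sum)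
  have nz': "Re (trace (g0 ** P0 $ i ** adj g0)) \<noteq> 0" for i using tp[of i] by simp
  obtain Y \<gamma> where Y: "open Y" "(r0, P0) \<in> Y" "smooth_on Y \<gamma>" "\<gamma> (r0, P0) = g0"
    and \<gamma>: "\<And>y. y \<in> Y \<Longrightarrow> (y, \<gamma> y) \<in> defect_domain \<and> defect (y, \<gamma> y) = 0"
    using smooth_implicit_function[OF open_defect_domain smooth_on_defect dom zero
        defect_has_vector_derivative[OF nz'] defect_derivative_injective[OF w(2,1) g0 gen]] by blast
  let ?H = "{h :: complex^'d^'d. \<forall>x. norm x = 1 \<longrightarrow> x \<bullet> (h *v x) > 0}"
  let ?Y = "Y \<inter> \<gamma> -` ?H"
  have o: "open ?Y"
    by (rule continuous_open_preimage[OF smooth_on_continuous_on[OF Y(3)] Y(1) open_positive_forms])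
  show thesis
  proof (rule that[OF o])
    show "(r0, P0) \<in> ?Y" using Y pd by (simp add: posdef_iff_unit_vectors)
    show "smooth_on ?Y \<gamma>" using Y(3) by (rule smooth_on_subset) auto
    show "((r, P), \<gamma> (r, P)) \<in> defect_domain" if "(r, P) \<in> ?Y" for r P using that \<gamma> by blast
    show "balancer r P (\<gamma> (r, P))" if "(r, P) \<in> ?Y" "config P" "\<And>i. r $ i > 0" for r P
    proof -
      obtain w where "P = polygon_of w" using \<open>config P\<close> by (auto simp: config_def)
      then show ?thesis using that \<gamma>[of "(r, P)"] by (intro defect_zero) auto
    qed
  qed
qed

subsection \<open>Balancing along a chamber\<close>

lemma rank_nullity:
  fixes f :: "'a::euclidean_space \<Rightarrow> 'b::euclidean_space"
  assumes f: "linear f" shows "dim {x. f x = 0} + dim (range f) = DIM('a)"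
proof -
  let ?K = "{x. f x = 0}"
  let ?C = "{y \<in> UNIV. \<forall>x\<in>?K. orthogonal x y}"
  have K: "subspace ?K" using f by (auto simp: subspace_def linear_0 linear_add linear_scale)
  have C: "subspace ?C" by (auto simp: subspace_def orthogonal_def inner_add_right)
  have "f x \<in> f ` ?C" for x
  proof -
    obtain y z where yz: "y \<in> span ?K" "\<And>w. w \<in> span ?K \<Longrightarrow> orthogonal z w" "x = y + z"
      by (rule orthogonal_subspace_decomp_exists[of ?K x]) blast
    have sK: "span ?K = ?K" using K by (rule span_eq_iff[THEN iffD2])
    have "f y = 0" using yz(1) unfolding sK by simp
    then have "f x = f z" unfolding yz(3) linear_add[OF f] by simp
    moreover have "orthogonal k z" if "f k = 0" for k
      using yz(2)[of k] that by (simp add: orthogonal_commute span_base)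
    ultimately show ?thesis by blast
  qed
  then have "range f = f ` ?C" by auto
  moreover have "inj_on f (span ?C)"
  proof (rule inj_onI)
    fix x y assume xy: "x \<in> span ?C" "y \<in> span ?C" "f x = f y"
    have sC: "span ?C = ?C" using C by (rule span_eq_iff[THEN iffD2])
    have "x - y \<in> ?C" using subspace_diff[OF C] xy(1,2) unfolding sC .
    moreover have "x - y \<in> ?K" using xy f by (simp add: linear_diff)
    ultimately have "orthogonal (x - y) (x - y)" by blast
    then show "x = y" by (simp add: orthogonal_self)
  qed
  ultimately have "dim (range f) = dim ?C" using dim_image_eq[OF f] by simp
  then show ?thesis
    using dim_subspace_orthogonal_to_vectors[OF K subspace_UNIV subset_UNIV] by simp
qed

lemma csubspace_kernel: "csubspace {x. h *v x = 0}" for h :: "complex^'d::finite^'d"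
  by (rule csubspaceI) (auto simp: matrix_vector_right_distrib matrix_vector_mult_complex_simps)

lemma csubspace_range: "csubspace (range (\<lambda>x. h *v x))" for h :: "complex^'d::finite^'d"
proof (rule csubspaceI)
  show "0 \<in> range (\<lambda>x. h *v x)" by (metis matrix_vector_mult_0_right rangeI)
qed (auto simp: matrix_vector_right_distrib[symmetric] matrix_vector_mult_complex_simps(3)[symmetric])

text \<open>The difference of the two sides is continuous and, by \<open>generic_dim\<close>,
  without zeros on the connected set \<open>\<Delta>\<close>, so its sign is constant.\<close>

lemma stability_in_chamber:
  fixes \<Delta> :: "(real^'n::finite) set" and V :: "(complex^'d::finite) set"
  assumes \<Delta>: "connected \<Delta>" "\<And>r. r \<in> \<Delta> \<Longrightarrow> generic TYPE('d) r" "\<And>r i. r \<in> \<Delta> \<Longrightarrow> r $ i > 0"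
    and rs: "r \<in> \<Delta>" "s \<in> \<Delta>" and V: "csubspace V" "0 < dim V" "dim V < 2 * CARD('d)"
    and lt: "2 * CARD('d) * (\<Sum>i\<in>I. r $ i) < (\<Sum>i\<in>UNIV. r $ i) * dim V"
  shows "2 * CARD('d) * (\<Sum>i\<in>I. s $ i) < (\<Sum>i\<in>UNIV. s $ i) * dim V"
proof (rule ccontr)
  let ?f = "\<lambda>r :: real^'n. 2 * CARD('d) * (\<Sum>i\<in>I. r $ i) - (\<Sum>i\<in>UNIV. r $ i) * dim V"
  assume "\<not> ?thesis"
  then have s: "?f s \<ge> 0" by simp
  have "connected (?f ` \<Delta>)" by (intro connected_continuous_image \<Delta>(1) continuous_intros)
  then have int: "is_interval (?f ` \<Delta>)" by (simp add: is_interval_connected_1)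
  have "0 \<in> ?f ` \<Delta>"
    by (rule mem_is_interval_1_I[OF int imageI[OF rs(1)] imageI[OF rs(2)]]) (use lt s in auto)
  then obtain t where "t \<in> \<Delta>" "?f t = 0" by auto
  then show False using generic_dim[OF \<Delta>(3) \<Delta>(2) V, of t I] by simp
qed

text \<open>Openness is the implicit function theorem. For closedness, a limit \<open>h\<close> of balancing matrices of
  norm one is invertible: otherwise the frame vectors in its kernel and the limit frame vectors in
  its range, which account for all indices, would both satisfy strict stability inequalities that
  add up to a contradiction.\<close>

theorem balancing_exists:
  fixes \<Delta> :: "(real^'n::finite) set" and e :: "('d::finite, 'n) polygon"
  assumes \<Delta>: "connected \<Delta>" "\<And>r. r \<in> \<Delta> \<Longrightarrow> generic TYPE('d) r" "\<And>r i. r \<in> \<Delta> \<Longrightarrow> r $ i > 0"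
    and e: "e \<in> closed_polygons r0" "r0 \<in> \<Delta>" and s: "s \<in> \<Delta>"
  shows "\<exists>h. balancing s e h"
proof -
  define S where "S = {r \<in> \<Delta>. \<exists>h. balancing r e h}"
  have cfg: "config e" using e by (blast intro: config_closed_polygons)
  obtain u where u: "tight_frame r0 u" "e = polygon_of u" using e(1) unfolding closed_polygons_iff by blast
  have "invertible (mat 1 :: complex^'d^'d)" by (auto simp: invertible_def)
  then have "r0 \<in> S" using e act_one[OF e(1)] by (auto simp: S_def balancing_def intro!: exI[of _ "mat 1"])
  moreover have "openin (top_of_set \<Delta>) S"
    unfolding openin_subopen[of _ S]
  proof
    fix r assume r: "r \<in> S"
    then obtain g where g: "balancer r e g" using balancer_exists[OF cfg] by (auto simp: S_def)
    have r\<Delta>: "r \<in> \<Delta>" using r by (simp add: S_def)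
    obtain Y \<gamma> where Y: "open Y" "(r, e) \<in> Y"
      "\<And>r P. (r, P) \<in> Y \<Longrightarrow> config P \<Longrightarrow> (\<And>i. r $ i > 0) \<Longrightarrow> balancer r P (\<gamma> (r, P))"
      using balancer_smooth[OF cfg g \<Delta>(2)[OF r\<Delta>]] by metis
    let ?T = "\<Delta> \<inter> (\<lambda>r. (r, e)) -` Y"
    have "openin (top_of_set \<Delta>) ?T"
      by (intro openin_open_Int open_vimage Y(1) continuous_intros)
    moreover have "?T \<subseteq> S"
      using Y(3) cfg \<Delta>(3) posdef_invertible by (fastforce simp: S_def balancing_def balancer_def)
    ultimately show "\<exists>T. openin (top_of_set \<Delta>) T \<and> r \<in> T \<and> T \<subseteq> S" using r\<Delta> Y(2) by blast
  qed
  moreover have "l \<in> S" if l: "l \<in> \<Delta>" "l \<in> closure S" for l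
  proof -
    obtain x where xS: "\<And>n. x n \<in> S" and lim: "x \<longlonglongrightarrow> l"
      using l(2) unfolding closure_sequential by blast
    \<comment> \<open>Balancing matrices are scaled to norm one so that they cannot tend to zero.
      The relation is written without division because \<open>h *v u $ i\<close> may vanish in the
      limit.\<close>
    have "\<exists>(h :: complex^'d^'d) v. norm h = 1 \<and> tight_frame (x n) v \<and> (\<forall>i. (norm (h *v u $ i))\<^sup>2 *\<^sub>R line_projection (v $ i)
        = (x n $ i) *\<^sub>R line_projection (h *v u $ i))" for n
    proof -
      obtain h where h: "invertible h" "act (x n) h e \<in> closed_polygons (x n)"
        using xS[of n] by (auto simp: S_def balancing_def)
      obtain v where v: "tight_frame (x n) v" "act (x n) h e = polygon_of v"
        using h(2) unfolding closed_polygons_iff by blast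
      define k where "k = inverse (norm h) *\<^sub>R h"
      have hnz: "h *v u $ i \<noteq> 0" for i using invertible_mult_nz[OF h(1)] tight_frame_nz[OF u(1)] by blast
      then have "h \<noteq> 0" by auto
      then have k: "norm k = 1" "act (x n) k e = polygon_of v" using v(2) by (simp_all add: k_def act_scaleR)
      have nz: "k *v u $ i \<noteq> 0" for i
        using hnz[of i] \<open>h \<noteq> 0\<close> by (simp add: k_def matrix_vector_mult_complex_simps)
      have "line_projection (v $ i) = (x n $ i / (norm (k *v u $ i))\<^sup>2) *\<^sub>R line_projection (k *v u $ i)" for i
        using arg_cong[OF k(2), of "\<lambda>P. P $ i"]
        by (simp add: u(2) act_def polygon_of_def conjugate_line_projection trace_line_projection del: of_real_power)
      then have "(norm (k *v u $ i))\<^sup>2 *\<^sub>R line_projection (v $ i) = (x n $ i) *\<^sub>R line_projection (k *v u $ i)" for i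
        using nz[of i] by simp
      with v(1) k(1) show ?thesis by (intro exI[of _ k] exI[of _ v] conjI allI)
    qed
    then obtain h :: "nat \<Rightarrow> complex^'d^'d" and v where h: "\<And>n. norm (h n) = 1" and v: "\<And>n. tight_frame (x n) (v n)"
      and hv: "\<And>n i. (norm (h n *v u $ i))\<^sup>2 *\<^sub>R line_projection (v n $ i)
        = (x n $ i) *\<^sub>R line_projection (h n *v u $ i)" by metis
    have "(\<lambda>n. \<Sum>i\<in>UNIV. x n $ i) \<longlonglongrightarrow> (\<Sum>i\<in>UNIV. l $ i)" by (intro tendsto_intros lim)
    then have "bounded (range (\<lambda>n. \<Sum>i\<in>UNIV. x n $ i))" by (rule convergent_imp_bounded)
    then obtain K where K: "\<And>n. \<bar>\<Sum>i\<in>UNIV. x n $ i\<bar> \<le> K" by (auto simp: bounded_iff)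
    \<comment> \<open>The squared norm of the frame is the total length, so matrices and frames
      converge together along a subsequence.\<close>
    have "norm (h n, v n) \<le> 1 + (K + 1)" for n
    proof -
      have "(norm (v n))\<^sup>2 = (\<Sum>i\<in>UNIV. (norm (v n $ i))\<^sup>2)"
        by (simp add: norm_vec_def[of "v n"] L2_set_def sum_nonneg)
      also have "\<dots> = (\<Sum>i\<in>UNIV. x n $ i)" using v[of n] by (simp add: tight_frame_def)
      finally have "(norm (v n))\<^sup>2 \<le> K" using K[of n] by simp
      moreover have "norm (v n) \<le> (norm (v n))\<^sup>2 + 1"
        using zero_le_power2[of "norm (v n) - 1/2"] by (simp add: power2_eq_square algebra_simps)
      ultimately have "norm (v n) \<le> K + 1" by simp
      then show ?thesis using norm_Pair_le[of "h n" "v n"] h[of n] by simp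
    qed
    then have "bounded (range (\<lambda>n. (h n, v n)))" by (auto simp: bounded_iff)
    then have "seq_compact (closure (range (\<lambda>n. (h n, v n))))"
      by (simp add: compact_closure compact_eq_seq_compact_metric[symmetric])
    moreover have "\<forall>n. (h n, v n) \<in> closure (range (\<lambda>n. (h n, v n)))"
      using closure_subset by fastforce
    ultimately obtain p \<phi> where \<phi>: "strict_mono (\<phi> :: nat \<Rightarrow> nat)"
      and pl: "((\<lambda>n. (h n, v n)) \<circ> \<phi>) \<longlonglongrightarrow> p" by (rule seq_compactE)
    have hl: "(\<lambda>n. h (\<phi> n)) \<longlonglongrightarrow> fst p" and vl: "(\<lambda>n. v (\<phi> n)) \<longlonglongrightarrow> snd p"
      using tendsto_fst[OF pl] tendsto_snd[OF pl] by (simp_all add: o_def)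
    have xl: "(\<lambda>n. x (\<phi> n)) \<longlonglongrightarrow> l" using LIMSEQ_subseq_LIMSEQ[OF lim \<phi>] by (simp add: o_def)
    define h' where "h' = fst p"
    define v' where "v' = snd p"
    note hl = hl[folded h'_def] and vl = vl[folded v'_def]
    have vli: "(\<lambda>n. v (\<phi> n) $ i) \<longlonglongrightarrow> v' $ i" for i by (intro tendsto_intros vl)
    have xli: "(\<lambda>n. x (\<phi> n) $ i) \<longlonglongrightarrow> l $ i" for i by (intro tendsto_intros xl)
    have lpc: "isCont line_projection y" for y :: "complex^'d"
      using continuous_on_line_projection[where f = "\<lambda>x :: complex^'d. x" and S = UNIV] by (simp add: continuous_on_eq_continuous_at)
    have lpv: "(\<lambda>n. line_projection (v (\<phi> n) $ i)) \<longlonglongrightarrow> line_projection (v' $ i)" for i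
      by (rule isCont_tendsto_compose[OF lpc vli])
    have hul: "(\<lambda>n. h (\<phi> n) *v u $ i) \<longlonglongrightarrow> h' *v u $ i" for i
    proof -
      have "continuous_on UNIV (\<lambda>A :: complex^'d^'d. A *v u $ i)"
        unfolding matrix_vector_mult_def by (intro continuous_intros)
      then have "isCont (\<lambda>A :: complex^'d^'d. A *v u $ i) h'" by (simp add: continuous_on_eq_continuous_at)
      from isCont_tendsto_compose[OF this hl] show ?thesis .
    qed
    have nh: "norm h' = 1"
      using LIMSEQ_unique[OF tendsto_norm[OF hl]] h by simp
    have lp: "l $ i > 0" for i using \<Delta>(3) l(1) by blast
    have rel: "(norm (h' *v u $ i))\<^sup>2 *\<^sub>R line_projection (v' $ i) = (l $ i) *\<^sub>R line_projection (h' *v u $ i)" for i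
    proof (rule LIMSEQ_unique)
      show "(\<lambda>n. (norm (h (\<phi> n) *v u $ i))\<^sup>2 *\<^sub>R line_projection (v (\<phi> n) $ i)) \<longlonglongrightarrow>
          (norm (h' *v u $ i))\<^sup>2 *\<^sub>R line_projection (v' $ i)"
        by (intro tendsto_intros lpv hul)
      show "(\<lambda>n. (norm (h (\<phi> n) *v u $ i))\<^sup>2 *\<^sub>R line_projection (v (\<phi> n) $ i)) \<longlonglongrightarrow>
          (l $ i) *\<^sub>R line_projection (h' *v u $ i)"
        unfolding hv by (intro tendsto_intros xl isCont_tendsto_compose[OF lpc hul])
    qed
    have tl: "tight_frame l v'"
      unfolding tight_frame_def
    proof (intro conjI allI)
      fix i show "l $ i > 0" by (rule lp)
      show "(norm (v' $ i))\<^sup>2 = l $ i"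
      proof (rule LIMSEQ_unique)
        show "(\<lambda>n. (norm (v (\<phi> n) $ i))\<^sup>2) \<longlonglongrightarrow> (norm (v' $ i))\<^sup>2" by (intro tendsto_intros vl)
        show "(\<lambda>n. (norm (v (\<phi> n) $ i))\<^sup>2) \<longlonglongrightarrow> l $ i" using v xli by (simp add: tight_frame_def)
      qed
    next
      have "(\<Sum>i\<in>UNIV. line_projection (v' $ i)) = ((\<Sum>i\<in>UNIV. l $ i) / CARD('d)) *\<^sub>R mat 1"
      proof (rule LIMSEQ_unique)
        show "(\<lambda>n. \<Sum>i\<in>UNIV. line_projection (v (\<phi> n) $ i)) \<longlonglongrightarrow> (\<Sum>i\<in>UNIV. line_projection (v' $ i))"
          by (intro tendsto_sum lpv)
        have "(\<lambda>n. ((\<Sum>i\<in>UNIV. x (\<phi> n) $ i) / CARD('d)) *\<^sub>R (mat 1 :: complex^'d^'d)) \<longlonglongrightarrow>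
            ((\<Sum>i\<in>UNIV. l $ i) / CARD('d)) *\<^sub>R mat 1"
          by (intro tendsto_intros xl) simp
        then show "(\<lambda>n. \<Sum>i\<in>UNIV. line_projection (v (\<phi> n) $ i)) \<longlonglongrightarrow> ((\<Sum>i\<in>UNIV. l $ i) / CARD('d)) *\<^sub>R mat 1"
          using v by (simp add: tight_frame_def mat_of_real[where 'd = 'd] del: of_real_divide of_real_sum)
      qed
      then show "(\<Sum>i\<in>UNIV. line_projection (v' $ i)) = mat (of_real ((\<Sum>i\<in>UNIV. l $ i) / CARD('d)))"
        by (simp only: mat_of_real)
    qed
    have "invertible h'"
    proof (rule ccontr)
      assume sing: "\<not> invertible h'"
      let ?N = "{x. h' *v x = 0}" and ?V = "range (\<lambda>x. h' *v x)"
      have "h' \<noteq> 0" using nh by auto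
      then obtain y where y: "h' *v y \<noteq> 0" using matrix_eq[of h' 0] by auto
      have "\<not> (\<forall>x. h' *v x = 0 \<longrightarrow> x = 0)"
        using sing matrix_left_invertible_ker[of h'] invertible_left_inverse[of h'] by blast
      then have dN: "0 < dim ?N" unfolding dim_pos_iff by auto
      have dV: "0 < dim ?V" unfolding dim_pos_iff using y by auto
      have dd: "dim ?N + dim ?V = 2 * CARD('d)"
        using rank_nullity[OF linear_matrix_vector_mult_complex[of h']] by simp
      \<comment> \<open>If \<open>h'\<close> does not kill \<open>u $ i\<close>, the limit relation
        says that \<open>v' $ i\<close> spans the line of \<open>h' *v u $ i\<close>.\<close>
      have "v' $ i \<in> ?V" if "u $ i \<notin> ?N" for i
      proof -
        have nz: "h' *v u $ i \<noteq> 0" using that by simp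
        have "(norm (h' *v u $ i))\<^sup>2 *\<^sub>R (line_projection (v' $ i) *v v' $ i) =
            (l $ i) *\<^sub>R (line_projection (h' *v u $ i) *v v' $ i)"
          using arg_cong[OF rel[of i], of "\<lambda>A. A *v v' $ i"] by (simp only: matrix_vector_mult_complex_simps)
        then have e: "((norm (h' *v u $ i))\<^sup>2 * l $ i) *\<^sub>R (v' $ i) =
            h' *v ((l $ i) *\<^sub>R (hinner (h' *v u $ i) (v' $ i) *s u $ i))"
          using tl by (simp add: line_projection_mult hinner_self tight_frame_def matrix_vector_mult_complex_simps
              vec_eq_iff scaleR_conv_of_real[where 'a = complex] mult_ac del: of_real_power)
        have "v' $ i = inverse ((norm (h' *v u $ i))\<^sup>2 * l $ i) *\<^sub>R (((norm (h' *v u $ i))\<^sup>2 * l $ i) *\<^sub>R (v' $ i))"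
        proof -
          have "(norm (h' *v u $ i))\<^sup>2 * l $ i \<noteq> 0" using nz lp[of i] by simp
          then show ?thesis by (simp only: scaleR_scaleR left_inverse scaleR_one not_False_eq_True)
        qed
        then show ?thesis unfolding e matrix_vector_mult_complex_simps(1)[symmetric] by blast
      qed
      then have cover: "{i. u $ i \<in> ?N} \<union> {i. v' $ i \<in> ?V} = UNIV" by blast
      have 0: "2 * CARD('d) * (\<Sum>i | u $ i \<in> ?N. r0 $ i) < (\<Sum>i\<in>UNIV. r0 $ i) * dim ?N"
        by (rule subspace_stability_strict[OF u(1) \<Delta>(2)[OF e(2)] csubspace_kernel dN]) (use dV dd in simp)
      \<comment> \<open>The frame \<open>u\<close> is stable for \<open>r0\<close>; the chamber
        carries this over to the limit weights \<open>l\<close>.\<close>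
      have 1: "2 * CARD('d) * (\<Sum>i | u $ i \<in> ?N. l $ i) < (\<Sum>i\<in>UNIV. l $ i) * dim ?N"
        by (rule stability_in_chamber[OF \<Delta> e(2) l(1) csubspace_kernel dN _ 0]) (use dV dd in simp_all)
      \<comment> \<open>Here \<open>v'\<close> is itself tight for \<open>l\<close>, and the weak
        inequality is enough.\<close>
      have 2: "2 * CARD('d) * (\<Sum>i | v' $ i \<in> ?V. l $ i) \<le> (\<Sum>i\<in>UNIV. l $ i) * dim ?V"
        by (rule subspace_stability[OF tl csubspace_range])
      show False by (rule no_complementary_stability[OF lp cover eq_refl[OF dd] 1 2])
    qed
    moreover have "act l h' e = polygon_of v'"
    proof -
      have "act l h' e $ i = line_projection (v' $ i)" for i
      proof -
        have nz: "(norm (h' *v u $ i))\<^sup>2 \<noteq> 0"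
          using invertible_mult_nz[OF \<open>invertible h'\<close>] tight_frame_nz[OF u(1)] by simp
        have "line_projection (v' $ i) = inverse ((norm (h' *v u $ i))\<^sup>2) *\<^sub>R
            ((norm (h' *v u $ i))\<^sup>2 *\<^sub>R line_projection (v' $ i))" using nz by simp
        also have "\<dots> = act l h' e $ i" unfolding rel
          by (simp add: u(2) act_def polygon_of_def conjugate_line_projection trace_line_projection
              divide_inverse mult.commute del: of_real_power)
        finally show ?thesis by simp
      qed
      then show ?thesis by (simp add: vec_eq_iff polygon_of_def)
    qed
    ultimately show ?thesis using l(1) tl unfolding S_def balancing_def closed_polygons_iff by blast
  qed
  then have "closedin (top_of_set \<Delta>) S"
    unfolding closedin_closed using closure_subset[of S]
    by (intro exI[of _ "closure S"]) (auto simp: S_def)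
  ultimately have "S = \<Delta>" using \<Delta>(1) by (auto simp: connected_clopen)
  then show ?thesis using s by (auto simp: S_def)
qed

subsection \<open>Triviality of the bundle over a chamber\<close>

definition balance :: "real^'n \<Rightarrow> ('d::finite, 'n::finite) polygon \<Rightarrow> ('d, 'n) polygon" where
  "balance r P = act r (THE g. balancer r P g) P"

lemma balance_eq:
  fixes P :: "('d::finite, 'n::finite) polygon"
  assumes "config P" "balancer r P g" "generic TYPE('d) r"
  shows "balance r P = act r g P"
  unfolding balance_def using assms balancer_unique by (metis the_equality)

lemma balance_closed_polygons:
  fixes P :: "('d::finite, 'n::finite) polygon"
  assumes "config P" "balancing r P h" "generic TYPE('d) r"
  shows "balance r P \<in> closed_polygons r"
  using assms balancer_exists balance_eq by (metis balancer_def)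

text \<open>By uniqueness, the implicit solution near a point is the normalised balancer at all
  nearby points of the set, so \<open>act\<close> along it is a smooth local extension of
  \<open>balance\<close>.\<close>

lemma locally_smooth_balance:
  "locally_smooth {(r, P :: ('d::finite, 'n::finite) polygon). (\<forall>i. r $ i > 0) \<and> generic TYPE('d) r \<and>
     config P \<and> (\<exists>h. balancing r P h)} (\<lambda>(r, P). balance r P)"
  (is "locally_smooth ?S _")
  unfolding locally_smooth_def
proof
  fix x :: "(real^'n) \<times> ('d, 'n) polygon" assume "x \<in> ?S"
  then obtain r P h where x: "x = (r, P)" "generic TYPE('d) r" "config P" "balancing r P h" by auto
  obtain g where g: "balancer r P g" using balancer_exists[OF x(3,4)] .
  obtain Y \<gamma> where Y: "open Y" "(r, P) \<in> Y" "smooth_on Y \<gamma>"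
    and dom: "\<And>r P. (r, P) \<in> Y \<Longrightarrow> ((r, P), \<gamma> (r, P)) \<in> defect_domain"
    and bal: "\<And>r P. (r, P) \<in> Y \<Longrightarrow> config P \<Longrightarrow> (\<And>i. r $ i > 0) \<Longrightarrow> balancer r P (\<gamma> (r, P))"
    using balancer_smooth[OF x(3) g x(2)] by metis
  have "smooth_on Y (\<lambda>p. act (fst p) (\<gamma> p) (snd p))"
    by (intro smooth_intros Y) (use dom in auto)
  moreover have "\<forall>y\<in>?S \<inter> Y. act (fst y) (\<gamma> y) (snd y) = (case y of (r, P) \<Rightarrow> balance r P)"
    by (auto simp: balance_eq[OF _ bal, symmetric])
  ultimately show "\<exists>W k. open W \<and> x \<in> W \<and> smooth_on W k \<and> (\<forall>y\<in>?S \<inter> W. k y = (case y of (r, P) \<Rightarrow> balance r P))"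
    using Y x(1) by (intro exI[of _ Y] exI[of _ "\<lambda>p. act (fst p) (\<gamma> p) (snd p)"]) auto
qed

lemma orbit_conjugate:
  assumes "u \<in> unitary_group" shows "orbit (conjugate u e) = orbit e"
proof -
  have c: "conjugate v (conjugate w e) = conjugate (v ** w) e" for v w :: "complex^'a^'a"
    by (simp add: conjugate_def vec_eq_iff[of "vec_lambda _"] adj_mult matrix_mul_assoc)
  have "orbit (conjugate u e) = (\<lambda>v. conjugate (v ** u) e) ` unitary_group" by (simp add: orbit_def c)
  also have "\<dots> = (\<lambda>v. conjugate v e) ` unitary_group"
  proof (intro set_eqI iffI)
    fix y assume "y \<in> (\<lambda>v. conjugate v e) ` unitary_group"
    then obtain v where v: "v \<in> unitary_group" "y = conjugate v e" by blast
    have "v = (v ** adj u) ** u" using assms by (simp add: matrix_mul_assoc[symmetric] unitary_group_def)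
    then show "y \<in> (\<lambda>v. conjugate (v ** u) e) ` unitary_group"
      using v assms by (intro image_eqI[of _ _ "v ** adj u"]) (auto intro: unitary_mult unitary_adj)
  qed (use assms in \<open>auto intro: unitary_mult\<close>)
  finally show ?thesis by (simp add: orbit_def)
qed

lemma orbit_eq_iff: "orbit e = orbit e' \<longleftrightarrow> (\<exists>u\<in>unitary_group. e' = conjugate u e)"
proof
  assume "orbit e = orbit e'"
  moreover have "e' \<in> orbit e'"
    unfolding orbit_def by (rule image_eqI[OF _ unitary_one]) (simp add: conjugate_def vec_eq_iff)
  ultimately show "\<exists>u\<in>unitary_group. e' = conjugate u e" by (auto simp: orbit_def)
qed (auto simp: orbit_conjugate)

text \<open>A matrix balancing a closed polygon to its own lengths is a positive multiple of a
  unitary one, and \<open>act\<close> ignores the multiple.\<close>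

lemma orbit_act:
  fixes e :: "('d::finite, 'n::finite) polygon"
  assumes e: "e \<in> closed_polygons r" and h: "balancing r e h" and g: "generic TYPE('d) r"
  shows "orbit (act r h e) = orbit e"
proof -
  obtain l where l: "l > 0" "adj h ** h = mat (of_real l)"
    using balancing_unique_up_to_unitary[OF e h g] by blast
  let ?u = "inverse (sqrt l) *\<^sub>R h"
  have "adj ?u ** ?u = inverse l *\<^sub>R (adj h ** h)"
    using l(1) by (simp add: scaleR_matrix_mult flip: inverse_mult_distrib)
  then have u: "?u \<in> unitary_group"
    using l by (simp add: unitary_group_iff(1) mat_of_real)
  have "act r h e = conjugate ?u e"
    using act_unitary[OF e u] l(1) by (simp add: act_scaleR)
  then show ?thesis using orbit_conjugate[OF u] by simp
qed

text \<open>The matrix \<open>?m\<close> takes one balanced polygon to the other, hence balances a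
  closed polygon, and \<open>orbit_act\<close> applies. Thus a \<open>GL\<close>-orbit of lines
  determines its balanced polygon up to conjugation.\<close>

lemma orbit_balance_act:
  fixes P :: "('d::finite, 'n::finite) polygon"
  assumes P: "config P" and h: "balancing s P h" and k: "invertible k" and r: "\<And>i. r $ i > 0"
    and g: "generic TYPE('d) s" and P': "config (act r k P)"
  shows "orbit (balance s (act r k P)) = orbit (balance s P)" and "\<exists>h. balancing s (act r k P) h"
proof -
  obtain k' where k': "k' ** k = mat 1" "k ** k' = mat 1" using k by (auto simp: invertible_def)
  have ik': "invertible k'" using k' by (auto simp: invertible_def)
  have ih: "invertible h" and sp: "\<And>i. s $ i > 0" using h closed_polygons_pos by (auto simp: balancing_def)
  have "act s (h ** k') (act r k P) = act s h P"
    using act_act[OF P k r, of s "h ** k'"] k' by (simp add: matrix_mul_assoc[symmetric])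
  then have b: "balancing s (act r k P) (h ** k')"
    using h invertible_mult[OF ih ik'] by (simp add: balancing_def)
  then show "\<exists>h. balancing s (act r k P) h" by blast
  obtain g1 where g1: "balancer s P g1" using balancer_exists[OF P h] .
  obtain g2 where g2: "balancer s (act r k P) g2" using balancer_exists[OF P' b] .
  have i1: "invertible g1" and i2: "invertible g2" using g1 g2 posdef_invertible by (auto simp: balancer_def)
  obtain q where q: "q ** g1 = mat 1" "g1 ** q = mat 1" using i1 by (auto simp: invertible_def)
  have iq: "invertible q" using q by (auto simp: invertible_def)
  let ?m = "g2 ** k ** q"
  have e1: "act s g1 P \<in> closed_polygons s" using g1 by (simp add: balancer_def)
  have "act s ?m (act s g1 P) = act s (g2 ** k) P"
    using act_act[OF P i1 sp, of s ?m] q by (simp add: matrix_mul_assoc[symmetric])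
  also have "\<dots> = act s g2 (act r k P)" using act_act[OF P k r, of s g2] by simp
  finally have m: "act s ?m (act s g1 P) = act s g2 (act r k P)" .
  have "balancing s (act s g1 P) ?m"
    using g2 invertible_mult[OF invertible_mult[OF i2 k] iq]
    by (simp add: balancing_def m balancer_def)
  from orbit_act[OF e1 this g] show "orbit (balance s (act r k P)) = orbit (balance s P)"
    using balance_eq[OF P g1 g] balance_eq[OF P' g2 g] by (simp add: m)
qed

text \<open>The inverse of a positive definite matrix is positive definite, so after adjusting its
  trace it is the normalised balancer for the way back. This is why \<open>balance\<close> is
  inverted exactly and not only up to conjugation.\<close>

lemma balance_balance:
  fixes e :: "('d::finite, 'n::finite) polygon"
  assumes e: "e \<in> closed_polygons r" and h: "balancing s e h"
    and g: "generic TYPE('d) r" "generic TYPE('d) s"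
  shows "balance r (balance s e) = e"
proof -
  have cfg: "config e" using e by (rule config_closed_polygons)
  obtain g1 where g1: "balancer s e g1" using balancer_exists[OF cfg h] .
  have pd: "posdef g1" and e1: "act s g1 e \<in> closed_polygons s" using g1 by (auto simp: balancer_def)
  obtain q where q: "q ** g1 = mat 1" "g1 ** q = mat 1"
    using posdef_invertible[OF pd] by (auto simp: invertible_def)
  have pq: "posdef q" by (rule posdef_inverse[OF pd q(2)])
  define t where "t = CARD('d) / Re (trace q)"
  have t: "t > 0" using posdef_trace_pos[OF pq] by (simp add: t_def)
  have a: "act r (t *\<^sub>R q) (act s g1 e) = e"
    using act_act[OF cfg posdef_invertible[OF pd] closed_polygons_pos[OF e1], of r q] t act_one[OF e]
    by (simp add: act_scaleR q)
  then have "balancer r (act s g1 e) (t *\<^sub>R q)"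
    using e posdef_scaleR[OF pq t] posdef_trace_pos[OF pq] by (simp add: balancer_def trace_scaleR t_def)
  from balance_eq[OF config_closed_polygons[OF e1] this g(1)] show ?thesis
    by (simp add: a balance_eq[OF cfg g1 g(2)])
qed

context
  fixes \<Delta> :: "(real^'n::finite) set"
  assumes \<Delta>: "\<Delta> \<in> chambers TYPE('d::finite)"
begin

lemma chamber:
  "connected \<Delta>" "r \<in> \<Delta> \<Longrightarrow> generic TYPE('d) r" "r \<in> \<Delta> \<Longrightarrow> r $ i > 0"
proof -
  show "connected \<Delta>" using \<Delta> unfolding chambers_def by (rule in_components_connected)
qed (use chamber_facts[of \<Delta>] \<Delta> in auto)

lemma balancing_in_chamber:
  "e \<in> closed_polygons r \<Longrightarrow> r \<in> \<Delta> \<Longrightarrow> s \<in> \<Delta> \<Longrightarrow> \<exists>h. balancing s (e :: ('d, 'n) polygon) h"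
  using balancing_exists[of \<Delta>] chamber by blast

lemma balance_in_chamber:
  assumes "e \<in> closed_polygons r" "r \<in> \<Delta>" "s \<in> \<Delta>"
  shows "balance s (e :: ('d, 'n) polygon) \<in> closed_polygons s" "balance r (balance s e) = e"
  using balancing_in_chamber[OF assms] balance_closed_polygons[OF config_closed_polygons[OF assms(1)]]
    balance_balance[OF assms(1)] chamber(2) assms by blast+

lemma locally_smooth_balance_chamber:
  fixes \<rho> :: "'a::euclidean_space \<Rightarrow> real^'n" and f :: "'a \<Rightarrow> ('d, 'n) polygon"
  assumes "locally_smooth A \<rho>" "locally_smooth A f"
    and "\<And>x. x \<in> A \<Longrightarrow> \<rho> x \<in> \<Delta> \<and> (\<exists>r\<in>\<Delta>. f x \<in> closed_polygons r)"
  shows "locally_smooth A (\<lambda>x. balance (\<rho> x) (f x))"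
proof -
  have "locally_smooth A (\<lambda>x. case (\<rho> x, f x) of (r, P) \<Rightarrow> balance r P)"
    by (rule locally_smooth_compose[OF locally_smooth_Pair[OF assms(1,2)] locally_smooth_balance])
      (use assms(3) chamber(2,3) balancing_in_chamber config_closed_polygons in blast)
  then show ?thesis by simp
qed

lemma side_lengths_closed_polygons: "e \<in> closed_polygons r \<Longrightarrow> side_lengths e = r"
  by (simp add: closed_polygons_def)

lemma trivial_bundle_over_chamber:
  "trivial_fiber_bundle {e \<in> (CPol :: ('d, 'n) polygon set). side_lengths e \<in> \<Delta>} \<Delta> side_lengths"
proof -
  let ?E = "{e \<in> (CPol :: ('d, 'n) polygon set). side_lengths e \<in> \<Delta>}"
  have E: "e \<in> closed_polygons (side_lengths e) \<and> side_lengths e \<in> \<Delta>" if "e \<in> ?E" for e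
    using that by (simp add: closed_polygons_def)
  have E': "e \<in> ?E" if "e \<in> closed_polygons r" "r \<in> \<Delta>" for e r
    using that by (simp add: closed_polygons_def)
  obtain r0 where r0: "r0 \<in> \<Delta>" using \<Delta> in_components_nonempty unfolding chambers_def by blast
  let ?F = "closed_polygons r0 :: ('d, 'n) polygon set"
  let ?h = "\<lambda>e :: ('d, 'n) polygon. (side_lengths e, balance r0 e)"
  let ?k = "\<lambda>(r, f). balance r f"
  \<comment> \<open>On polygons the description in \<open>side_lengths\<close> agrees with the
    traces, which are linear in \<open>e\<close>.\<close>
  have "smooth_on UNIV (\<lambda>e :: ('d, 'n) polygon. \<chi> i. Re (trace (e $ i)))"
    by (intro smooth_intros) auto
  then have "locally_smooth ?E (\<lambda>e. \<chi> i. Re (trace (e $ i)))"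
    by (rule smooth_on_imp_locally_smooth[rotated]) auto
  moreover have "side_lengths e = (\<chi> i. Re (trace (e $ i)))" if "e \<in> ?E" for e
    using trace_closed_polygons[of e "side_lengths e"] E[OF that] by (simp add: vec_eq_iff)
  ultimately have ls: "locally_smooth ?E side_lengths"
    using locally_smooth_cong[of ?E side_lengths "\<lambda>e. \<chi> i. Re (trace (e $ i))"] by blast
  have 1: "smooth_map (eucl_space ?E) (eucl_space \<Delta>) side_lengths"
    by (rule smooth_map_eucl_space[OF ls]) auto
  have 2: "smooth_map (eucl_space ?E) (eucl_space (\<Delta> \<times> ?F)) ?h"
  proof (rule smooth_map_eucl_space)
    show "locally_smooth ?E ?h"
      by (intro locally_smooth_Pair ls locally_smooth_balance_chamber locally_smooth_const locally_smooth_ident) (use E r0 in blast)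
  qed (use balance_in_chamber E r0 in blast)
  have 3: "smooth_map (eucl_space (\<Delta> \<times> ?F)) (eucl_space ?E) ?k"
  proof (rule smooth_map_eucl_space)
    have "locally_smooth (\<Delta> \<times> ?F) (\<lambda>p. balance (fst p) (snd p))"
      by (intro locally_smooth_balance_chamber
          locally_smooth_bounded_linear[OF bounded_linear_fst] locally_smooth_bounded_linear[OF bounded_linear_snd]) (use r0 in auto)
    then show "locally_smooth (\<Delta> \<times> ?F) ?k" by (simp add: case_prod_unfold)
    show "?k x \<in> ?E" if p: "x \<in> \<Delta> \<times> ?F" for x
    proof -
      obtain r f where x: "x = (r, f)" "r \<in> \<Delta>" "f \<in> ?F" using p by blast
      show ?thesis unfolding x(1) prod.case by (rule E'[OF balance_in_chamber(1)[OF x(3) r0 x(2)] x(2)])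
    qed
  qed
  have 4: "?k (?h e) = e" if "e \<in> ?E" for e
    unfolding prod.case using E[OF that] by (intro balance_in_chamber(2) r0) blast+
  have 5: "?h (?k x) = x" if p: "x \<in> \<Delta> \<times> ?F" for x
  proof -
    obtain r f where x: "x = (r, f)" "r \<in> \<Delta>" "f \<in> ?F" using p by blast
    show ?thesis
      unfolding x(1) prod.case balance_in_chamber(2)[OF x(3) r0 x(2)]
        side_lengths_closed_polygons[OF balance_in_chamber(1)[OF x(3) r0 x(2)]] ..
  qed
  have "diffeomorphism (eucl_space ?E) (eucl_space (\<Delta> \<times> ?F)) ?h"
    unfolding diffeomorphism_def stop_eucl_space topspace_euclidean_subtopology using 2 3 4 5 by blast
  moreover have "\<forall>e\<in>?E. fst (?h e) = side_lengths e" by simp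
  ultimately show ?thesis unfolding trivial_fiber_bundle_def using 1 by blast
qed

lemma orbit_balance_cong:
  fixes e e' :: "('d, 'n) polygon"
  assumes r: "r \<in> \<Delta>" and s: "s \<in> \<Delta>"
    and e: "e \<in> closed_polygons r" "e' \<in> closed_polygons r" "orbit e = orbit e'"
  shows "orbit (balance s e') = orbit (balance s e)"
proof -
  obtain u where u: "u \<in> unitary_group" "e' = conjugate u e" using e(3) unfolding orbit_eq_iff by blast
  then have a: "e' = act r u e" using act_unitary[OF e(1)] by simp
  have i: "invertible u" using u(1) by (auto simp: invertible_def unitary_group_def)
  obtain h where h: "balancing s e h" using balancing_in_chamber[OF e(1) r s] by blast
  have "config (act r u e)" using config_closed_polygons[OF e(2)] a by simp
  from orbit_balance_act(1)[OF config_closed_polygons[OF e(1)] h i chamber(3)[OF r] chamber(2)[OF s] this]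
  show ?thesis by (simp add: a)
qed

lemma moduli_map:
  assumes r: "r \<in> \<Delta>" and s: "s \<in> \<Delta>"
  obtains \<phi> where "smooth_map (moduli_space r :: ('d, 'n) polygon set smooth_space) (moduli_space s) \<phi>"
    "\<And>e :: ('d, 'n) polygon. e \<in> closed_polygons r \<Longrightarrow> \<phi> (orbit e) = orbit (balance s e)"
proof -
  define \<phi> where "\<phi> = (\<lambda>X :: ('d, 'n) polygon set. orbit (balance s (SOME e. e \<in> closed_polygons r \<and> orbit e = X)))"
  have \<phi>: "\<phi> (orbit e) = orbit (balance s e)" if e: "e \<in> closed_polygons r" for e
  proof -
    have e': "(SOME e'. e' \<in> closed_polygons r \<and> orbit e' = orbit e) \<in> closed_polygons r \<and>
        orbit (SOME e'. e' \<in> closed_polygons r \<and> orbit e' = orbit e) = orbit e"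
      by (rule someI[of _ e]) (use e in auto)
    show ?thesis
      unfolding \<phi>_def by (rule orbit_balance_cong[OF r s e conjunct1[OF e'] conjunct2[OF e', symmetric]])
  qed
  have "smooth_map (eucl_space (closed_polygons r)) (eucl_space (closed_polygons s)) (balance s :: ('d, 'n) polygon \<Rightarrow> _)"
  proof (rule smooth_map_eucl_space)
    show "locally_smooth (closed_polygons r) (balance s :: ('d, 'n) polygon \<Rightarrow> _)"
      by (intro locally_smooth_balance_chamber[where \<rho> = "\<lambda>_. s" and f = "\<lambda>e. e"] locally_smooth_const
          locally_smooth_ident) (use r s in auto)
  qed (use balance_in_chamber r s in blast)
  then have "smooth_map (moduli_space r :: ('d, 'n) polygon set smooth_space) (moduli_space s) \<phi>"
    unfolding moduli_space_def by (rule smooth_map_quotient) (rule \<phi>)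
  with \<phi> that show thesis by blast
qed

lemma moduli_spaces_diffeomorphic:
  assumes r: "r \<in> \<Delta>" and s: "s \<in> \<Delta>"
  shows "\<exists>\<phi>. diffeomorphism (moduli_space r :: ('d, 'n) polygon set smooth_space)
    (moduli_space s :: ('d, 'n) polygon set smooth_space) \<phi>"
proof -
  obtain \<phi> where \<phi>: "smooth_map (moduli_space r :: ('d, 'n) polygon set smooth_space) (moduli_space s) \<phi>"
    "\<And>e :: ('d, 'n) polygon. e \<in> closed_polygons r \<Longrightarrow> \<phi> (orbit e) = orbit (balance s e)"
    using moduli_map[OF r s] by blast
  obtain \<psi> where \<psi>: "smooth_map (moduli_space s :: ('d, 'n) polygon set smooth_space) (moduli_space r) \<psi>"
    "\<And>e :: ('d, 'n) polygon. e \<in> closed_polygons s \<Longrightarrow> \<psi> (orbit e) = orbit (balance r e)"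
    using moduli_map[OF s r] by blast
  show ?thesis
    unfolding diffeomorphism_def topspace_moduli_space
    using \<phi> \<psi> balance_in_chamber[OF _ r s] balance_in_chamber[OF _ s r]
    by (intro exI[of _ \<phi>] exI[of _ \<psi>]) auto
qed

end

subsection \<open>Topology of the moduli spaces\<close>

lemma continuous_on_conjugate:
  assumes "continuous_on S f" "continuous_on S g"
  shows "continuous_on S (\<lambda>x. conjugate (f x) (g x :: ('d::finite, 'n::finite) polygon))"
  unfolding conjugate_def
  by (intro continuous_intros continuous_on_matrix_mult continuous_on_adj assms)

text \<open>The saturation of a relatively open set is cut out by the union of its translates under
  the group.\<close>

lemma openin_orbit_image:
  assumes "openin (top_of_set (closed_polygons r)) (U :: ('d::finite, 'n::finite) polygon set)"
  shows "openin (stop (moduli_space r)) (orbit ` U)"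
proof -
  obtain T where T: "open T" "U = closed_polygons r \<inter> T" using assms by (auto simp: openin_open)
  let ?T = "\<Union>u\<in>unitary_group. conjugate u -` T"
  have "open (conjugate u -` T)" for u :: "complex^'d^'d"
    by (rule open_vimage[OF T(1)]) (intro continuous_on_conjugate continuous_intros)
  then have "open ?T" by blast
  moreover have "{x \<in> closed_polygons r. orbit x \<in> orbit ` U} = closed_polygons r \<inter> ?T"
  proof (intro set_eqI iffI)
    fix x assume "x \<in> {x \<in> closed_polygons r. orbit x \<in> orbit ` U}"
    then show "x \<in> closed_polygons r \<inter> ?T" using orbit_eq_iff[of x] by (force simp: T(2))
  next
    fix x assume "x \<in> closed_polygons r \<inter> ?T"
    then obtain u where u: "x \<in> closed_polygons r" "u \<in> unitary_group" "conjugate u x \<in> T" by blast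
    then have "conjugate u x \<in> U" using conjugate_closed_polygons T(2) by blast
    moreover have "orbit x = orbit (conjugate u x)" by (rule orbit_conjugate[OF u(2), symmetric])
    ultimately show "x \<in> {x \<in> closed_polygons r. orbit x \<in> orbit ` U}" using u(1) by blast
  qed
  ultimately have "openin (top_of_set (closed_polygons r)) {x \<in> closed_polygons r. orbit x \<in> orbit ` U}"
    by (simp add: openin_open_Int)
  then show ?thesis
    using T(2) by (auto simp: moduli_space_def openin_quotient_topology)
qed

lemma second_countable_moduli_space:
  "second_countable (stop (moduli_space r :: ('d::finite, 'n::finite) polygon set smooth_space))"
proof (rule second_countable_open_map_image)
  show "continuous_map (top_of_set (closed_polygons r)) (stop (moduli_space r :: ('d, 'n) polygon set smooth_space)) orbit"
    using continuous_map_quotient_topology by (simp add: moduli_space_def)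
  show "open_map (top_of_set (closed_polygons r)) (stop (moduli_space r :: ('d, 'n) polygon set smooth_space)) orbit"
    using openin_orbit_image by (auto simp: open_map_def)
  show "orbit ` topspace (top_of_set (closed_polygons r)) = topspace (stop (moduli_space r :: ('d, 'n) polygon set smooth_space))"
    by (simp add: topspace_moduli_space)
  have "second_countable (euclidean :: ('d, 'n) polygon topology)"
  proof -
    obtain B :: "('d, 'n) polygon set set" where "countable B" "topological_basis B"
      using ex_countable_basis by blast
    moreover from this have "\<exists>V\<in>B. x \<in> V \<and> V \<subseteq> U" if "open U" "x \<in> U" for U x
      using that by (meson topological_basisE)
    moreover have "\<forall>V\<in>B. open V" using \<open>topological_basis B\<close> topological_basis_open by blast
    ultimately show ?thesis unfolding second_countable_def open_openin[symmetric] by blast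
  qed
  then show "second_countable (top_of_set (closed_polygons r :: ('d, 'n) polygon set))"
    by (rule second_countable_subtopology)
qed

text \<open>The orbit relation is a projection of a closed set along the compact group, hence
  closed; as the quotient map is open, product neighbourhoods in its complement separate
  orbits.\<close>

lemma Hausdorff_moduli_space:
  "Hausdorff_space (stop (moduli_space r :: ('d::finite, 'n::finite) polygon set smooth_space))"
  unfolding Hausdorff_space_def topspace_moduli_space
proof (intro allI impI)
  fix X Y :: "('d, 'n) polygon set"
  assume "X \<in> orbit ` closed_polygons r \<and> Y \<in> orbit ` closed_polygons r \<and> X \<noteq> Y"
  then obtain x y where xy: "x \<in> closed_polygons r" "X = orbit x" "y \<in> closed_polygons r" "Y = orbit y"
    "orbit x \<noteq> orbit y" by blast
  let ?T = "{p :: (complex^'d^'d) \<times> (('d, 'n) polygon \<times> ('d, 'n) polygon).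
      snd (snd p) = conjugate (fst p) (fst (snd p))}"
  have "closed ?T" by (intro closed_Collect_eq continuous_on_conjugate continuous_intros)
  define S where "S = - {q :: ('d, 'n) polygon \<times> ('d, 'n) polygon. \<exists>u. u \<in> unitary_group \<and> (u, q) \<in> ?T}"
  have "open S"
    using closed_compact_projection[OF compact_unitary_group \<open>closed ?T\<close>] by (simp add: S_def open_closed)
  moreover have "(x, y) \<in> S" using xy(5) orbit_eq_iff[of x y] by (auto simp: S_def)
  ultimately obtain A B where AB: "open A" "open B" "(x, y) \<in> A \<times> B" "A \<times> B \<subseteq> S"
    by (rule open_prod_elim)
  let ?U = "orbit ` (closed_polygons r \<inter> A)" and ?V = "orbit ` (closed_polygons r \<inter> B)"
  have "openin (stop (moduli_space r)) ?U" "openin (stop (moduli_space r)) ?V"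
    using AB(1,2) by (auto intro!: openin_orbit_image openin_open_Int)
  moreover have "disjnt ?U ?V"
  proof -
    have "orbit a \<noteq> orbit b" if "a \<in> A" "b \<in> B" for a b
    proof
      assume "orbit a = orbit b"
      then obtain u where "u \<in> unitary_group" "b = conjugate u a" using orbit_eq_iff[of a b] by blast
      moreover have "(a, b) \<in> S" using AB(4) that by blast
      ultimately show False by (auto simp: S_def)
    qed
    then show ?thesis by (auto simp: disjnt_def)
  qed
  ultimately show "\<exists>U V. openin (stop (moduli_space r)) U \<and> openin (stop (moduli_space r)) V \<and> X \<in> U \<and> Y \<in> V \<and> disjnt U V"
    using xy AB(3) by blast
qed

subsection \<open>Normal forms of configurations\<close>

text \<open>Coordinates with respect to the basis \<open>w $ \<beta> b\<close> (junk if the determinant vanishes), written by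
  Cramer's rule, which makes their smoothness evident.\<close>

definition frame_matrix :: "('d::finite \<Rightarrow> 'n) \<Rightarrow> (complex^'d)^'n \<Rightarrow> complex^'d^'d" where
  "frame_matrix \<beta> w = (\<chi> a b. w $ \<beta> b $ a)"

definition coords :: "('d::finite \<Rightarrow> 'n) \<Rightarrow> (complex^'d)^'n::finite \<Rightarrow> (complex^'d)^'n" where
  "coords \<beta> w = (\<chi> i b. det (\<chi> a c. if c = b then w $ i $ a else frame_matrix \<beta> w $ a $ c) / det (frame_matrix \<beta> w))"

lemma frame_matrix_mult: "frame_matrix \<beta> w *v y = (\<Sum>b\<in>UNIV. y $ b *s w $ \<beta> b)"
  by (simp add: frame_matrix_def matrix_vector_mult_def vec_eq_iff mult.commute)

lemma coords_iff:
  assumes "det (frame_matrix \<beta> w) \<noteq> 0"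
  shows "frame_matrix \<beta> w *v y = w $ i \<longleftrightarrow> y = coords \<beta> w $ i"
  using cramer[OF assms, of y "w $ i"] by (simp add: coords_def)

lemma coords_basis:
  assumes "det (frame_matrix \<beta> w) \<noteq> 0"
  shows "coords \<beta> w $ \<beta> b = axis b 1"
proof -
  have "frame_matrix \<beta> w *v axis b 1 = w $ \<beta> b"
    by (simp add: frame_matrix_mult axis_def vec_eq_iff if_distrib if_distribR cong: if_cong)
  then show ?thesis using coords_iff[OF assms] by metis
qed

text \<open>Equality of two configurations of lines up to a linear map; the scalars
  \<open>\<tau>\<close> absorb the choice of vectors in the lines.\<close>

definition equivalent :: "(complex^'d::finite)^'n \<Rightarrow> (complex^'d)^'n \<Rightarrow> bool" where
  "equivalent w w' \<longleftrightarrow> (\<exists>k \<tau>. invertible k \<and> (\<forall>i. \<tau> i \<noteq> 0) \<and> (\<forall>i. w' $ i = \<tau> i *s (k *v w $ i)))"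

lemma equivalentI:
  "invertible k \<Longrightarrow> (\<And>i. \<tau> i \<noteq> 0) \<Longrightarrow> (\<And>i. w' $ i = \<tau> i *s (k *v w $ i)) \<Longrightarrow> equivalent w w'"
  unfolding equivalent_def by blast

text \<open>The linear map cancels from coordinates with respect to the moved basis. What is left of
  equivalence is a torus acting on rows and columns, which the spanning tree will normalise
  away.\<close>

lemma coords_equivalent:
  assumes nz: "det (frame_matrix \<beta> w) \<noteq> 0" and k: "invertible k" and \<tau>: "\<And>i. \<tau> i \<noteq> 0"
    and w': "\<And>i. w' $ i = \<tau> i *s (k *v w $ i)"
  shows "det (frame_matrix \<beta> w') \<noteq> 0"
    and "coords \<beta> w' $ i $ b = coords \<beta> w $ i $ b * \<tau> i / \<tau> (\<beta> b)"
proof -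
  have fm: "frame_matrix \<beta> w' *v y = k *v (frame_matrix \<beta> w *v (\<chi> b. y $ b * \<tau> (\<beta> b)))" for y
    unfolding frame_matrix_mult w'
    by (simp add: linear_sum[OF linear_matrix_vector_mult_complex] matrix_vector_mult_complex_simps)
  have "invertible (frame_matrix \<beta> w)" using nz by (simp add: invertible_det_nz)
  have "y = 0" if "frame_matrix \<beta> w' *v y = 0" for y
  proof -
    have "(\<chi> b. y $ b * \<tau> (\<beta> b)) = 0"
      using that invertible_mult_nz[OF k] invertible_mult_nz[OF \<open>invertible (frame_matrix \<beta> w)\<close>]
      unfolding fm by blast
    then show ?thesis using \<tau> by (simp add: vec_eq_iff)
  qed
  then have "invertible (frame_matrix \<beta> w')"
    using matrix_left_invertible_ker[of "frame_matrix \<beta> w'"] invertible_left_inverse by blast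
  then show nz': "det (frame_matrix \<beta> w') \<noteq> 0" by (simp add: invertible_det_nz)
  have "(\<chi> b. coords \<beta> w $ i $ b * \<tau> i / \<tau> (\<beta> b) * \<tau> (\<beta> b)) = \<tau> i *s coords \<beta> w $ i"
    using \<tau> by (simp add: vec_eq_iff)
  then have "frame_matrix \<beta> w' *v (\<chi> b. coords \<beta> w $ i $ b * \<tau> i / \<tau> (\<beta> b)) =
      \<tau> i *s (k *v (frame_matrix \<beta> w *v coords \<beta> w $ i))"
    unfolding fm by (simp add: matrix_vector_mult_complex_simps)
  also have "frame_matrix \<beta> w *v coords \<beta> w $ i = w $ i" using coords_iff[OF nz] by blast
  finally have "(\<chi> b. coords \<beta> w $ i $ b * \<tau> i / \<tau> (\<beta> b)) = coords \<beta> w' $ i"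
    using coords_iff[OF nz'] w' by simp
  then show "coords \<beta> w' $ i $ b = coords \<beta> w $ i $ b * \<tau> i / \<tau> (\<beta> b)"
    by (metis vec_lambda_beta)
qed

text \<open>A rooted tree on the indices. Every edge joins an index in the range of \<open>\<beta>\<close> to an index
  outside of it, and so it corresponds to an entry of the coordinate matrix.\<close>

locale gauge_tree =
  fixes \<beta> :: "'d::finite \<Rightarrow> 'n::finite" and root :: 'n and parent :: "'n \<Rightarrow> 'n" and rank :: "'n \<Rightarrow> nat"
  assumes \<beta>: "inj \<beta>"
    and rank_root: "rank root = 0"
    and rank_parent: "v \<noteq> root \<Longrightarrow> rank v = Suc (rank (parent v))"
    and bipartite: "v \<noteq> root \<Longrightarrow> v \<in> range \<beta> \<longleftrightarrow> parent v \<notin> range \<beta>"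
begin

text \<open>The matrix entry of the edge from \<open>v\<close> to its parent: its row is the
  endpoint outside the basis, its column the one inside.\<close>

definition edge :: "'n \<Rightarrow> 'n \<times> 'd" where
  "edge v = (if v \<in> range \<beta> then (parent v, inv \<beta> v) else (v, inv \<beta> (parent v)))"

definition tree :: "('n \<times> 'd) set" where "tree = edge ` (- {root})"

text \<open>The parameters of a chart: rows of basis vectors are unit vectors, and entries on the
  tree are scaled to one.\<close>

definition free :: "('n \<times> 'd) set" where "free = {(i, b). i \<notin> range \<beta>} - tree"

lemma fst_edge: "v \<noteq> root \<Longrightarrow> fst (edge v) \<notin> range \<beta>"
  using bipartite[of v] by (auto simp: edge_def)

lemma inj_edge: "inj_on edge (- {root})"
proof (rule inj_onI)
  fix v v' assume v: "v \<in> - {root}" "v' \<in> - {root}" "edge v = edge v'"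
  \<comment> \<open>Sharing an entry with swapped roles would make each of two vertices the parent
    of the other, which the ranks exclude.\<close>
  have *: False if "x \<noteq> root" "y \<noteq> root" "edge x = edge y" "x \<in> range \<beta>" "y \<notin> range \<beta>" for x y
  proof -
    have y: "parent y \<in> range \<beta>" using bipartite[of y] that by blast
    have e: "parent x = y" "inv \<beta> x = inv \<beta> (parent y)"
      using that(3) unfolding edge_def if_P[OF that(4)] if_not_P[OF that(5)] by simp_all
    have "x = \<beta> (inv \<beta> x)" by (rule f_inv_into_f[OF that(4), symmetric])
    also have "\<dots> = parent y" unfolding e(2) by (rule f_inv_into_f[OF y])
    finally have x: "x = parent y" .
    have "rank x = Suc (rank y)" using rank_parent[OF that(1)] unfolding e(1) .
    moreover have "rank y = Suc (rank x)" using rank_parent[OF that(2)] unfolding x[symmetric] .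
    ultimately show False by simp
  qed
  show "v = v'"
  proof (cases "v \<in> range \<beta>")
    case True
    have v': "v' \<in> range \<beta>" using *[OF _ _ v(3) True] v(1,2) by blast
    have "inv \<beta> v = inv \<beta> v'" using v(3) unfolding edge_def if_P[OF True] if_P[OF v'] by simp
    then have "\<beta> (inv \<beta> v) = \<beta> (inv \<beta> v')" by (rule arg_cong)
    then show ?thesis unfolding f_inv_into_f[OF True] f_inv_into_f[OF v'] .
  next
    case False
    have v': "v' \<notin> range \<beta>" using *[OF _ _ v(3)[symmetric] _ False] v(1,2) by blast
    show ?thesis using v(3) unfolding edge_def if_not_P[OF False] if_not_P[OF v'] by simp
  qed
qed

text \<open>For \<open>n = CARD('n)\<close> and \<open>d = CARD('d)\<close> this is the expected
  complex dimension \<open>n * (d - 1) - (d * d - 1)\<close> of the moduli space. It does not depend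
  on the basis or the tree, so all charts can share one model.\<close>

lemma card_free: "card free = (CARD('n) - CARD('d)) * CARD('d) - (CARD('n) - 1)"
proof -
  have sub: "tree \<subseteq> (- range \<beta>) \<times> UNIV"
  proof
    fix p assume "p \<in> tree"
    then obtain v where "v \<noteq> root" "p = edge v" by (auto simp: tree_def)
    then show "p \<in> (- range \<beta>) \<times> UNIV" using fst_edge[of v] by (simp add: mem_Times_iff)
  qed
  have "card tree = CARD('n) - 1"
    unfolding tree_def using inj_edge by (simp add: card_image Compl_eq_Diff_UNIV card_Diff_subset)
  moreover have "card (range \<beta>) = CARD('d)" using \<beta> by (rule card_image)
  then have "card ((- range \<beta>) \<times> (UNIV :: 'd set)) = (CARD('n) - CARD('d)) * CARD('d)"
    by (simp add: card_cartesian_product Compl_eq_Diff_UNIV card_Diff_subset)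
  moreover have "{(i, b :: 'd). i \<notin> range \<beta>} = (- range \<beta>) \<times> UNIV" by auto
  ultimately show ?thesis
    unfolding free_def using card_Diff_subset[OF finite_subset[OF sub] sub] by simp
qed

text \<open>The torus element that scales the tree entries to one, computed along the path to the
  root. The recursion runs over the number of steps and is meant to be used with
  \<open>k = rank v\<close>.\<close>

primrec factor_upto :: "(complex^'d)^'n \<Rightarrow> nat \<Rightarrow> 'n \<Rightarrow> complex" where
  "factor_upto A 0 v = 1"
| "factor_upto A (Suc k) v = factor_upto A k (parent v) *
     (if v \<in> range \<beta> then A $ fst (edge v) $ snd (edge v) else inverse (A $ fst (edge v) $ snd (edge v)))"

definition factor :: "(complex^'d)^'n \<Rightarrow> 'n \<Rightarrow> complex" where
  "factor A v = factor_upto A (rank v) v"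

lemma factor_root: "factor A root = 1"
  by (simp add: factor_def rank_root)

lemma factor_step:
  "v \<noteq> root \<Longrightarrow> factor A v = factor A (parent v) *
     (if v \<in> range \<beta> then A $ fst (edge v) $ snd (edge v) else inverse (A $ fst (edge v) $ snd (edge v)))"
  by (simp add: factor_def rank_parent)

lemma rank_induct [case_names root step]:
  assumes "P root" "\<And>v. v \<noteq> root \<Longrightarrow> P (parent v) \<Longrightarrow> P v"
  shows "P v"
proof (induction "rank v" arbitrary: v rule: less_induct)
  case less
  show ?case
    by (cases "v = root") (use assms less rank_parent[of v] in auto)
qed

definition admissible :: "(complex^'d)^'n \<Rightarrow> bool" where
  "admissible A \<longleftrightarrow> (\<forall>v. v \<noteq> root \<longrightarrow> A $ fst (edge v) $ snd (edge v) \<noteq> 0)"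

lemma factor_nz: "admissible A \<Longrightarrow> factor A v \<noteq> 0"
  by (induction v rule: rank_induct) (auto simp: factor_root factor_step admissible_def)

definition normalise :: "(complex^'d)^'n \<Rightarrow> (complex^'d)^'n" where
  "normalise A = (\<chi> i b. A $ i $ b * factor A i / factor A (\<beta> b))"

lemma normalise_edge:
  assumes "admissible A" "v \<noteq> root"
  shows "normalise A $ fst (edge v) $ snd (edge v) = 1"
proof (cases "v \<in> range \<beta>")
  case True
  then have "\<beta> (inv \<beta> v) = v" by (simp add: f_inv_into_f)
  then show ?thesis
    using assms True factor_nz[OF assms(1), of "parent v"] factor_step[OF assms(2), of A]
    by (auto simp: normalise_def edge_def admissible_def)
next
  case False
  then have "\<beta> (inv \<beta> (parent v)) = parent v" using bipartite[OF assms(2)] by (simp add: f_inv_into_f)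
  then show ?thesis
    using assms False factor_nz[OF assms(1), of "parent v"] factor_step[OF assms(2), of A]
    by (auto simp: normalise_def edge_def admissible_def field_simps)
qed

lemma normalise_basis:
  assumes "admissible A" "\<And>b. A $ \<beta> b = axis b 1"
  shows "normalise A $ \<beta> b = axis b 1"
  using factor_nz[OF assms(1)] by (simp add: normalise_def vec_eq_iff assms(2) axis_def)

lemma normalise_normalised:
  assumes "\<And>v. v \<noteq> root \<Longrightarrow> A $ fst (edge v) $ snd (edge v) = 1"
  shows "normalise A = A"
proof -
  have "factor A v = 1" for v
    by (induction v rule: rank_induct) (auto simp: factor_root factor_step assms)
  then show ?thesis by (simp add: normalise_def vec_eq_iff)
qed

text \<open>By induction along the tree the factors of \<open>A'\<close> are those of
  \<open>A\<close> times \<open>\<tau> root / \<tau> v\<close>, which cancels the change of the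
  entries.\<close>

lemma normalise_equivalent:
  assumes A: "admissible A" and \<tau>: "\<And>i. \<tau> i \<noteq> 0"
    and A': "\<And>i b. A' $ i $ b = A $ i $ b * \<tau> i / \<tau> (\<beta> b)"
  shows "admissible A'" "normalise A' = normalise A"
proof -
  show "admissible A'" using A \<tau> by (simp add: admissible_def A')
  have f: "factor A' v = factor A v * \<tau> root / \<tau> v" for v
  proof (induction v rule: rank_induct)
    case (step v)
    show ?case
    proof (cases "v \<in> range \<beta>")
      case True
      then have "\<beta> (inv \<beta> v) = v" by (simp add: f_inv_into_f)
      then show ?thesis using step True \<tau> by (simp add: factor_step A' edge_def)
    next
      case False
      then have "\<beta> (inv \<beta> (parent v)) = parent v" using bipartite[OF step(1)] by (simp add: f_inv_into_f)
      then show ?thesis using step False \<tau> A by (simp add: factor_step A' edge_def divide_simps)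
    qed
  qed (use \<tau> in \<open>simp add: factor_root\<close>)
  have "factor A (\<beta> b) \<noteq> 0" for b using factor_nz[OF A] .
  then show "normalise A' = normalise A"
    using \<tau> by (simp add: normalise_def vec_eq_iff f A' divide_simps)
qed

lemma smooth_on_factor:
  fixes A :: "'z::euclidean_space \<Rightarrow> (complex^'d)^'n"
  assumes "open U" "smooth_on U A" "\<And>x. x \<in> U \<Longrightarrow> admissible (A x)"
  shows "smooth_on U (\<lambda>x. factor (A x) v)"
proof (induction v rule: rank_induct)
  case root
  then show ?case using assms(1) by (simp add: factor_root smooth_on_const)
next
  case (step v)
  have "smooth_on U (\<lambda>x. if v \<in> range \<beta> then A x $ fst (edge v) $ snd (edge v)
      else inverse (A x $ fst (edge v) $ snd (edge v)))"
  proof (cases "v \<in> range \<beta>")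
    case True
    then show ?thesis using assms by (simp add: smooth_on_vec_nth)
  next
    case False
    moreover have "smooth_on U (\<lambda>x. inverse (A x $ fst (edge v) $ snd (edge v)))"
      using assms step(1) by (intro smooth_intros) (auto simp: admissible_def)
    ultimately show ?thesis by simp
  qed
  then show ?case using step by (simp only: factor_step[OF step(1)]) (intro smooth_intros assms)
qed

lemma smooth_on_normalise:
  fixes A :: "'z::euclidean_space \<Rightarrow> (complex^'d)^'n"
  assumes "open U" "smooth_on U A" "\<And>x. x \<in> U \<Longrightarrow> admissible (A x)"
  shows "smooth_on U (\<lambda>x. normalise (A x))"
  unfolding normalise_def
  by (intro smooth_intros smooth_on_factor assms factor_nz) auto

end

section \<open>Bases and spanning trees of a tight frame\<close>

lemma tight_frame_has_basis:
  fixes w :: "(complex^'d::finite)^'n::finite"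
  assumes t: "tight_frame r w"
  obtains \<beta> :: "'d \<Rightarrow> 'n" where "inj \<beta>" "det (frame_matrix \<beta> w) \<noteq> 0"
proof -
  let ?c = "(\<Sum>i\<in>UNIV. r $ i) / CARD('d)"
  have c: "?c \<noteq> 0" using tight_frame_sum_pos[OF t] by simp
  have span: "x \<in> vec.span (range (($) w))" for x
  proof -
    have "(\<Sum>i\<in>UNIV. hinner (w $ i) x *s w $ i) \<in> vec.span (range (($) w))"
      by (intro vec.span_sum vec.span_scale vec.span_base) simp
    then have "inverse (complex_of_real ?c) *s (?c *\<^sub>R x) \<in> vec.span (range (($) w))"
      unfolding tight_frame_hinner(1)[OF t] by (rule vec.span_scale)
    moreover have "inverse (complex_of_real ?c) *s (?c *\<^sub>R x) = x"
    proof -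
      have "inverse (complex_of_real ?c) * complex_of_real ?c = 1" using c by (simp only: left_inverse of_real_eq_0_iff not_False_eq_True)
      then show ?thesis
        by (simp add: vec_eq_iff scaleR_conv_of_real[where 'a = complex] mult.assoc[symmetric] del: of_real_divide of_real_sum)
    qed
    ultimately show ?thesis by simp
  qed
  obtain B where B: "B \<subseteq> range (($) w)" "vec.independent B" "range (($) w) \<subseteq> vec.span B"
    using vec.maximal_independent_subset by blast
  have sB: "vec.span B = UNIV"
    using vec.span_mono[OF B(3)] span by (simp add: vec.span_span) blast
  have "card B = CARD('d)"
    using vec.dim_eq_card[of B UNIV] B(2) sB by (simp add: card_cart_basis)
  moreover have "finite B" by (rule finite_subset[OF B(1)]) simp
  ultimately obtain f :: "'d \<Rightarrow> complex^'d" where f: "bij_betw f UNIV B"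
    using finite_same_card_bij[of "UNIV :: 'd set" B] by auto
  have "\<exists>i. w $ i = f b" for b
  proof -
    have "f b \<in> B" using bij_betwE[OF f] by simp
    then have "f b \<in> range (($) w)" using B(1) by (rule rev_subsetD)
    then show ?thesis by (auto simp: image_iff)
  qed
  then obtain \<beta> where \<beta>: "\<And>b. w $ \<beta> b = f b" by metis
  have "inj \<beta>"
  proof (rule injI)
    fix x y assume "\<beta> x = \<beta> y"
    then have "f x = f y" unfolding \<beta>[symmetric] by simp
    then show "x = y" using bij_betw_imp_inj_on[OF f] by (simp add: inj_on_eq_iff)
  qed
  moreover have "columns (frame_matrix \<beta> w) = B"
  proof -
    have "column b (frame_matrix \<beta> w) = f b" for b
      by (simp add: column_def frame_matrix_def \<beta> vec_eq_iff)
    then have "columns (frame_matrix \<beta> w) = range f" by (auto simp: columns_def)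
    then show ?thesis using f by (simp add: bij_betw_def)
  qed
  then have "det (frame_matrix \<beta> w) \<noteq> 0"
    using sB matrix_right_invertible_span_columns[of "frame_matrix \<beta> w"]
      invertible_right_inverse[of "frame_matrix \<beta> w"] by (simp add: invertible_det_nz[symmetric])
  ultimately show thesis by (rule that)
qed

definition adjacent :: "('d::finite \<Rightarrow> 'n) \<Rightarrow> (complex^'d)^'n::finite \<Rightarrow> ('n \<times> 'n) set" where
  "adjacent \<beta> A = {(u, v). \<exists>i b. i \<notin> range \<beta> \<and> A $ i $ b \<noteq> 0 \<and> (u = i \<and> v = \<beta> b \<or> u = \<beta> b \<and> v = i)}"

text \<open>If the graph were disconnected, the frame would split along two complementary subspaces.\<close>

lemma adjacent_connected:
  fixes w :: "(complex^'d::finite)^'n::finite" and root :: 'n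
  assumes t: "tight_frame r w" and g: "generic TYPE('d) r" and nz: "det (frame_matrix \<beta> w) \<noteq> 0"
  shows "(root, v) \<in> (adjacent \<beta> (coords \<beta> w))\<^sup>*"
proof -
  define C where "C = {v. (root, v) \<in> (adjacent \<beta> (coords \<beta> w))\<^sup>*}"
  let ?F = "\<lambda>y. frame_matrix \<beta> w *v y"
  \<comment> \<open>The span of the basis vectors whose indices lie in \<open>S\<close>.\<close>
  define V where "V S = ?F ` {y. \<forall>b. \<beta> b \<notin> S \<longrightarrow> y $ b = 0}" for S
  have inv: "invertible (frame_matrix \<beta> w)" using nz by (simp add: invertible_det_nz)
  have injF: "x = y" if "?F x = ?F y" for x y
    using invertible_mult_nz[OF inv, of "x - y"] that by (auto simp: matrix_vector_mult_diff_distrib)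
  have closed: "u \<in> C \<longleftrightarrow> v \<in> C" if "(u, v) \<in> adjacent \<beta> (coords \<beta> w)" for u v
  proof -
    have "(v, u) \<in> adjacent \<beta> (coords \<beta> w)" using that by (auto simp: adjacent_def)
    then show ?thesis using that unfolding C_def by (auto intro: rtrancl_into_rtrancl)
  qed
  have cV: "csubspace (V S)" for S
  proof (rule csubspaceI)
    show "0 \<in> V S" unfolding V_def by (rule image_eqI[of _ _ 0]) auto
    show "x + y \<in> V S" if "x \<in> V S" "y \<in> V S" for x y
      using that unfolding V_def by (auto simp: matrix_vector_right_distrib[symmetric] intro!: imageI)
    show "z *s x \<in> V S" if "x \<in> V S" for z x
      using that unfolding V_def by (auto simp: matrix_vector_mult_complex_simps(3)[symmetric] intro!: imageI)
  qed
  \<comment> \<open>In a union \<open>S\<close> of components, only basis vectors from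
    \<open>S\<close> occur in the expansion of \<open>w $ i\<close> with \<open>i\<close> in
    \<open>S\<close>.\<close>
  have mem: "w $ i \<in> V S" if S: "\<And>u v. (u, v) \<in> adjacent \<beta> (coords \<beta> w) \<Longrightarrow> u \<in> S \<longleftrightarrow> v \<in> S" and i: "i \<in> S" for i S
  proof -
    have "\<forall>b. \<beta> b \<notin> S \<longrightarrow> coords \<beta> w $ i $ b = 0"
    proof (intro allI impI, rule ccontr)
      fix b assume b: "\<beta> b \<notin> S" "coords \<beta> w $ i $ b \<noteq> 0"
      show False
      proof (cases "i \<in> range \<beta>")
        case True
        then obtain b' where "i = \<beta> b'" by blast
        then show False using b i coords_basis[OF nz, of b'] by (auto simp: axis_def split: if_splits)
      next
        case False
        then have "(i, \<beta> b) \<in> adjacent \<beta> (coords \<beta> w)" using b by (auto simp: adjacent_def)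
        then show False using S i b by blast
      qed
    qed
    moreover have "?F (coords \<beta> w $ i) = w $ i" using coords_iff[OF nz] by blast
    ultimately show ?thesis unfolding V_def by (intro image_eqI[of _ _ "coords \<beta> w $ i"]) auto
  qed
  have "C = UNIV"
  proof (rule ccontr)
    assume "C \<noteq> UNIV"
    then obtain j where j: "j \<notin> C" by blast
    have root: "root \<in> C" by (simp add: C_def)
    have mC: "w $ i \<in> V C" if "i \<in> C" for i by (rule mem[OF closed that])
    have mD: "w $ i \<in> V (- C)" if "i \<notin> C" for i by (rule mem) (use closed that in auto)
    have d: "0 < dim (V C)" "0 < dim (V (- C))"
      using mC[OF root] mD[OF j] tight_frame_nz[OF t] by (auto simp only: dim_pos_iff)
    have sub: "subspace (V C)" "subspace (V (- C))" using cV by (auto simp: csubspace_def)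
    have "V C \<inter> V (- C) \<subseteq> {0}"
    proof
      fix x assume "x \<in> V C \<inter> V (- C)"
      then obtain y z where yz: "x = ?F y" "x = ?F z" "\<forall>b. \<beta> b \<notin> C \<longrightarrow> y $ b = 0" "\<forall>b. \<beta> b \<notin> - C \<longrightarrow> z $ b = 0"
        unfolding V_def by blast
      then have "y = z" using injF by metis
      then have "y = 0" using yz(3,4) by (auto simp: vec_eq_iff)
      then show "x \<in> {0}" using yz(1) by simp
    qed
    then have "dim (V C \<inter> V (- C)) = 0" by (simp only: dim_eq_0)
    then have dd: "dim (V C) + dim (V (- C)) \<le> 2 * CARD('d)"
      using dim_sums_Int[OF sub] dim_subset_UNIV[of "{x + y |x y. x \<in> V C \<and> y \<in> V (- C)}"]
      unfolding DIM_complex_vec by linarith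
    have "{i. w $ i \<in> V C} \<union> {i. w $ i \<in> V (- C)} = UNIV" using mC mD by auto
    moreover have "r $ i > 0" for i using t by (simp add: tight_frame_def)
    moreover have "dim (V C) < 2 * CARD('d)" using dd d(2) by simp
    ultimately show False
      using no_complementary_stability[OF _ _ dd subspace_stability_strict[OF t g cV d(1)] subspace_stability[OF t cV]]
      by blast
  qed
  then show ?thesis by (auto simp: C_def)
qed

text \<open>A breadth-first tree: the rank is the distance from the root, and the parent is the last
  vertex before \<open>v\<close> on a shortest path.\<close>

lemma spanning_tree_exists:
  fixes root :: 'n
  assumes "\<And>v. (root, v) \<in> R\<^sup>*"
  obtains parent :: "'n \<Rightarrow> 'n" and rank :: "'n \<Rightarrow> nat" where "rank root = 0"
    "\<And>v. v \<noteq> root \<Longrightarrow> rank v = Suc (rank (parent v)) \<and> (parent v, v) \<in> R"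
proof -
  define rank where "rank v = (LEAST k. (root, v) \<in> R ^^ k)" for v
  have ex: "\<exists>k. (root, v) \<in> R ^^ k" for v using assms[of v] by (simp add: rtrancl_power)
  have path: "(root, v) \<in> R ^^ rank v" for v unfolding rank_def by (rule LeastI_ex[OF ex])
  have "rank root = 0" unfolding rank_def by (rule Least_eq_0) simp
  moreover have "\<exists>u. rank v = Suc (rank u) \<and> (u, v) \<in> R" if v: "v \<noteq> root" for v
  proof -
    obtain k where k: "rank v = Suc k" using path[of v] v by (cases "rank v") auto
    then obtain u where u: "(root, u) \<in> R ^^ k" "(u, v) \<in> R" using path[of v] by auto
    have "rank u \<le> k" unfolding rank_def using u(1) by (rule Least_le)
    moreover have "(root, v) \<in> R ^^ Suc (rank u)" using path[of u] u(2) by auto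
    then have "rank v \<le> Suc (rank u)" unfolding rank_def[of v] by (rule Least_le)
    ultimately show ?thesis using k u(2) by (intro exI[of _ u]) simp
  qed
  then obtain parent where "\<And>v. v \<noteq> root \<Longrightarrow> rank v = Suc (rank (parent v)) \<and> (parent v, v) \<in> R" by metis
  ultimately show thesis by (rule that)
qed

lemma gauge_exists:
  fixes w :: "(complex^'d::finite)^'n::finite"
  assumes t: "tight_frame r w" and g: "generic TYPE('d) r"
  obtains \<beta> :: "'d \<Rightarrow> 'n" and root parent rank where "gauge_tree \<beta> root parent rank" "det (frame_matrix \<beta> w) \<noteq> 0"
    "gauge_tree.admissible \<beta> root parent (coords \<beta> w)"
proof -
  obtain \<beta> :: "'d \<Rightarrow> 'n" where basis: "inj \<beta>" "det (frame_matrix \<beta> w) \<noteq> 0"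
    using tight_frame_has_basis[OF t] by blast
  define root :: 'n where "root = undefined"
  obtain parent rank where tree: "rank root = 0"
    "\<And>v. v \<noteq> root \<Longrightarrow> rank v = Suc (rank (parent v)) \<and> (parent v, v) \<in> adjacent \<beta> (coords \<beta> w)"
    using spanning_tree_exists[of root, OF adjacent_connected[OF t g basis(2)]] by metis
  interpret gauge_tree \<beta> root parent rank
  proof
    show "v \<in> range \<beta> \<longleftrightarrow> parent v \<notin> range \<beta>" if "v \<noteq> root" for v
      using tree(2)[OF that] by (auto simp: adjacent_def)
  qed (use basis tree in auto)
  have "admissible (coords \<beta> w)"
    unfolding admissible_def
  proof (intro allI impI)
    fix v assume v: "v \<noteq> root"
    obtain i b where ib: "i \<notin> range \<beta>" "coords \<beta> w $ i $ b \<noteq> 0"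
      "parent v = i \<and> v = \<beta> b \<or> parent v = \<beta> b \<and> v = i"
      using tree(2)[OF v] by (auto simp: adjacent_def)
    then have "edge v = (i, b)" using basis(1) by (auto simp: edge_def dest: injD)
    then show "coords \<beta> w $ fst (edge v) $ snd (edge v) \<noteq> 0" using ib by simp
  qed
  with gauge_tree_axioms basis(2) that show thesis by blast
qed

subsection \<open>Charts of the moduli spaces\<close>

lemma equivalent_nz: "equivalent w w' \<Longrightarrow> (\<And>i. w $ i \<noteq> 0) \<Longrightarrow> w' $ i \<noteq> 0"
  unfolding equivalent_def using invertible_mult_nz by fastforce

lemma equivalent_sym:
  fixes w w' :: "(complex^'d::finite)^'n::finite"
  assumes "equivalent w w'" shows "equivalent w' w"
proof -
  obtain k \<tau> where k: "invertible k" "\<And>i. \<tau> i \<noteq> 0" "\<And>i. w' $ i = \<tau> i *s (k *v w $ i)"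
    using assms unfolding equivalent_def by metis
  obtain q where q: "q ** k = mat 1" "k ** q = mat 1" using k(1) by (auto simp: invertible_def)
  have "w $ i = inverse (\<tau> i) *s (q *v w' $ i)" for i
    using k(2)[of i] q by (simp add: k(3) matrix_vector_mult_complex_simps matrix_vector_mul_assoc vector_smult_assoc)
  moreover have "invertible q" using q by (auto simp: invertible_def)
  ultimately show ?thesis using k(2) by (intro equivalentI[of q "\<lambda>i. inverse (\<tau> i)"]) auto
qed

lemma act_scaled:
  assumes "\<And>i. t i > 0" shows "act r h (\<chi> i. t i *\<^sub>R P $ i) = act r h P"
proof -
  have "t i \<noteq> 0" for i using assms[of i] by simp
  then show ?thesis by (simp add: act_def vec_eq_iff conj_scaleR trace_scaleR)
qed

text \<open>Rescaling vectors affects only lengths, which the outer \<open>act\<close> forgets; the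
  weights \<open>1\<close> of the inner one are an arbitrary choice.\<close>

lemma polygon_of_equivalent:
  fixes w w' :: "(complex^'d::finite)^'n::finite"
  assumes eq: "equivalent w w'" and nz: "\<And>i. w $ i \<noteq> 0"
  obtains k where "invertible k" "\<And>r h. act r h (polygon_of w') = act r h (act 1 k (polygon_of w))"
proof -
  obtain k \<tau> where k: "invertible k" "\<And>i. \<tau> i \<noteq> 0" "\<And>i. w' $ i = \<tau> i *s (k *v w $ i)"
    using eq unfolding equivalent_def by metis
  have nz': "k *v w $ i \<noteq> 0" for i using invertible_mult_nz[OF k(1) nz] .
  let ?t = "\<lambda>i. (cmod (\<tau> i))\<^sup>2 * (norm (k *v w $ i))\<^sup>2"
  have t: "?t i > 0" for i using k(2) nz' by simp
  have "act 1 k (polygon_of w) $ i = (1 / (norm (k *v w $ i))\<^sup>2) *\<^sub>R line_projection (k *v w $ i)" for i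
    by (simp add: act_def polygon_of_def conjugate_line_projection trace_line_projection del: of_real_power)
  then have eq: "polygon_of w' = (\<chi> i. ?t i *\<^sub>R act 1 k (polygon_of w) $ i)"
    using nz' by (simp add: polygon_of_def vec_eq_iff[of "vec_lambda _"] k(3) line_projection_scale)
  show thesis by (rule that[OF k(1)]) (unfold eq, rule act_scaled[OF t])
qed

lemma config_act:
  assumes "config P" "invertible h" "\<And>i. r $ i > 0" shows "config (act r h P)"
proof -
  obtain w where w: "\<And>i. w $ i \<noteq> 0" "P = polygon_of w" using assms(1) by (auto simp: config_def)
  have nz: "h *v w $ i \<noteq> 0" for i using invertible_mult_nz[OF assms(2) w(1)] .
  have "(sqrt (r $ i) / norm (h *v w $ i)) *\<^sub>R (h *v w $ i) \<noteq> 0" for i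
    using nz[of i] assms(3)[of i] by simp
  then show ?thesis
    unfolding config_def w(2) act_polygon_of[OF assms(3) nz]
    by (intro exI[of _ "\<chi> i. (sqrt (r $ i) / norm (h *v w $ i)) *\<^sub>R (h *v w $ i)"]) simp
qed

lemma balance_equivalent:
  fixes w w' :: "(complex^'d::finite)^'n::finite"
  assumes eq: "equivalent w w'" and nz: "\<And>i. w $ i \<noteq> 0" and h: "balancing s (polygon_of w) h"
    and g: "generic TYPE('d) s"
  shows "\<exists>h. balancing s (polygon_of w') h" "orbit (balance s (polygon_of w')) = orbit (balance s (polygon_of w))"
proof -
  obtain k where k: "invertible k" "\<And>r h. act r h (polygon_of w') = act r h (act 1 k (polygon_of w))"
    using polygon_of_equivalent[OF eq nz] by blast
  have cfg: "config (polygon_of w)" using nz by (auto simp: config_def)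
  have one: "(1 :: real^'n) $ i > 0" for i by simp
  have cfg': "config (act 1 k (polygon_of w))" by (rule config_act[OF cfg k(1) one])
  note * = orbit_balance_act[OF cfg h k(1) one g cfg']
  show "\<exists>h. balancing s (polygon_of w') h" using *(2) by (simp add: balancing_def k(2))
  have "balance s (polygon_of w') = balance s (act 1 k (polygon_of w))"
    by (simp add: balance_def balancer_def k(2))
  then show "orbit (balance s (polygon_of w')) = orbit (balance s (polygon_of w))" using *(1) by simp
qed

lemma balance_polygon_of:
  fixes w :: "(complex^'d::finite)^'n::finite"
  assumes nz: "\<And>i. w $ i \<noteq> 0" and h: "balancing s (polygon_of w) h" and g: "generic TYPE('d) s"
  obtains w' where "tight_frame s w'" "balance s (polygon_of w) = polygon_of w'" "equivalent w w'"
proof -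
  have cfg: "config (polygon_of w)" using nz by (auto simp: config_def)
  obtain k where k: "balancer s (polygon_of w) k" using balancer_exists[OF cfg h] .
  have ik: "invertible k" and a: "act s k (polygon_of w) \<in> closed_polygons s"
    using k posdef_invertible by (auto simp: balancer_def)
  obtain w' where w': "tight_frame s w'" "act s k (polygon_of w) = polygon_of w'"
    using a unfolding closed_polygons_iff by blast
  have sp: "s $ i > 0" for i using closed_polygons_pos[OF a] .
  have nz': "k *v w $ i \<noteq> 0" for i using invertible_mult_nz[OF ik nz] .
  have "\<exists>z. z \<noteq> 0 \<and> w' $ i = z *s (k *v w $ i)" for i
  proof -
    have "line_projection ((sqrt (s $ i) / norm (k *v w $ i)) *\<^sub>R (k *v w $ i)) = line_projection (w' $ i)"
      using w'(2) unfolding act_polygon_of[OF sp nz'] by (simp add: polygon_of_def vec_eq_iff[of "vec_lambda _"])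
    then obtain z where z: "w' $ i = z *s ((sqrt (s $ i) / norm (k *v w $ i)) *\<^sub>R (k *v w $ i))"
      using line_projection_eq_imp_parallel by blast
    then have "w' $ i = (z * of_real (sqrt (s $ i) / norm (k *v w $ i))) *s (k *v w $ i)"
      by (simp add: vec_eq_iff scaleR_conv_of_real[where 'a = complex])
    moreover have "z * of_real (sqrt (s $ i) / norm (k *v w $ i)) \<noteq> 0"
      using tight_frame_nz[OF w'(1), of i] calculation by auto
    ultimately show ?thesis by blast
  qed
  then obtain \<tau> where "\<And>i. \<tau> i \<noteq> 0 \<and> w' $ i = \<tau> i *s (k *v w $ i)" by metis
  then have "equivalent w w'" using ik by (intro equivalentI[of k \<tau>]) auto
  moreover have "balance s (polygon_of w) = polygon_of w'" using balance_eq[OF cfg k g] w'(2) by simp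
  ultimately show thesis using that w'(1) by blast
qed

lemma polygon_of_eq_equivalent:
  fixes w w' :: "(complex^'d::finite)^'n::finite"
  assumes "polygon_of w = polygon_of w'" "\<And>i. w' $ i \<noteq> 0"
  shows "equivalent w w'"
proof -
  have "\<exists>z. z \<noteq> 0 \<and> w' $ i = z *s (mat 1 *v w $ i)" for i
  proof -
    have "line_projection (w $ i) = line_projection (w' $ i)"
      using assms(1) by (simp add: polygon_of_def vec_eq_iff[of "vec_lambda _"])
    then obtain z where "w' $ i = z *s w $ i" using line_projection_eq_imp_parallel by blast
    then show ?thesis using assms(2)[of i] by (intro exI[of _ z]) auto
  qed
  then obtain \<tau> where "\<And>i. \<tau> i \<noteq> 0 \<and> w' $ i = \<tau> i *s (mat 1 *v w $ i)" by metis
  moreover have "invertible (mat 1 :: complex^'d^'d)" by (auto simp: invertible_def)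
  ultimately show ?thesis by (intro equivalentI[of "mat 1" \<tau>]) auto
qed

lemma equivalent_trans:
  fixes w w' w'' :: "(complex^'d::finite)^'n::finite"
  assumes "equivalent w w'" "equivalent w' w''" shows "equivalent w w''"
proof -
  obtain k \<tau> where k: "invertible k" "\<And>i. \<tau> i \<noteq> 0" "\<And>i. w' $ i = \<tau> i *s (k *v w $ i)"
    using assms(1) unfolding equivalent_def by metis
  obtain l \<sigma> where l: "invertible l" "\<And>i. \<sigma> i \<noteq> 0" "\<And>i. w'' $ i = \<sigma> i *s (l *v w' $ i)"
    using assms(2) unfolding equivalent_def by metis
  have "w'' $ i = (\<sigma> i * \<tau> i) *s ((l ** k) *v w $ i)" for i
    by (simp add: l(3) k(3) matrix_vector_mult_complex_simps matrix_vector_mul_assoc vector_smult_assoc)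
  then show ?thesis
    using invertible_mult[OF l(1) k(1)] k(2) l(2) by (intro equivalentI[of "l ** k" "\<lambda>i. \<sigma> i * \<tau> i"]) auto
qed

lemma orbit_eq_equivalent:
  fixes w w' :: "(complex^'d::finite)^'n::finite"
  assumes "orbit (polygon_of w) = orbit (polygon_of w')" "\<And>i. w' $ i \<noteq> 0"
  shows "equivalent w w'"
proof -
  obtain u where u: "u \<in> unitary_group" "polygon_of w' = conjugate u (polygon_of w)"
    using assms(1) unfolding orbit_eq_iff by blast
  have "conjugate u (polygon_of w) = polygon_of (\<chi> i. u *v w $ i)"
    by (simp add: conjugate_def polygon_of_def conjugate_line_projection)
  then have "polygon_of (\<chi> i. u *v w $ i) = polygon_of w'" using u(2) by simp
  from polygon_of_eq_equivalent[OF this assms(2)] have "equivalent (\<chi> i. u *v w $ i) w'" .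
  moreover have "invertible u" using u(1) by (auto simp: invertible_def unitary_group_def)
  then have "equivalent w (\<chi> i. u *v w $ i)" by (intro equivalentI[of u "\<lambda>_. 1"]) auto
  ultimately show ?thesis using equivalent_trans by blast
qed

lemma smooth_on_polygon_of [smooth_intros]:
  fixes w :: "'z::euclidean_space \<Rightarrow> (complex^'d::finite)^'n::finite"
  shows "open U \<Longrightarrow> smooth_on U w \<Longrightarrow> smooth_on U (\<lambda>x. polygon_of (w x))"
  unfolding polygon_of_def line_projection_def by (intro smooth_intros) auto

lemma smooth_on_coords:
  fixes w :: "'z::euclidean_space \<Rightarrow> (complex^'d::finite)^'n::finite"
  assumes "open U" "smooth_on U w" "\<And>x. x \<in> U \<Longrightarrow> det (frame_matrix \<beta> (w x)) \<noteq> 0"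
  shows "smooth_on U (\<lambda>x. coords \<beta> (w x))"
proof -
  have 1: "smooth_on U (\<lambda>x. frame_matrix \<beta> (w x))"
    unfolding frame_matrix_def by (intro smooth_intros assms)
  have 2: "smooth_on U (\<lambda>x. if c = b then w x $ i $ a else frame_matrix \<beta> (w x) $ a $ c)" for a b c i
    by (cases "c = b") (simp_all add: smooth_on_vec_nth 1 assms)
  show ?thesis unfolding coords_def by (intro smooth_intros assms 1 2)
qed

section \<open>Normal forms as an affine slice, and local lifts of polygons to vectors\<close>

context gauge_tree
begin

definition normal_form :: "(complex^'d)^'n \<Rightarrow> (complex^'d)^'n" where
  "normal_form w = normalise (coords \<beta> w)"

definition in_domain :: "(complex^'d)^'n \<Rightarrow> bool" where
  "in_domain w \<longleftrightarrow> det (frame_matrix \<beta> w) \<noteq> 0 \<and> admissible (coords \<beta> w)"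

lemma normal_form_equivalent:
  assumes "in_domain w" "equivalent w w'"
  shows "in_domain w'" "normal_form w' = normal_form w"
proof -
  have nz: "det (frame_matrix \<beta> w) \<noteq> 0" and ad: "admissible (coords \<beta> w)"
    using assms(1) by (auto simp: in_domain_def)
  obtain k \<tau> where k: "invertible k" "\<And>i. \<tau> i \<noteq> 0" "\<And>i. w' $ i = \<tau> i *s (k *v w $ i)"
    using assms(2) unfolding equivalent_def by metis
  note c = coords_equivalent[OF nz k]
  show "in_domain w'" "normal_form w' = normal_form w"
    using normalise_equivalent[where A' = "coords \<beta> w'", OF ad k(2) c(2)] c(1)
    by (simp_all add: in_domain_def normal_form_def)
qed

lemma equivalent_normal_form:
  assumes "in_domain w" shows "equivalent w (normal_form w)"
proof -
  have nz: "det (frame_matrix \<beta> w) \<noteq> 0" and ad: "admissible (coords \<beta> w)"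
    using assms by (auto simp: in_domain_def)
  let ?A = "coords \<beta> w"
  \<comment> \<open>The basis scaled by the tree factors; it carries the normal form back to
    \<open>w\<close> up to scalars.\<close>
  define k where "k = frame_matrix \<beta> w ** (\<chi> a b. if a = b then factor ?A (\<beta> b) else 0)"
  have diag: "(\<chi> a b. if a = b then factor ?A (\<beta> b) else 0) *v y = (\<chi> b. factor ?A (\<beta> b) * y $ b)" for y :: "complex^'d"
    by (simp add: vec_eq_iff matrix_vector_mult_def if_distrib if_distribR cong: if_cong)
  have "y = 0" if "k *v y = 0" for y
  proof -
    have "(\<chi> b. factor ?A (\<beta> b) * y $ b) = 0"
      using that invertible_mult_nz[of "frame_matrix \<beta> w"] nz
      unfolding k_def matrix_vector_mul_assoc[symmetric] diag by (metis invertible_det_nz)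
    then show ?thesis using factor_nz[OF ad] by (simp add: vec_eq_iff)
  qed
  then have ik: "invertible k"
    using matrix_left_invertible_ker[of k] invertible_left_inverse by blast
  have "w $ i = inverse (factor ?A i) *s (k *v normal_form w $ i)" for i
  proof -
    have "(\<chi> b. factor ?A (\<beta> b) * normal_form w $ i $ b) = factor ?A i *s ?A $ i"
      using factor_nz[OF ad] by (simp add: normal_form_def normalise_def vec_eq_iff)
    then have "k *v normal_form w $ i = factor ?A i *s (frame_matrix \<beta> w *v ?A $ i)"
      unfolding k_def matrix_vector_mul_assoc[symmetric] diag by (simp add: matrix_vector_mult_complex_simps)
    moreover have "frame_matrix \<beta> w *v ?A $ i = w $ i" using coords_iff[OF nz] by blast
    ultimately show ?thesis using factor_nz[OF ad, of i] by (simp add: vector_smult_assoc)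
  qed
  then have "equivalent (normal_form w) w"
    using factor_nz[OF ad] ik by (intro equivalentI[of k "\<lambda>i. inverse (factor ?A i)"]) auto
  then show ?thesis by (rule equivalent_sym)
qed

text \<open>The forced entries of a normal form, with zeros in the free places, so that the normal
  forms lie in the affine space \<open>base\<close> plus the linear space
  \<open>slice\<close>.\<close>

definition base :: "(complex^'d)^'n" where
  "base = (\<chi> i b. if i \<in> range \<beta> then (if i = \<beta> b then 1 else 0) else if (i, b) \<in> tree then 1 else 0)"

definition slice :: "((complex^'d)^'n) set" where
  "slice = {z. \<forall>i b. (i, b) \<notin> free \<longrightarrow> z $ i $ b = 0}"

lemma normal_form_in_slice:
  assumes "in_domain w" shows "normal_form w - base \<in> slice"
proof -
  have nz: "det (frame_matrix \<beta> w) \<noteq> 0" and ad: "admissible (coords \<beta> w)"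
    using assms by (auto simp: in_domain_def)
  have "normal_form w $ i $ b = base $ i $ b" if ib: "(i, b) \<notin> free" for i b
  proof (cases "i \<in> range \<beta>")
    case True
    then obtain b' where i: "i = \<beta> b'" by blast
    then show ?thesis
      using normalise_basis[OF ad coords_basis[OF nz], of b'] \<beta>
      by (auto simp: normal_form_def base_def axis_def inj_eq)
  next
    case False
    then have "(i, b) \<in> tree" using ib by (simp add: free_def)
    then obtain v where v: "v \<noteq> root" "(i, b) = edge v" by (auto simp: tree_def)
    then have "normal_form w $ i $ b = 1" using normalise_edge[OF ad v(1)] by (simp add: normal_form_def v(2)[symmetric])
    then show ?thesis using False \<open>(i, b) \<in> tree\<close> by (simp add: base_def)
  qed
  then show ?thesis by (simp add: slice_def)
qed

lemma slice_normal_form: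
  assumes "z \<in> slice" shows "in_domain (base + z)" "normal_form (base + z) = base + z"
proof -
  let ?w = "base + z"
  have z: "z $ i $ b = 0" if "(i, b) \<notin> free" for i b using assms that by (simp add: slice_def)
  have wb: "?w $ \<beta> b = axis b 1" for b
    using z \<beta> by (auto simp: base_def vec_eq_iff axis_def free_def inj_eq)
  then have fm: "frame_matrix \<beta> ?w = mat 1"
    by (simp add: frame_matrix_def vec_eq_iff mat_def axis_def)
  then have nz: "det (frame_matrix \<beta> ?w) \<noteq> 0" by simp
  have c: "coords \<beta> ?w = ?w"
  proof -
    have "?w $ i = coords \<beta> ?w $ i" for i
      using coords_iff[OF nz, of "?w $ i" i] by (simp add: fm)
    then show ?thesis by (simp add: vec_eq_iff[of "coords \<beta> ?w"])
  qed
  have e: "?w $ fst (edge v) $ snd (edge v) = 1" if v: "v \<noteq> root" for v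
  proof -
    have "edge v \<in> tree" using v by (simp add: tree_def)
    then show ?thesis using z[of "fst (edge v)" "snd (edge v)"] fst_edge[OF v] by (simp add: base_def free_def)
  qed
  show "in_domain ?w" using nz e by (simp add: in_domain_def admissible_def c)
  show "normal_form ?w = ?w" unfolding normal_form_def c by (rule normalise_normalised[OF e])
qed

text \<open>Near \<open>polygon_of w0\<close> the vectors \<open>e $ i *v w0 $ i\<close> span the lines of the polygon \<open>e\<close>.\<close>

definition lift :: "(complex^'d)^'n \<Rightarrow> ('d, 'n) polygon \<Rightarrow> (complex^'d)^'n" where
  "lift w0 e = (\<chi> i. e $ i *v w0 $ i)"

lemma smooth_on_lift: "open U \<Longrightarrow> smooth_on U (lift w0)"
  unfolding lift_def matrix_vector_mult_def by (intro smooth_intros)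

lemma equivalent_lift:
  assumes "\<And>i. lift w0 (polygon_of w) $ i \<noteq> 0" shows "equivalent w (lift w0 (polygon_of w))"
proof -
  have l: "lift w0 (polygon_of w) $ i = hinner (w $ i) (w0 $ i) *s (mat 1 *v w $ i)" for i
    by (simp add: lift_def polygon_of_def line_projection_mult)
  then have "hinner (w $ i) (w0 $ i) \<noteq> 0" for i using assms[of i] by auto
  moreover have "invertible (mat 1 :: complex^'d^'d)" by (auto simp: invertible_def)
  ultimately show ?thesis using l by (intro equivalentI[of "mat 1" "\<lambda>i. hinner (w $ i) (w0 $ i)"]) auto
qed

lemma lift_nz:
  assumes "\<And>i. w0 $ i \<noteq> 0" shows "lift w0 (polygon_of w0) $ i \<noteq> 0"
  using assms[of i] by (simp add: lift_def polygon_of_def line_projection_mult hinner_self)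

definition lift_domain :: "(complex^'d)^'n \<Rightarrow> ('d, 'n) polygon set" where
  "lift_domain w0 = {e. (\<forall>i. lift w0 e $ i \<noteq> 0) \<and> in_domain (lift w0 e)}"

lemma open_lift_domain: "open (lift_domain w0)"
proof -
  have cl: "continuous_on S (lift w0)" for S
    using smooth_on_continuous_on[OF smooth_on_lift[OF open_UNIV]] continuous_on_subset by blast
  \<comment> \<open>The determinant condition is split off first, because the coordinates are smooth
    only where it holds.\<close>
  define A where "A = {e. (\<forall>i. lift w0 e $ i \<noteq> 0)} \<inter> {e. det (frame_matrix \<beta> (lift w0 e)) \<noteq> 0}"
  have "open {e. lift w0 e $ i \<noteq> 0}" for i
    by (intro open_Collect_neq continuous_intros cl)
  then have "open (\<Inter>i. {e. lift w0 e $ i \<noteq> 0})" by (intro open_INT) auto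
  moreover have "{e. \<forall>i. lift w0 e $ i \<noteq> 0} = (\<Inter>i. {e. lift w0 e $ i \<noteq> 0})" by auto
  moreover have "smooth_on UNIV (\<lambda>e. det (frame_matrix \<beta> (lift w0 e)))"
    unfolding frame_matrix_def by (intro smooth_intros smooth_on_lift) auto
  then have "open {e. det (frame_matrix \<beta> (lift w0 e)) \<noteq> 0}"
    by (intro open_Collect_neq smooth_on_continuous_on continuous_intros)
  ultimately have A: "open A" by (simp add: A_def open_Int)
  have "smooth_on A (\<lambda>e. coords \<beta> (lift w0 e))"
    by (intro smooth_on_coords A smooth_on_lift) (simp add: A_def)
  then have cc: "continuous_on A (\<lambda>e. coords \<beta> (lift w0 e))" by (rule smooth_on_continuous_on)
  have "open (A \<inter> (\<lambda>e. coords \<beta> (lift w0 e)) -` {x. admissible x})"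
  proof (rule continuous_open_preimage[OF cc A])
    have "open {x :: (complex^'d)^'n. v \<noteq> root \<longrightarrow> x $ fst (edge v) $ snd (edge v) \<noteq> 0}" for v
      by (cases "v = root") (auto intro!: open_Collect_neq continuous_intros)
    then have "open (\<Inter>v. {x :: (complex^'d)^'n. v \<noteq> root \<longrightarrow> x $ fst (edge v) $ snd (edge v) \<noteq> 0})"
      by (intro open_INT) auto
    moreover have "{x. admissible x} = (\<Inter>v. {x :: (complex^'d)^'n. v \<noteq> root \<longrightarrow> x $ fst (edge v) $ snd (edge v) \<noteq> 0})"
      by (auto simp: admissible_def)
    ultimately show "open {x. admissible x}" by simp
  qed
  moreover have "lift_domain w0 = A \<inter> (\<lambda>e. coords \<beta> (lift w0 e)) -` {x. admissible x}"
    by (auto simp: lift_domain_def A_def in_domain_def)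
  ultimately show ?thesis by simp
qed

lemma smooth_on_normal_form_lift: "smooth_on (lift_domain w0) (\<lambda>e. normal_form (lift w0 e))"
  unfolding normal_form_def
  by (intro smooth_on_normalise smooth_on_coords smooth_on_lift open_lift_domain)
    (auto simp: lift_domain_def in_domain_def)

end

text \<open>All charts have to take values in one subspace of the type of polygons; we use a coordinate
  subspace in a fixed row of each matrix.\<close>

definition model_space :: "('n \<times> 'd) set \<Rightarrow> ('d::finite, 'n::finite) polygon set" where
  "model_space Q = {e. \<forall>i a b. a \<noteq> undefined \<or> (i, b) \<notin> Q \<longrightarrow> e $ i $ a $ b = 0}"

lemma subspace_model_space: "subspace (model_space Q)"
  by (auto simp: subspace_def model_space_def)

lemma (in gauge_tree) slice_iso:
  assumes card: "card free = card Q"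
  obtains \<iota> :: "('d, 'n) polygon \<Rightarrow> (complex^'d)^'n" and \<kappa>
  where "bounded_linear \<iota>" "bounded_linear \<kappa>" "\<And>e. \<iota> e \<in> slice" "\<And>z. \<kappa> z \<in> model_space Q"
    "\<And>e. e \<in> model_space Q \<Longrightarrow> \<kappa> (\<iota> e) = e" "\<And>z. z \<in> slice \<Longrightarrow> \<iota> (\<kappa> z) = z"
proof -
  have "finite free" "finite Q" by auto
  then obtain f where f: "bij_betw f free Q" using card finite_same_card_bij by blast
  define f' where "f' = the_inv_into free f"
  have f': "f' (f p) = p" "f p \<in> Q" if "p \<in> free" for p
    using f that by (auto simp: f'_def bij_betw_def the_inv_into_f_f)
  have ff: "f (f' p) = p" "f' p \<in> free" if "p \<in> Q" for p
    using f that f' by (auto simp: bij_betw_def f'_def f_the_inv_into_f the_inv_into_into)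
  define \<iota> :: "('d, 'n) polygon \<Rightarrow> (complex^'d)^'n" where
    "\<iota> e = (\<chi> i b. if (i, b) \<in> free then e $ fst (f (i, b)) $ undefined $ snd (f (i, b)) else 0)" for e
  define \<kappa> :: "(complex^'d)^'n \<Rightarrow> ('d, 'n) polygon" where
    "\<kappa> z = (\<chi> i a b. if a = undefined \<and> (i, b) \<in> Q then z $ fst (f' (i, b)) $ snd (f' (i, b)) else 0)" for z
  have "bounded_linear \<iota>"
    by (rule linear_conv_bounded_linear[THEN iffD1], rule linearI) (auto simp: \<iota>_def vec_eq_iff)
  moreover have "bounded_linear \<kappa>"
    by (rule linear_conv_bounded_linear[THEN iffD1], rule linearI) (auto simp: \<kappa>_def vec_eq_iff)
  moreover have "\<iota> e \<in> slice" for e by (simp add: slice_def \<iota>_def)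
  moreover have "\<kappa> z \<in> model_space Q" for z by (auto simp: model_space_def \<kappa>_def)
  moreover have "\<kappa> (\<iota> e) = e" if "e \<in> model_space Q" for e
  proof -
    have "\<kappa> (\<iota> e) $ i $ a $ b = e $ i $ a $ b" for i a b
      using that ff[of "(i, b)"] by (auto simp: \<kappa>_def \<iota>_def model_space_def)
    then show ?thesis by (simp add: vec_eq_iff)
  qed
  moreover have "\<iota> (\<kappa> z) = z" if "z \<in> slice" for z
  proof -
    have "\<iota> (\<kappa> z) $ i $ b = z $ i $ b" for i b
      using that f'[of "(i, b)"] by (auto simp: \<kappa>_def \<iota>_def slice_def)
    then show ?thesis by (simp add: vec_eq_iff)
  qed
  ultimately show thesis by (rule that)
qed

text \<open>The chart takes an orbit to the free entries of the normal form of any frame over it;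
  its inverse balances a normal form. Smoothness of the chart is checked with \<open>lift\<close>, a
  smooth choice of vectors in the lines near a given polygon, and smoothness of the inverse is that
  of \<open>balance\<close>.\<close>

lemma (in gauge_tree) moduli_space_chart:
  fixes r :: "real^'n"
  assumes gen: "generic TYPE('d) r" and w0: "tight_frame r w0" "in_domain w0" and card: "card free = card Q"
  shows "\<exists>U V \<phi>. openin (stop (moduli_space r)) U \<and> orbit (polygon_of w0) \<in> U \<and>
    openin (top_of_set (model_space Q :: ('d, 'n) polygon set)) V \<and>
    diffeomorphism (open_subspace (moduli_space r :: ('d, 'n) polygon set smooth_space) U) (eucl_space V) \<phi>"
proof -
  obtain \<iota> :: "('d, 'n) polygon \<Rightarrow> (complex^'d)^'n" and \<kappa> where \<iota>: "bounded_linear \<iota>" and \<kappa>: "bounded_linear \<kappa>"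
    and \<iota>s: "\<And>e. \<iota> e \<in> slice" and \<kappa>m: "\<And>z. \<kappa> z \<in> model_space Q"
    and \<kappa>\<iota>: "\<And>e. e \<in> model_space Q \<Longrightarrow> \<kappa> (\<iota> e) = e" and \<iota>\<kappa>: "\<And>z. z \<in> slice \<Longrightarrow> \<iota> (\<kappa> z) = z"
    using slice_iso[OF card] by blast
  define M :: "('d, 'n) polygon set" where "M = closed_polygons r"
  define G where "G = {w :: (complex^'d)^'n. tight_frame r w \<and> in_domain w}"
  define U where "U = (\<lambda>w. orbit (polygon_of w)) ` G"
  define N where "N = polygon_of ` G"
  define B where "B z = base + \<iota> z" for z
  \<comment> \<open>Only normal forms that can be balanced occur; by \<open>balancer_smooth\<close>
    they form an open set.\<close>
  define V where "V = {z \<in> model_space Q. (\<forall>i. B z $ i \<noteq> 0) \<and> (\<exists>h. balancing r (polygon_of (B z)) h)}"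
  define \<sigma> where "\<sigma> z = balance r (polygon_of (B z))" for z
  \<comment> \<open>The chosen frame is unique up to phases, which the normal form does not
    see.\<close>
  define \<xi> where "\<xi> e = \<kappa> (normal_form (SOME w. tight_frame r w \<and> polygon_of w = e) - base)" for e
  have rp: "r $ i > 0" for i using w0(1) by (simp add: tight_frame_def)
  have \<xi>: "\<xi> (polygon_of w) = \<kappa> (normal_form w - base)" if "w \<in> G" for w
  proof -
    let ?w = "SOME w'. tight_frame r w' \<and> polygon_of w' = polygon_of w"
    have "tight_frame r ?w \<and> polygon_of ?w = polygon_of w"
      by (rule someI[of _ w]) (use that in \<open>simp add: G_def\<close>)
    then have "equivalent w ?w"
      using polygon_of_eq_equivalent[of w ?w] tight_frame_nz[of r ?w] by metis
    then have "normal_form ?w = normal_form w"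
      using normal_form_equivalent(2)[of w ?w] that unfolding G_def by blast
    then show ?thesis unfolding \<xi>_def by simp
  qed
  have NM: "N = {e \<in> M. orbit e \<in> U}"
  proof (intro set_eqI iffI)
    fix e assume "e \<in> N"
    then show "e \<in> {e \<in> M. orbit e \<in> U}" unfolding N_def U_def M_def closed_polygons_iff by (auto simp: G_def)
  next
    fix e assume "e \<in> {e \<in> M. orbit e \<in> U}"
    then obtain w w' where w: "tight_frame r w" "e = polygon_of w" "w' \<in> G" "orbit (polygon_of w) = orbit (polygon_of w')"
      unfolding M_def closed_polygons_iff U_def by auto
    then have "equivalent w' w" using tight_frame_nz[OF w(1)] by (intro orbit_eq_equivalent) auto
    then have "w \<in> G" using normal_form_equivalent(1) w by (auto simp: G_def)
    then show "e \<in> N" using w(2) by (simp add: N_def)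
  qed
  have lift_self: "polygon_of w \<in> lift_domain w" if w: "w \<in> G" for w
  proof -
    have nz: "lift w (polygon_of w) $ i \<noteq> 0" for i
      by (rule lift_nz) (use w tight_frame_nz in \<open>auto simp: G_def\<close>)
    then show ?thesis
      using normal_form_equivalent(1)[OF _ equivalent_lift[OF nz]] w by (auto simp: lift_domain_def G_def)
  qed
  have lift_G: "w \<in> G \<and> equivalent w (lift w1 (polygon_of w))"
    if w: "tight_frame r w" "polygon_of w \<in> lift_domain w1" for w w1
  proof -
    have "equivalent w (lift w1 (polygon_of w))"
      by (rule equivalent_lift) (use w in \<open>auto simp: lift_domain_def\<close>)
    moreover from this have "in_domain w"
      using normal_form_equivalent(1)[OF _ equivalent_sym] w by (auto simp: lift_domain_def)
    ultimately show ?thesis using w by (simp add: G_def)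
  qed
  have "N = M \<inter> (\<Union>w\<in>G. lift_domain w)"
  proof (intro set_eqI iffI)
    fix e assume "e \<in> N"
    then have "e \<in> M" by (simp add: NM)
    moreover obtain w where "w \<in> G" "e = polygon_of w" using \<open>e \<in> N\<close> by (auto simp: N_def)
    ultimately show "e \<in> M \<inter> (\<Union>w\<in>G. lift_domain w)" using lift_self by blast
  next
    fix e assume "e \<in> M \<inter> (\<Union>w\<in>G. lift_domain w)"
    then obtain w1 where "e \<in> closed_polygons r" "e \<in> lift_domain w1" by (auto simp: M_def)
    moreover from this obtain w where "tight_frame r w" "e = polygon_of w" unfolding closed_polygons_iff by blast
    ultimately have "tight_frame r w" "e = polygon_of w" "e \<in> lift_domain w1" by auto
    then show "e \<in> N" using lift_G[of w w1] by (simp add: N_def)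
  qed
  then have oN: "openin (top_of_set M) N" using open_lift_domain by (simp add: openin_open_Int open_UN)
  have "N \<subseteq> M" by (auto simp: NM)
  then have UM: "U \<subseteq> orbit ` M" by (auto simp: U_def N_def)
  have oU: "openin (stop (moduli_space r)) U"
    using oN UM unfolding NM moduli_space_def by (simp add: openin_quotient_topology M_def)
  have s\<xi>: "locally_smooth N \<xi>"
    unfolding locally_smooth_def
  proof
    fix e assume "e \<in> N"
    then obtain w1 where w1: "w1 \<in> G" "e = polygon_of w1" by (auto simp: N_def)
    \<comment> \<open>Near \<open>w1\<close> the arbitrary choice in \<open>\<xi>\<close> is
      replaced by the smooth lift; both frames are equivalent, so their normal forms agree.\<close>
    let ?g = "\<lambda>e. \<kappa> (normal_form (lift w1 e) - base)"
    have "smooth_on (lift_domain w1) ?g"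
      by (rule smooth_on_bounded_linear[OF \<kappa> open_lift_domain],
          rule smooth_on_diff[OF open_lift_domain smooth_on_normal_form_lift smooth_on_const[OF open_lift_domain]])
    moreover have "?g y = \<xi> y" if y: "y \<in> N \<inter> lift_domain w1" for y
    proof -
      obtain w where w: "w \<in> G" "y = polygon_of w" using y by (auto simp: N_def)
      then have "equivalent w (lift w1 y)" using lift_G[of w w1] y by (simp add: G_def)
      then have "normal_form (lift w1 y) = normal_form w"
        using normal_form_equivalent(2) w(1) by (auto simp: G_def)
      then show ?thesis using \<xi>[OF w(1)] w(2) by simp
    qed
    ultimately show "\<exists>W g. open W \<and> e \<in> W \<and> smooth_on W g \<and> (\<forall>y\<in>N \<inter> W. g y = \<xi> y)"
      using open_lift_domain lift_self[OF w1(1)] w1(2) by blast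
  qed
  have sB: "smooth_on UNIV (\<lambda>z. polygon_of (B z))"
    unfolding B_def by (intro smooth_intros smooth_on_bounded_linear[OF \<iota>]) auto
  have oV: "openin (top_of_set (model_space Q)) V"
    unfolding openin_subopen[of _ V]
  proof
    fix z assume z: "z \<in> V"
    then obtain h where h: "balancing r (polygon_of (B z)) h" and nz: "\<And>i. B z $ i \<noteq> 0" by (auto simp: V_def)
    have cfg: "config (polygon_of (B z))" using nz by (auto simp: config_def)
    obtain k where k: "balancer r (polygon_of (B z)) k" using balancer_exists[OF cfg h] .
    obtain Y \<gamma> where Y: "open Y" "(r, polygon_of (B z)) \<in> Y"
      "\<And>r P. (r, P) \<in> Y \<Longrightarrow> config P \<Longrightarrow> (\<And>i. r $ i > 0) \<Longrightarrow> balancer r P (\<gamma> (r, P))"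
      using balancer_smooth[OF cfg k gen] by metis
    let ?T1 = "(\<lambda>z. (r, polygon_of (B z))) -` Y" and ?T2 = "\<Inter>i. {z. B z $ i \<noteq> 0}"
    have "open ?T1"
      by (intro open_vimage[OF Y(1)] continuous_intros smooth_on_continuous_on[OF sB])
    moreover have "open ?T2"
      unfolding B_def using \<iota>
      by (intro open_INT ballI open_Collect_neq continuous_intros) (auto intro: linear_continuous_on)
    ultimately have "openin (top_of_set (model_space Q)) (model_space Q \<inter> (?T1 \<inter> ?T2))"
      by (intro openin_open_Int open_Int)
    moreover have "model_space Q \<inter> (?T1 \<inter> ?T2) \<subseteq> V"
    proof
      fix y assume y: "y \<in> model_space Q \<inter> (?T1 \<inter> ?T2)"
      then have "config (polygon_of (B y))" by (auto simp: config_def)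
      then have "balancer r (polygon_of (B y)) (\<gamma> (r, polygon_of (B y)))" using Y(3) y rp by blast
      then have "balancing r (polygon_of (B y)) (\<gamma> (r, polygon_of (B y)))"
        using posdef_invertible by (auto simp: balancing_def balancer_def)
      then show "y \<in> V" using y by (auto simp: V_def)
    qed
    moreover have "z \<in> model_space Q \<inter> (?T1 \<inter> ?T2)" using z nz Y(2) by (auto simp: V_def)
    ultimately show "\<exists>T. openin (top_of_set (model_space Q)) T \<and> z \<in> T \<and> T \<subseteq> V" by blast
  qed
  have s\<sigma>: "locally_smooth V \<sigma>"
  proof -
    have 1: "locally_smooth V (\<lambda>z. (r, polygon_of (B z)))"
      by (rule smooth_on_imp_locally_smooth[OF open_UNIV]) (intro smooth_intros sB, auto)
    have "locally_smooth V (\<lambda>z. case (r, polygon_of (B z)) of (r, P) \<Rightarrow> balance r P)"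
      by (rule locally_smooth_compose[OF 1 locally_smooth_balance])
        (use rp gen in \<open>auto simp: V_def config_def\<close>)
    then show ?thesis by (simp add: \<sigma>_def[abs_def])
  qed
  have \<sigma>V: "\<sigma> v \<in> M \<and> orbit (\<sigma> v) \<in> U \<and> \<xi> (\<sigma> v) = v" if v: "v \<in> V" for v
  proof -
    obtain h where h: "balancing r (polygon_of (B v)) h" and nz: "\<And>i. B v $ i \<noteq> 0" using v by (auto simp: V_def)
    obtain w where w: "tight_frame r w" "\<sigma> v = polygon_of w" "equivalent (B v) w"
      unfolding \<sigma>_def using balance_polygon_of[OF nz h gen] by blast
    note nf = slice_normal_form[OF \<iota>s[of v], folded B_def]
    have "w \<in> G" using w normal_form_equivalent(1)[OF nf(1)] by (simp add: G_def)
    moreover have "normal_form w = B v" using normal_form_equivalent(2)[OF nf(1) w(3)] nf(2) by simp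
    then have "\<kappa> (normal_form w - base) = v" using v \<kappa>\<iota> by (simp add: B_def V_def)
    ultimately show ?thesis
      using \<xi>[of w] w by (auto simp: U_def M_def closed_polygons_iff)
  qed
  have \<xi>N: "\<xi> e \<in> V \<and> orbit (\<sigma> (\<xi> e)) = orbit e" if e: "e \<in> N" for e
  proof -
    obtain w where w: "w \<in> G" "e = polygon_of w" using e by (auto simp: N_def)
    have t: "tight_frame r w" and ind: "in_domain w" using w(1) by (auto simp: G_def)
    have wn: "w $ i \<noteq> 0" for i by (rule tight_frame_nz[OF t])
    have Bw: "B (\<xi> e) = normal_form w"
      using \<iota>\<kappa>[OF normal_form_in_slice[OF ind]] \<xi>[OF w(1)] w(2) by (simp add: B_def)
    have eq: "equivalent w (B (\<xi> e))" unfolding Bw by (rule equivalent_normal_form[OF ind])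
    have eM: "e \<in> closed_polygons r" unfolding closed_polygons_iff using t w(2) by blast
    have bal: "balancing r (polygon_of w) (mat 1)"
      using act_one[OF eM] eM w(2) by (auto simp: balancing_def invertible_def)
    have "\<xi> e \<in> V"
      using balance_equivalent(1)[OF eq wn bal gen] equivalent_nz[OF eq wn] \<kappa>m by (auto simp: V_def \<xi>_def)
    moreover have "orbit (\<sigma> (\<xi> e)) = orbit (balance r e)"
      unfolding \<sigma>_def w(2)[symmetric] using balance_equivalent(2)[OF eq wn bal gen] w(2) by simp
    moreover have "orbit (balance r e) = orbit e"
    proof -
      obtain k where k: "balancer r e k" using balancer_exists[OF config_closed_polygons[OF eM]] bal w(2) by blast
      then have "balancing r e k" using posdef_invertible by (auto simp: balancing_def balancer_def)
      from orbit_act[OF eM this gen] show ?thesis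
        by (simp add: balance_eq[OF config_closed_polygons[OF eM] k gen])
    qed
    ultimately show ?thesis by simp
  qed
  have "\<exists>\<phi>. diffeomorphism (open_subspace (quotient_space (eucl_space M) orbit) U) (eucl_space V) \<phi>"
  proof (rule quotient_chart)
    show "openin (stop (quotient_space (eucl_space M) orbit)) U" using oU by (simp add: moduli_space_def M_def)
    show "locally_smooth {x \<in> M. orbit x \<in> U} \<xi>" using s\<xi> unfolding NM .
    show "\<xi> x \<in> V" if "x \<in> M" "orbit x \<in> U" for x using \<xi>N[of x] that by (auto simp: NM)
    show "\<xi> x = \<xi> y" if "x \<in> M" "y \<in> M" "orbit x \<in> U" "orbit x = orbit y" for x y
    proof -
      have "x \<in> N" "y \<in> N" using that by (auto simp: NM)
      then obtain w w' where w: "w \<in> G" "x = polygon_of w" "w' \<in> G" "y = polygon_of w'" by (auto simp: N_def)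
      have "equivalent w w'"
        using that(4) w tight_frame_nz by (intro orbit_eq_equivalent) (auto simp: G_def)
      then have "normal_form w' = normal_form w" using normal_form_equivalent(2) w(1) by (auto simp: G_def)
      then show ?thesis using \<xi> w by simp
    qed
    show "locally_smooth V \<sigma>" by (rule s\<sigma>)
    show "\<sigma> v \<in> M \<and> orbit (\<sigma> v) \<in> U \<and> \<xi> (\<sigma> v) = v" if "v \<in> V" for v using \<sigma>V[OF that] .
    show "orbit (\<sigma> (\<xi> x)) = orbit x" if "x \<in> M" "orbit x \<in> U" for x using \<xi>N[of x] that by (auto simp: NM)
  qed
  moreover have "orbit (polygon_of w0) \<in> U" using w0 by (simp add: U_def G_def)
  ultimately show ?thesis using oU oV unfolding moduli_space_def M_def by blast
qed

theorem smooth_manifold_moduli_space: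
  fixes r :: "real^'n::finite"
  assumes gen: "generic TYPE('d::finite) r"
  shows "smooth_manifold TYPE(('d, 'n) polygon) (moduli_space r :: ('d, 'n) polygon set smooth_space)"
proof -
  \<comment> \<open>The value of \<open>card free\<close> for every basis and tree, so that a single
    \<open>Q\<close> serves all charts.\<close>
  let ?q = "(CARD('n) - CARD('d)) * CARD('d) - (CARD('n) - 1)"
  have "?q \<le> (CARD('n) - CARD('d)) * CARD('d)" by (rule diff_le_self)
  also have "\<dots> \<le> CARD('n) * CARD('d)" by (intro mult_le_mono1 diff_le_self)
  also have "\<dots> = card (UNIV :: ('n \<times> 'd) set)" by (simp add: card_cartesian_product flip: UNIV_Times_UNIV)
  finally have "?q \<le> card (UNIV :: ('n \<times> 'd) set)" .
  then obtain Q :: "('n \<times> 'd) set" where Q: "card Q = ?q" using obtain_subset_with_card_n by metis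
  have "\<exists>U V \<phi>. openin (stop (moduli_space r)) U \<and> X \<in> U \<and>
      openin (top_of_set (model_space Q :: ('d, 'n) polygon set)) V \<and>
      diffeomorphism (open_subspace (moduli_space r :: ('d, 'n) polygon set smooth_space) U) (eucl_space V) \<phi>"
    if X: "X \<in> topspace (stop (moduli_space r :: ('d, 'n) polygon set smooth_space))" for X
  proof -
    obtain w where w: "tight_frame r w" "X = orbit (polygon_of w)"
      using X unfolding topspace_moduli_space closed_polygons_iff[abs_def] by (auto simp: closed_polygons_iff)
    obtain \<beta> :: "'d \<Rightarrow> 'n" and root parent rank where tree: "gauge_tree \<beta> root parent rank"
      and ad: "det (frame_matrix \<beta> w) \<noteq> 0" "gauge_tree.admissible \<beta> root parent (coords \<beta> w)"
      using gauge_exists[OF w(1) gen] by blast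
    interpret gauge_tree \<beta> root parent rank by (rule tree)
    show ?thesis
      unfolding w(2)
      by (rule moduli_space_chart[OF gen w(1)]) (use ad Q card_free in \<open>simp_all add: in_domain_def\<close>)
  qed
  then show ?thesis
    unfolding smooth_manifold_def
    using Hausdorff_moduli_space second_countable_moduli_space subspace_model_space by blast
qed

theorem corollary4p2p8:
  fixes m n :: nat and \<Delta> :: "(real ^ 'n::finite) set"
  assumes "m \<ge> 1" and "n \<ge> 1"
    and "CARD('d::finite) = m + 1" and "CARD('n) = n"
    and "\<Delta> \<in> chambers TYPE('d)"
  shows "trivial_fiber_bundle {e \<in> (CPol :: ('d, 'n) polygon set). side_lengths e \<in> \<Delta>} \<Delta> side_lengths
    \<and> (\<forall>r\<in>\<Delta>. \<forall>r'\<in>\<Delta>. diffeomorphic_manifolds TYPE(('d, 'n) polygon)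
        (moduli_space r :: ('d, 'n) polygon set smooth_space)
        (moduli_space r' :: ('d, 'n) polygon set smooth_space))"
proof (intro conjI ballI)
  show "trivial_fiber_bundle {e \<in> (CPol :: ('d, 'n) polygon set). side_lengths e \<in> \<Delta>} \<Delta> side_lengths"
    by (rule trivial_bundle_over_chamber[OF assms(5)])
  fix r r' assume "r \<in> \<Delta>" "r' \<in> \<Delta>"
  then show "diffeomorphic_manifolds TYPE(('d, 'n) polygon)
        (moduli_space r :: ('d, 'n) polygon set smooth_space)
        (moduli_space r' :: ('d, 'n) polygon set smooth_space)"
    unfolding diffeomorphic_manifolds_def
    using smooth_manifold_moduli_space chamber(2)[OF assms(5)] moduli_spaces_diffeomorphic[OF assms(5)] by blast
qed

end
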